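(* Let $T_0 \ge 2\pi$ and let $\phi:[T_0,\infty)\to[0,\infty)$ be twice continuously differentiable with $\phi'(t)\le 0$ and $\phi''(t)\ge 0$ for all $t\ge T_0$. Let $A_0, A_1$ be constants such that $|S_1(t)-c_0| \le A_0 + A_1\log t$ for all $t \ge T_0$, where $c_0 = S_1(168\pi)$, and let $A_2 = 1/150$. Suppose $T_0 \le T$ and $\int_T^\infty \phi(t)\log(t/2\pi)\,dt < \infty$. Define \[ E(T) := {\sum_{T\le\gamma}}' \phi(\gamma) - \frac{1}{2\pi}\int_T^\infty \phi(t)\log(t/2\pi)\,dt . \] Then $E(T) = -\phi(T)Q(T) + E_2(T)$, where \[ E_2(T) = -\int_T^\infty \phi'(t)Q(t)\,dt, \] and \[ |E_2(T)| \le 2(A_0 + A_1\log T)\,|\phi'(T)| + (A_1+A_2)\,\phi(T)/T . \]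
   Context: Nontrivial zeros of the Riemann zeta-function $\zeta(s)$ are written $\rho=\beta+i\gamma$. Sums $\sum'$ over $\gamma$ range over ordinates of nontrivial zeros (counted with multiplicity) in the indicated range, where a term with $\gamma$ equal to an endpoint of the range is given weight $\tfrac12$. For $T>0$ not an ordinate of a zero, $N(T)$ is the number of zeros with $0<\gamma\le T$ (with multiplicity), and $S(T)=\pi^{-1}\arg\zeta(\tfrac12+iT)$, obtained by continuous variation along the straight lines from $2$ to $2+iT$ to $\tfrac12+iT$, starting with value $0$; if $T$ is an ordinate of a zero, $N(T)$ and $S(T)$ are defined as the average of the left and right limits. $L(T) = \frac{T}{2\pi}\left(\log\frac{T}{2\pi}-1\right)+\frac78$, and $Q(T)=N(T)-L(T)$. $S_1(T)=\int_0^T S(t)\,dt$. (For example, $A_0=2.067$ and $A_1=0.059$ satisfy the required bound on $S_1$ for $t\ge 2\pi$.) *)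

theory Defs
  imports "HOL-Complex_Analysis.Complex_Analysis"
begin

definition zeta :: "complex \<Rightarrow> complex" where
  "zeta = (THE f. f holomorphic_on (- {1}) \<and>
            (\<forall>s. 1 < Re s \<longrightarrow> f s = (\<Sum>n. 1 / (of_nat (Suc n)) powr s)) \<and> f 1 = 0)"

definition nontrivial_zeros :: "complex set" where
  "nontrivial_zeros = {\<rho>. \<rho> \<noteq> 1 \<and> zeta \<rho> = 0 \<and> (\<forall>n::nat. \<rho> \<noteq> - 2 * of_nat (Suc n))}"

definition mult_zero :: "complex \<Rightarrow> real" where
  "mult_zero \<rho> = real_of_int (zorder zeta \<rho>)"

definition is_ordinate :: "real \<Rightarrow> bool" where
  "is_ordinate T \<longleftrightarrow> (\<exists>\<rho>\<in>nontrivial_zeros. Im \<rho> = T)"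

definition arg_variation :: "(real \<Rightarrow> complex) \<Rightarrow> (complex \<Rightarrow> complex) \<Rightarrow> real" where
  "arg_variation g f = (THE v. \<exists>\<theta>. continuous_on {0..1} \<theta> \<and> \<theta> 0 = 0 \<and>
      (\<forall>t\<in>{0..1}. f (g t) = of_real (norm (f (g t))) * exp (\<i> * of_real (\<theta> t))) \<and> v = \<theta> 1)"

definition S_path :: "real \<Rightarrow> real \<Rightarrow> complex" where
  "S_path T = linepath 2 (Complex 2 T) +++ linepath (Complex 2 T) (Complex (1/2) T)"

definition S0 :: "real \<Rightarrow> real" where
  "S0 T = arg_variation (S_path T) zeta / pi"

definition S :: "real \<Rightarrow> real" where
  "S T = (if is_ordinate T then (Lim (at_left T) S0 + Lim (at_right T) S0) / 2 else S0 T)"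

definition N0 :: "real \<Rightarrow> real" where
  "N0 T = (\<Sum>\<rho>\<in>{\<rho>\<in>nontrivial_zeros. 0 < Im \<rho> \<and> Im \<rho> \<le> T}. mult_zero \<rho>)"

definition N :: "real \<Rightarrow> real" where
  "N T = (if is_ordinate T then (Lim (at_left T) N0 + Lim (at_right T) N0) / 2 else N0 T)"

definition L :: "real \<Rightarrow> real" where
  "L T = T / (2 * pi) * (ln (T / (2 * pi)) - 1) + 7 / 8"

definition Q :: "real \<Rightarrow> real" where
  "Q T = N T - L T"

definition S1 :: "real \<Rightarrow> real" where
  "S1 T = integral {0..T} S"

text \<open>Weighted sum over ordinates gamma >= T (weight 1/2 at gamma = T), with multiplicity.\<close>
definition zero_sum_weight :: "real \<Rightarrow> (real \<Rightarrow> real) \<Rightarrow> complex \<Rightarrow> real" where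
  "zero_sum_weight T \<phi> \<rho> = (if Im \<rho> = T then 1/2 else 1) * mult_zero \<rho> * \<phi> (Im \<rho>)"

end

theory Submission
  imports Defs "HOL-Real_Asymp.Real_Asymp"
begin

text \<open>
  Euler--Maclaurin summation continues \<open>(s - 1) \<zeta>(s)\<close> to \<open>Re s > -1\<close>. For real \<open>s\<close> in \<open>(-1, 0)\<close> the
  functional equation follows from Tonelli's theorem alone, by evaluating the Mellin integral of
  \<open>1/(exp x - 1) + 1/2 - 1/x\<close> both termwise in \<open>exp(-nx)\<close> and by its partial fraction expansion; the identity
  theorem then makes the completed function \<open>\<xi>\<close> entire and symmetric, and its zeros are the nontrivial
  zeros of \<open>\<zeta>\<close>. The argument principle for \<open>\<xi>\<close> on the rectangle with corners \<open>-1\<close> and \<open>2 + iT\<close>, folded along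
  \<open>Re s = 1/2\<close>, gives \<open>N(T) = \<theta>(T)/\<pi> + 1 + S(T)\<close>, and an explicit Stirling estimate turns this into
  \<open>0 \<le> Q(T) - S(T) \<le> 1/(150 T)\<close>. Since \<open>N\<close> is increasing, the bound on \<open>S1\<close> already forces \<open>Q(T) = O(log T)\<close>.
  The formula for \<open>E(T)\<close> is then partial summation, and \<open>E2(T)\<close> is bounded by integrating the \<open>S\<close>-part of \<open>Q\<close>
  by parts against \<open>S1 - c0\<close>.
\<close>

section \<open>Partial fractions of the hyperbolic cotangent\<close>

text \<open>The integral is taken against \<open>x powr (s - 1)\<close>. Its kernel is asymptotic to
  x/12 at 0 and tends to 1/2 at infinity, so it converges exactly for -1 < s < 0; there every term
  of both expansions is nonnegative, as Tonelli's theorem requires. The exponentials are grouped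
  into trapezoidal errors for exp(-xy) on unit intervals, which the Mellin integral turns into
  trapezoidal errors for a power of y: the very Euler-Maclaurin terms that define the continuation.
  The rectangle has its base on the real axis and its sides on Re s = -1 and Re s = 2. It avoids the
  zeros because xi does not vanish on the real line, nor for Re s \<ge> 2, hence by symmetry nor for
  Re s \<le> -1. The obstacle in the last part is convergence at infinity: partial summation up to X
  produces phi(X) Q(X) and an integral of phi' Q. Integrability of phi(t) log(t/2pi) forces phi(t) =
  O(1/t), and Q = O(log T) follows by averaging the increasing function N over unit intervals, where
  differences of S1 appear. Together they remove the boundary term and make the integral absolutely
  convergent.\<close>

lemma Digamma_reflection_complex:
  fixes z :: complex
  assumes "z \<notin> \<int>"
  shows "Digamma z - Digamma (1 - z) = - of_real pi * cos (of_real pi * z) / sin (of_real pi * z)"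
proof -
  have s: "sin (of_real pi * z) \<noteq> 0"
    using assms by (auto simp: sin_eq_0 Ints_def mult.commute)
  have z1: "z \<notin> \<int>\<^sub>\<le>\<^sub>0" using assms nonpos_Ints_Int by blast
  have z2: "1 - z \<notin> \<int>\<^sub>\<le>\<^sub>0"
  proof
    assume "1 - z \<in> \<int>\<^sub>\<le>\<^sub>0"
    then have "1 - (1 - z) \<in> \<int>" using nonpos_Ints_Int Ints_1 Ints_diff by blast
    then show False using assms by simp
  qed
  have d1: "((\<lambda>w. Gamma w * Gamma (1 - w)) has_field_derivative
        Gamma z * Digamma z * Gamma (1 - z) - Gamma z * (Gamma (1 - z) * Digamma (1 - z))) (at z)"
    using z1 z2 by (auto intro!: derivative_eq_intros)
  have d2: "((\<lambda>w. of_real pi / sin (of_real pi * w)) has_field_derivative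
        - (of_real pi * (cos (of_real pi * z) * of_real pi)) / (sin (of_real pi * z))^2) (at z)"
    using s by (auto intro!: derivative_eq_intros simp: power2_eq_square)
  have "(\<lambda>w. Gamma w * Gamma (1 - w)) = (\<lambda>w. complex_of_real pi / sin (of_real pi * w))"
    using Gamma_reflection_complex by auto
  with d1 d2 have "Gamma z * Digamma z * Gamma (1 - z) - Gamma z * (Gamma (1 - z) * Digamma (1 - z))
     = - (of_real pi * (cos (of_real pi * z) * of_real pi)) / (sin (of_real pi * z))^2"
    using DERIV_unique by metis
  then have "Gamma z * Gamma (1 - z) * (Digamma z - Digamma (1 - z)) =
      - (of_real pi * (cos (of_real pi * z) * of_real pi)) / (sin (of_real pi * z))^2"
    by (simp add: algebra_simps)
  then have "of_real pi / sin (of_real pi * z) * (Digamma z - Digamma (1 - z)) =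
      - (of_real pi * (cos (of_real pi * z) * of_real pi)) / (sin (of_real pi * z))^2"
    by (simp add: Gamma_reflection_complex)
  then have "(of_real pi / sin (of_real pi * z) * (Digamma z - Digamma (1 - z))) * sin (of_real pi * z) / of_real pi =
      - (of_real pi * (cos (of_real pi * z) * of_real pi)) / (sin (of_real pi * z))^2 * sin (of_real pi * z) / of_real pi"
    by (rule arg_cong)
  then show ?thesis using s by (simp add: power2_eq_square)
qed

text \<open>On the imaginary axis, \<open>z = \<i> * of_real y\<close>, the cotangent of the
  reflection formula becomes hyperbolic. The limit formula for \<open>Digamma\<close> supplies the
  series, whose terms are then paired with their conjugates.\<close>

lemma coth_partial_fractions:
  fixes y :: real
  assumes "y \<noteq> 0"
  shows "(\<lambda>n. 2 * y / (real (Suc n) ^ 2 + y ^ 2)) sums (pi * cosh (pi * y) / sinh (pi * y) - 1 / y)"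
proof -
  define z where "z = \<i> * of_real y"
  have zI: "z \<notin> \<int>"
  proof
    assume "z \<in> \<int>"
    then obtain k where "z = of_int k" by (auto simp: Ints_def)
    then have "Im z = 0" by simp
    with assms show False by (simp add: z_def)
  qed
  have z0: "z \<noteq> 0" "1 - z \<noteq> 0" using zI Ints_0 Ints_1 by auto
  have "(\<lambda>m. (of_real (ln (real m)) - (\<Sum>n<m. inverse (z + of_nat n))) -
     (of_real (ln (real m)) - (\<Sum>n<m. inverse (1 - z + of_nat n)))) \<longlonglongrightarrow> Digamma z - Digamma (1 - z)"
    by (intro tendsto_diff Digamma_LIMSEQ z0)
  then have "(\<lambda>m. - (\<Sum>n<m. inverse (z + of_nat n) - inverse (1 - z + of_nat n)))
     \<longlonglongrightarrow> Digamma z - Digamma (1 - z)"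
    by (simp add: sum_subtractf algebra_simps)
  from tendsto_minus[OF this]
  have "(\<lambda>m. \<Sum>n<m. inverse (z + of_nat n) - inverse (1 - z + of_nat n))
     \<longlonglongrightarrow> - (Digamma z - Digamma (1 - z))"
    by simp
  \<comment> \<open>Adding this telescoping series replaces \<open>z + of_nat n\<close> by
    \<open>z + of_nat (Suc n)\<close>, the conjugate of \<open>1 - z + of_nat n\<close>, so that
    each pair has a real denominator. The leftover \<open>inverse z\<close> becomes the 1/y of the
    claim.\<close>
  moreover have "(\<lambda>m. inverse (z + of_nat m) - inverse z) \<longlonglongrightarrow> 0 - inverse z"
  proof (intro tendsto_intros tendsto_inverse_0[THEN filterlim_compose])
    show "filterlim (\<lambda>m. z + of_nat m) at_infinity sequentially"
      by (rule tendsto_add_filterlim_at_infinity[OF tendsto_const tendsto_of_nat])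
  qed
  then have "(\<lambda>m. (\<Sum>n<m. inverse (z + of_nat (Suc n)) - inverse (z + of_nat n))) \<longlonglongrightarrow> 0 - inverse z"
    by (subst sum_lessThan_telescope) simp_all
  ultimately have "(\<lambda>m. (\<Sum>n<m. inverse (z + of_nat n) - inverse (1 - z + of_nat n)) +
       (\<Sum>n<m. inverse (z + of_nat (Suc n)) - inverse (z + of_nat n)))
     \<longlonglongrightarrow> - (Digamma z - Digamma (1 - z)) + (0 - inverse z)"
    by (rule tendsto_add)
  then have "(\<lambda>n. inverse (z + of_nat (Suc n)) - inverse (1 - z + of_nat n)) sums
     (- (Digamma z - Digamma (1 - z)) - inverse z)"
    unfolding sums_def by (simp add: sum.distrib [symmetric] )
  then have S: "(\<lambda>n. inverse (z + of_nat (Suc n)) - inverse (1 - z + of_nat n)) sums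
     (of_real pi * cos (of_real pi * z) / sin (of_real pi * z) - inverse z)"
    by (simp add: Digamma_reflection_complex[OF zI])
  have t: "inverse (z + of_nat (Suc n)) - inverse (1 - z + of_nat n) = - \<i> * of_real (2 * y / (real (Suc n) ^ 2 + y ^ 2))" for n
  proof -
    have nz: "real (Suc n) ^ 2 + y ^ 2 \<noteq> 0" by (simp add: sum_power2_eq_zero_iff)
    have nz': "(z + of_nat (Suc n)) * (1 - z + of_nat n) = of_real (real (Suc n) ^ 2 + y ^ 2)"
      by (simp add: z_def algebra_simps power2_eq_square)
    then have "(z + of_nat (Suc n)) * (1 - z + of_nat n) \<noteq> 0" using nz by (metis of_real_eq_0_iff)
    then have "z + of_nat (Suc n) \<noteq> 0" "1 - z + of_nat n \<noteq> 0" by auto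
    then have "inverse (z + of_nat (Suc n)) - inverse (1 - z + of_nat n) =
       (- 2 * z) / ((z + of_nat (Suc n)) * (1 - z + of_nat n))" by (simp add: divide_simps)
    also have "\<dots> = - \<i> * of_real (2 * y / (real (Suc n) ^ 2 + y ^ 2))"
      unfolding nz' by (simp add: z_def)
    finally show ?thesis .
  qed
  have piz: "of_real pi * z = \<i> * of_real (pi * y)" by (simp add: z_def)
  have c: "cos (of_real pi * z) = of_real (cosh (pi * y))"
    unfolding piz by (simp add: cosh_def cos_exp_eq exp_of_real scaleR_conv_of_real flip: exp_of_real)
  have s: "sin (of_real pi * z) = \<i> * of_real (sinh (pi * y))"
    unfolding piz by (simp add: sinh_def sin_exp_eq exp_of_real scaleR_conv_of_real field_simps flip: exp_of_real)
  have r: "of_real pi * cos (of_real pi * z) / sin (of_real pi * z) - inverse z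
     = - \<i> * of_real (pi * cosh (pi * y) / sinh (pi * y) - 1 / y)"
  proof -
    have i: "a / (\<i> * b) = - \<i> * (a / b)" for a b :: complex
      by (cases "b = 0") (simp_all add: field_simps)
    show ?thesis unfolding c s unfolding z_def inverse_eq_divide i
      by (simp add: algebra_simps)
  qed
  have "(\<lambda>n. - \<i> * of_real (2 * y / (real (Suc n) ^ 2 + y ^ 2))) sums
     (- \<i> * of_real (pi * cosh (pi * y) / sinh (pi * y) - 1 / y))"
    using S unfolding t r .
  from sums_mult[OF this, of \<i>] have "(\<lambda>n. complex_of_real (2 * y / (real (Suc n) ^ 2 + y ^ 2))) sums
     (of_real (pi * cosh (pi * y) / sinh (pi * y) - 1 / y))"
    by (simp add: mult.assoc [symmetric] del: of_real_divide of_real_mult of_real_add of_real_power)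
  then show ?thesis by (simp only: sums_of_real_iff)
qed

text \<open>Since 1/(exp x - 1) + 1/2 is half of coth(x/2), this is the previous expansion at y =
  x/(2 pi), divided by 2 pi.\<close>

lemma planck_partial_fractions:
  fixes x :: real
  assumes "x > 0"
  shows "(\<lambda>n. 2 * x / (x ^ 2 + (2 * pi * real (Suc n)) ^ 2)) sums (1 / (exp x - 1) + 1 / 2 - 1 / x)"
proof -
  define y where "y = x / (2 * pi)"
  have y: "y \<noteq> 0" "pi * y = x / 2" "x = 2 * pi * y" using assms by (auto simp: y_def)
  have "(\<lambda>n. 2 * y / (real (Suc n) ^ 2 + y ^ 2) / (2 * pi)) sums ((pi * cosh (pi * y) / sinh (pi * y) - 1 / y) / (2 * pi))"
    by (intro sums_divide coth_partial_fractions y)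
  moreover have "2 * y / (real (Suc n) ^ 2 + y ^ 2) / (2 * pi) = 2 * x / (x ^ 2 + (2 * pi * real (Suc n)) ^ 2)" for n
  proof -
    have "real (Suc n) ^ 2 + y ^ 2 \<noteq> 0" by (simp add: sum_power2_eq_zero_iff)
    moreover have "x ^ 2 + (2 * pi * real (Suc n)) ^ 2 = (2*pi)^2 * (real (Suc n) ^ 2 + y ^ 2)"
      unfolding y(3) by (simp only: power_mult_distrib distrib_left)
    ultimately show ?thesis unfolding y(3) by (simp add: divide_simps power2_eq_square del: of_nat_Suc)
  qed
  moreover have "(pi * cosh (pi * y) / sinh (pi * y) - 1 / y) / (2 * pi) = 1 / (exp x - 1) + 1 / 2 - 1 / x"
  proof -
    have e: "exp (x/2) > 1" using assms by simp
    have ex: "exp x = exp (x/2) * exp (x/2)" by (simp flip: exp_add)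
    have "exp (x/2) * exp (x/2) > 1 * 1" by (intro mult_strict_mono) (use e in auto)
    then have e2: "exp (x/2) * exp (x/2) - 1 \<noteq> 0" by simp
    have "(p / 2) / (q / 2) = p / q" for p q :: real by simp
    then have a: "cosh (x/2) / sinh (x/2) = (exp (x/2) + inverse (exp (x/2))) / (exp (x/2) - inverse (exp (x/2)))"
      unfolding cosh_field_def sinh_field_def exp_minus .
    have "\<dots> = (exp (x/2) * exp (x/2) + 1) / (exp (x/2) * exp (x/2) - 1)"
    proof -
      have "exp (x/2) + inverse (exp (x/2)) = (exp (x/2) * exp (x/2) + 1) / exp (x/2)"
         "exp (x/2) - inverse (exp (x/2)) = (exp (x/2) * exp (x/2) - 1) / exp (x/2)"
        by (simp_all add: field_simps)
      then show ?thesis by simp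
    qed
    also have "\<dots> = 1 + 2 / (exp x - 1)" using e2 by (simp add: ex field_simps)
    finally have "cosh (x/2) / sinh (x/2) = 1 + 2 / (exp x - 1)" using a by simp
    moreover have "(pi * c / d - 1 / y) / (2 * pi) = (c / d) / 2 - 1 / (2 * pi * y)" for c d
      by (simp add: diff_divide_distrib)
    ultimately show ?thesis unfolding y(2) y(3)[symmetric] by (simp add: add_divide_distrib)
  qed
  ultimately show ?thesis by simp
qed

section \<open>Analytic continuation by Euler--Maclaurin summation\<close>

lemma has_integral_FTC:
  fixes F :: "real \<Rightarrow> real"
  assumes "a \<le> b" "\<And>x. x \<in> {a..b} \<Longrightarrow> (F has_real_derivative f x) (at x within {a..b})"
  shows "(f has_integral (F b - F a)) {a..b}"
  using assms by (intro fundamental_theorem_of_calculus) (simp_all add: has_real_derivative_iff_has_vector_derivative)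

text \<open>Two integrations by parts against the Peano kernel u(1 - u)/2, which vanishes at both
  ends. Derivatives are asked for only inside the interval, and the third continuity condition
  concerns \<open>F''\<close> times the kernel, because \<open>F''\<close> may blow up at an
  endpoint: this happens for powers of x on \<open>{0..1}\<close>.\<close>

lemma trapezoid_error:
  fixes F F' F'' F''' :: "real \<Rightarrow> 'a :: banach"
  assumes F: "\<And>x. x \<in> {a<..<a+1} \<Longrightarrow> (F has_vector_derivative F' x) (at x)"
    and F': "\<And>x. x \<in> {a<..<a+1} \<Longrightarrow> (F' has_vector_derivative F'' x) (at x)"
    and F'': "\<And>x. x \<in> {a<..<a+1} \<Longrightarrow> (F'' has_vector_derivative F''' x) (at x)"
    and c: "continuous_on {a..a+1} F" "continuous_on {a..a+1} F'"
       "continuous_on {a..a+1} (\<lambda>x. ((x - a) * (a + 1 - x) / 2) *\<^sub>R F'' x)"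
  shows "((\<lambda>x. ((x - a) * (a + 1 - x) / 2) *\<^sub>R F''' x) has_integral
            (1/2) *\<^sub>R (F' a + F' (a + 1)) - (F (a + 1) - F a)) {a..a+1}"
proof -
  define G where "G = (\<lambda>x. ((x - a) * (a + 1 - x) / 2) *\<^sub>R F'' x - ((1 - 2 * (x - a)) / 2) *\<^sub>R F' x - F x)"
  have "((\<lambda>x. ((x - a) * (a + 1 - x) / 2) *\<^sub>R F''' x) has_integral G (a + 1) - G a) {a..a+1}"
  proof (rule fundamental_theorem_of_calculus_interior)
    show "continuous_on {a..a+1} G"
      unfolding G_def by (intro continuous_on_diff c continuous_on_scaleR[OF _ c(2)]) (auto intro!: continuous_intros)
    show "(G has_vector_derivative ((x - a) * (a + 1 - x) / 2) *\<^sub>R F''' x) (at x)" if "x \<in> {a<..<a+1}" for x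
    proof -
      have q: "((\<lambda>x. (x - a) * (a + 1 - x) / 2) has_real_derivative (1 - 2 * (x - a)) / 2) (at x)"
          "((\<lambda>x. (1 - 2 * (x - a)) / 2) has_real_derivative - 1) (at x)"
        by (auto intro!: derivative_eq_intros simp: field_simps)
      have "(G has_vector_derivative ((((x - a) * (a + 1 - x) / 2) *\<^sub>R F''' x + ((1 - 2 * (x - a)) / 2) *\<^sub>R F'' x)
          - (((1 - 2 * (x - a)) / 2) *\<^sub>R F'' x + (- 1) *\<^sub>R F' x) - F' x)) (at x)"
        unfolding G_def by (intro has_vector_derivative_diff has_vector_derivative_scaleR q F[OF that] F'[OF that] F''[OF that])
      then show ?thesis by simp
    qed
  qed simp
  also have "G (a + 1) - G a = (1/2) *\<^sub>R (F' a + F' (a + 1)) - (F (a + 1) - F a)"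
    by (simp add: G_def algebra_simps)
  finally show ?thesis .
qed

lemma has_vector_derivative_of_real_powr:
  assumes "x > 0"
  shows "((\<lambda>x. complex_of_real x powr w) has_vector_derivative w * of_real x powr (w - 1)) (at x within A)"
proof -
  have "((\<lambda>z. z powr w) has_field_derivative w * of_real x powr (w - 1)) (at (complex_of_real x))"
    using assms by (intro has_field_derivative_powr) (auto simp: complex_nonpos_Reals_iff)
  then show ?thesis
    by (rule has_vector_derivative_real_field)
qed

text \<open>
  The error of the trapezoidal rule for \<open>x\<^sup>-\<^sup>s\<close> on \<open>{y..y+1}\<close>, multiplied by \<open>s - 1\<close>, which makes it entire;
  \<open>zetaE s\<close> below is \<open>(s - 1) \<zeta>(s)\<close> for \<open>Re s > -1\<close>.
\<close>

definition zeta_term :: "real \<Rightarrow> complex \<Rightarrow> complex" where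
  "zeta_term y s = (s - 1) * (of_real y powr (- s) + of_real (y + 1) powr (- s)) / 2
      - of_real y powr (1 - s) + of_real (y + 1) powr (1 - s)"

text \<open>The rule is applied to \<open>(s - 1) * of_real x powr (- s)\<close>, whose
  antiderivative \<open>- (of_real x powr (1 - s))\<close> involves no division by
  \<open>s - 1\<close>; hence the formula covers \<open>s = 1\<close> as well.\<close>

lemma zeta_term_integral:
  assumes "y > 0"
  shows "((\<lambda>x. ((x - y) * (y + 1 - x) / 2) *\<^sub>R ((s - 1) * s * (s + 1) * of_real x powr (- s - 2)))
           has_integral zeta_term y s) {y..y+1}"
proof -
  have "((\<lambda>x. ((x - y) * (y + 1 - x) / 2) *\<^sub>R ((s - 1) * s * (s + 1) * of_real x powr (- s - 2)))
           has_integral ((1/2) *\<^sub>R ((s - 1) * of_real y powr (- s) + (s - 1) * of_real (y + 1) powr (- s))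
              - (- (of_real (y + 1) powr (1 - s)) - (- (of_real y powr (1 - s)))))) {y..y+1}"
  proof (rule trapezoid_error[where F'' = "\<lambda>x. - (s - 1) * s * of_real x powr (- s - 1)"])
    show "continuous_on {y..y+1} (\<lambda>x. - (complex_of_real x powr (1 - s)))"
      "continuous_on {y..y+1} (\<lambda>x. (s - 1) * complex_of_real x powr (- s))"
      "continuous_on {y..y+1} (\<lambda>x. ((x - y) * (y + 1 - x) / 2) *\<^sub>R (- (s - 1) * s * of_real x powr (- s - 1)))"
      using assms by (auto intro!: continuous_intros simp: complex_nonpos_Reals_iff)
    fix x assume "x \<in> {y<..<y+1}"
    then have x: "x > 0" using assms by auto
    show "((\<lambda>x. - (complex_of_real x powr (1 - s))) has_vector_derivative (s - 1) * of_real x powr (- s)) (at x)"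
      by (rule derivative_eq_intros has_vector_derivative_of_real_powr x | simp add: algebra_simps)+
    show "((\<lambda>x. (s - 1) * complex_of_real x powr (- s)) has_vector_derivative - (s - 1) * s * of_real x powr (- s - 1)) (at x)"
      by (rule derivative_eq_intros has_vector_derivative_of_real_powr x | simp add: algebra_simps)+
    show "((\<lambda>x. - (s - 1) * s * complex_of_real x powr (- s - 1)) has_vector_derivative (s - 1) * s * (s + 1) * of_real x powr (- s - 2)) (at x)"
      by (rule derivative_eq_intros has_vector_derivative_of_real_powr x | simp add: algebra_simps)+
  qed
  then show ?thesis by (simp add: zeta_term_def scaleR_conv_of_real algebra_simps add_divide_distrib diff_divide_distrib)
qed

lemma trapezoid_weight_le: "0 \<le> (u::real) \<Longrightarrow> u \<le> 1 \<Longrightarrow> u * (1 - u) / 2 \<le> 1 / 8"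
  using zero_le_power2[of "u - 1/2"] by (simp add: power2_eq_square algebra_simps)

text \<open>The kernel is at most 1/8, and the third derivative contributes the power of
  \<open>y\<close>. Summability of this power over the integers is what confines the continuation to
  \<open>Re s > -1\<close>.\<close>

lemma norm_zeta_term_le:
  assumes "y > 0" "Re s > -2"
  shows "norm (zeta_term y s) \<le> norm ((s - 1) * s * (s + 1)) / 8 * y powr (- Re s - 2)"
proof -
  have "norm (zeta_term y s) \<le> (norm ((s - 1) * s * (s + 1)) / 8 * y powr (- Re s - 2)) * measure lborel (cbox y (y+1))"
  proof (rule has_integral_bound)
    show "((\<lambda>x. ((x - y) * (y + 1 - x) / 2) *\<^sub>R ((s - 1) * s * (s + 1) * of_real x powr (- s - 2)))
           has_integral zeta_term y s) (cbox y (y+1))"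
      using zeta_term_integral[OF assms(1)] by simp
    fix x assume "x \<in> cbox y (y+1)"
    then have x: "y \<le> x" "x \<le> y + 1" by auto
    have "norm (((x - y) * (y + 1 - x) / 2) *\<^sub>R ((s - 1) * s * (s + 1) * of_real x powr (- s - 2)))
       = ((x - y) * (y + 1 - x) / 2) * (norm ((s - 1) * s * (s + 1)) * x powr (- Re s - 2))"
      using x assms by (simp add: norm_mult norm_powr_real_powr)
    also have "\<dots> \<le> (1 / 8) * (norm ((s - 1) * s * (s + 1)) * y powr (- Re s - 2))"
      using x assms trapezoid_weight_le[of "x - y"]
      by (intro mult_mono powr_mono2') (auto simp: algebra_simps)
    finally show "norm (((x - y) * (y + 1 - x) / 2) *\<^sub>R ((s - 1) * s * (s + 1) * of_real x powr (- s - 2)))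
       \<le> norm ((s - 1) * s * (s + 1)) / 8 * y powr (- Re s - 2)" by simp
  qed simp
  then show ?thesis by simp
qed

definition zetaE :: "complex \<Rightarrow> complex" where
  "zetaE s = 1 + (s - 1) / 2 + (\<Sum>n. zeta_term (real (Suc n)) s)"

lemma summable_zeta_majorant: "r > -1 \<Longrightarrow> summable (\<lambda>n. real (Suc n) powr (- r - 2))"
  by (subst summable_Suc_iff) (simp add: summable_real_powr_iff)

lemma summable_zeta_term: "Re s > -1 \<Longrightarrow> summable (\<lambda>n. zeta_term (real (Suc n)) s)"
  by (rule summable_comparison_test'[OF summable_mult[OF summable_zeta_majorant[of "Re s"]]])
     (auto intro!: norm_zeta_term_le)

lemma zeta_term_holomorphic: "zeta_term (real (Suc n)) holomorphic_on A"
  unfolding zeta_term_def by (intro holomorphic_intros) (auto simp: complex_nonpos_Reals_iff)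

lemma zetaE_holomorphic: "zetaE holomorphic_on {s. Re s > -1}"
proof -
  have "(\<lambda>s. \<Sum>n. zeta_term (real (Suc n)) s) holomorphic_on {s. Re s > -1}"
  proof (rule holomorphic_uniform_sequence)
    show "open {s. Re s > -1}" by (rule open_halfspace_Re_gt)
    show "(\<lambda>s. \<Sum>n<M. zeta_term (real (Suc n)) s) holomorphic_on {s. Re s > -1}" for M
      by (intro holomorphic_intros zeta_term_holomorphic)
    fix z assume "z \<in> {s. Re s > -1}"
    then have z: "Re z > -1" by simp
    \<comment> \<open>Half the distance from \<open>z\<close> to the line Re s = -1, so that Re s
      \<ge> \<open>r\<close> > -1 on the closed disc and one majorant serves all its points.\<close>
    define d where "d = (Re z + 1) / 2"
    have d: "d > 0" using z by (simp add: d_def)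
    define r where "r = (Re z - 1) / 2"
    have r: "r > -1" using z by (simp add: r_def)
    have *: "Re s \<ge> r \<and> norm s \<le> norm z + d" if "s \<in> cball z d" for s
    proof -
      have "norm (s - z) \<le> d" using that by (simp add: dist_norm norm_minus_commute)
      moreover have "\<bar>Re (s - z)\<bar> \<le> norm (s - z)" by (rule abs_Re_le_cmod)
      moreover have "norm s \<le> norm z + norm (s - z)" by (metis add_diff_cancel_left' diff_add_cancel norm_triangle_ineq add.commute)
      ultimately show ?thesis by (auto simp: r_def d_def field_simps)
    qed
    define B where "B = norm z + d + 1"
    have "uniform_limit (cball z d) (\<lambda>M s. \<Sum>n<M. zeta_term (real (Suc n)) s) (\<lambda>s. \<Sum>n. zeta_term (real (Suc n)) s) sequentially"
    proof (rule Weierstrass_m_test)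
      show "summable (\<lambda>n. B ^ 3 / 8 * real (Suc n) powr (- r - 2))"
        by (intro summable_mult summable_zeta_majorant r)
      fix n s assume s: "s \<in> cball z d"
      have "norm (zeta_term (real (Suc n)) s) \<le> norm ((s - 1) * s * (s + 1)) / 8 * real (Suc n) powr (- Re s - 2)"
        by (rule norm_zeta_term_le) (use *[OF s] r in auto)
      also have "\<dots> \<le> B ^ 3 / 8 * real (Suc n) powr (- r - 2)"
      proof (intro mult_mono divide_right_mono powr_mono)
        have "norm (s - 1) \<le> B" "norm (s + 1) \<le> B" "norm s \<le> B"
          using *[OF s] norm_triangle_ineq4[of s 1] norm_triangle_ineq[of s 1] by (auto simp: B_def)
        then have "norm (s - 1) * norm s * norm (s + 1) \<le> B * B * B"
          by (intro mult_mono) (auto intro: order_trans[OF norm_ge_zero])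
        then show "norm ((s - 1) * s * (s + 1)) \<le> B ^ 3" by (simp add: norm_mult power3_eq_cube)
        show "0 \<le> B ^ 3 / 8" using d by (simp add: B_def)
      qed (use *[OF s] in auto)
      finally show "norm (zeta_term (real (Suc n)) s) \<le> B ^ 3 / 8 * real (Suc n) powr (- r - 2)" .
    qed
    moreover have "cball z d \<subseteq> {s. Re s > -1}" using * r by fastforce
    ultimately show "\<exists>d>0. cball z d \<subseteq> {s. Re s > -1} \<and>
       uniform_limit (cball z d) (\<lambda>M s. \<Sum>n<M. zeta_term (real (Suc n)) s) (\<lambda>s. \<Sum>n. zeta_term (real (Suc n)) s) sequentially"
      using d by blast
  qed
  then show ?thesis unfolding zetaE_def by (intro holomorphic_intros) auto
qed

text \<open>The endpoint averages add up to a sum with half weights at both ends, and the powers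
  with exponent \<open>1 - s\<close> telescope. What remains from x = 1 is minus the explicit part
  \<open>1 + (s - 1) / 2\<close> of \<open>zetaE\<close>.\<close>

lemma sum_zeta_term:
  "(\<Sum>n<M. zeta_term (real (Suc n)) s) = (s - 1) * ((\<Sum>n<M. 1 / of_nat (Suc n) powr s) - 1 / 2 + of_nat (Suc M) powr (- s) / 2)
     - 1 + of_nat (Suc M) powr (1 - s)"
proof -
  have "(\<Sum>n<M. c * (p n + p (Suc n)) / 2 - q n + q (Suc n)) = c * ((\<Sum>n<M. p n) - p 0 / 2 + p M / 2) - q 0 + q M"
    for p q :: "nat \<Rightarrow> complex" and c
  proof (induction M)
    case (Suc M)
    show ?case unfolding sum.lessThan_Suc Suc.IH by (simp add: field_simps)
  qed simp
  from this[of "s - 1" "\<lambda>n. of_nat (Suc n) powr (- s)" "\<lambda>n. of_nat (Suc n) powr (1 - s)"]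
  show ?thesis
    by (simp add: zeta_term_def powr_minus inverse_eq_divide add_ac)
qed

lemma zetaE_conv_series:
  assumes "Re s > 1"
  shows "(\<lambda>n. 1 / of_nat (Suc n) powr s) sums (zetaE s / (s - 1))"
proof -
  have tend: "(\<lambda>M. complex_of_nat (Suc M) powr w) \<longlonglongrightarrow> 0" if "Re w < 0" for w
  proof (rule tendsto_norm_zero_cancel)
    have "(\<lambda>M. real (Suc M) powr Re w) \<longlonglongrightarrow> 0"
      by (rule tendsto_neg_powr[OF that]) (rule filterlim_compose[OF filterlim_real_sequentially filterlim_Suc])
    then show "(\<lambda>M. norm (complex_of_nat (Suc M) powr w)) \<longlonglongrightarrow> 0"

    proof -
      have "norm (complex_of_nat (Suc M) powr w) = real (Suc M) powr Re w" for M
        using norm_powr_real_powr[of "of_nat (Suc M)" w] by (simp del: of_nat_Suc)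
      with \<open>(\<lambda>M. real (Suc M) powr Re w) \<longlonglongrightarrow> 0\<close> show ?thesis by (simp only:)
    qed
  qed
  have s1: "s - 1 \<noteq> 0" using assms by auto
  have "(\<lambda>M. \<Sum>n<M. zeta_term (real (Suc n)) s) \<longlonglongrightarrow> (\<Sum>n. zeta_term (real (Suc n)) s)"
    using assms by (intro summable_LIMSEQ summable_zeta_term) auto
  then have "(\<lambda>M. ((\<Sum>n<M. zeta_term (real (Suc n)) s) + 1 - of_nat (Suc M) powr (1 - s)) / (s - 1) + 1 / 2 - of_nat (Suc M) powr (- s) / 2)
     \<longlonglongrightarrow> ((\<Sum>n. zeta_term (real (Suc n)) s) + 1 - 0) / (s - 1) + 1 / 2 - 0 / 2"
    by (intro tendsto_intros tend) (use assms s1 in auto)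
  moreover have "((\<Sum>n<M. zeta_term (real (Suc n)) s) + 1 - of_nat (Suc M) powr (1 - s)) / (s - 1) + 1 / 2 - of_nat (Suc M) powr (- s) / 2
     = (\<Sum>n<M. 1 / of_nat (Suc n) powr s)" for M
    unfolding sum_zeta_term using s1 by (simp add: field_simps)
  ultimately show ?thesis unfolding sums_def zetaE_def using s1 by (simp add: field_simps)
qed

lemma cnj_zeta_term: "y > 0 \<Longrightarrow> zeta_term y (cnj s) = cnj (zeta_term y s)"
  by (simp add: zeta_term_def cnj_powr complex_nonpos_Reals_iff)

lemma cnj_zetaE: "Re s > -1 \<Longrightarrow> zetaE (cnj s) = cnj (zetaE s)"
  unfolding zetaE_def using bounded_linear.suminf[OF bounded_linear_cnj summable_zeta_term[of s]]
  by (simp add: cnj_zeta_term)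

lemma zetaE_1: "zetaE 1 = 1"
  proof -
  have "zeta_term (real (Suc n)) 1 = 0" for n
  proof -
    have "complex_of_real (real (Suc n)) \<noteq> 0" "complex_of_real (real (Suc n) + 1) \<noteq> 0"
      by (simp_all only: of_real_eq_0_iff)
    then show ?thesis unfolding zeta_term_def by simp
  qed
  then show ?thesis by (simp add: zetaE_def)
qed

section \<open>The functional equation\<close>

text \<open>The Mellin integrals are stated as nonnegative integrals: in \<open>ennreal\<close> sums
  and integrals may be interchanged freely, and finiteness comes out of the closed forms.\<close>

lemma nn_integral_Gamma_powr:
  fixes a y :: real
  assumes a: "a > 0" and y: "y > 0"
  shows "(\<integral>\<^sup>+x. ennreal (indicator {0<..} x * (x powr (a - 1) * exp (- x * y))) \<partial>lborel) = ennreal (Gamma a * y powr (- a))"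
    (is "?I = _")
proof -
  let ?g = "\<lambda>x. ennreal (indicator {0..} x * x powr (a - 1) / exp x)"
  let ?h = "\<lambda>x. ennreal (indicator {0<..} x * (x powr (a - 1) * exp (- x * y)))"
  have "ennreal (Gamma a) = (\<integral>\<^sup>+x. ?g x \<partial>lborel)"
    by (rule Gamma_conv_nn_integral_real[OF a])
  also have "\<dots> = ennreal \<bar>y\<bar> * (\<integral>\<^sup>+x. ?g (0 + y * x) \<partial>lborel)"
    using y by (intro nn_integral_real_affine) auto
  also have "(\<integral>\<^sup>+x. ?g (0 + y * x) \<partial>lborel) = (\<integral>\<^sup>+x. ennreal (y powr (a - 1)) * ?h x \<partial>lborel)"
  proof (rule nn_integral_cong_AE, rule AE_I[of _ _ "{0}"])
    show "{x \<in> space lborel. ?g (0 + y * x) \<noteq> ennreal (y powr (a - 1)) * ?h x} \<subseteq> {0}"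
      using y by (auto simp: indicator_def zero_le_mult_iff powr_mult exp_minus field_simps ennreal_mult' [symmetric])
  qed auto
  also have "\<dots> = ennreal (y powr (a - 1)) * ?I"
    by (rule nn_integral_cmult) auto
  also have "ennreal \<bar>y\<bar> * (ennreal (y powr (a - 1)) * ?I) = ennreal (y powr a) * ?I"
    using y by (simp add: mult.assoc [symmetric] ennreal_mult' [symmetric] powr_mult_base)
  finally have G: "ennreal (Gamma a) = ennreal (y powr a) * ?I" .
  have "ennreal (y powr (- a)) * ennreal (Gamma a) = (ennreal (y powr (- a)) * ennreal (y powr a)) * ?I"
    unfolding G by (rule mult.assoc [symmetric])
  also have "ennreal (y powr (- a)) * ennreal (y powr a) = ennreal (y powr (- a) * y powr a)"
    by (rule ennreal_mult' [symmetric]) simp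
  also have "y powr (- a) * y powr a = 1" using y by (simp add: powr_minus)
  also have "ennreal (y powr (- a)) * ennreal (Gamma a) = ennreal (Gamma a * y powr (- a))"
    by (subst ennreal_mult' [symmetric]) (auto simp: mult.commute)
  finally show ?thesis by simp
qed

lemma indicator_mult_eq_if: "indicator A x * (y::real) = (if x \<in> A then y else 0)"
  by simp

text \<open>The substitution w = x^2 leads to the Gamma integral with exponent (s + 1)/2. The change
  of variables theorem speaks about absolutely integrable functions, hence the passage from
  \<open>nn_integral\<close> to \<open>has_integral\<close> and back.\<close>

lemma nn_integral_powr_gauss:
  fixes s v :: real
  assumes s: "s > -1" and v: "v > 0"
  shows "(\<integral>\<^sup>+x. ennreal (indicator {0<..} x * (x powr s * exp (- v * x\<^sup>2))) \<partial>lborel)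
           = ennreal (Gamma ((s + 1) / 2) * v powr (- ((s + 1) / 2)) / 2)"
proof -
  define b where "b = Gamma ((s + 1) / 2) * v powr (- ((s + 1) / 2)) / 2"
  define f where "f = (\<lambda>w. (1 / 2) * (w powr ((s + 1) / 2 - 1) * exp (- w * v)))"
  have img: "(\<lambda>x::real. x\<^sup>2) ` {0<..} = {0<..}"
  proof safe
    fix x :: real assume "x > 0"
    then have "x = (sqrt x)\<^sup>2" "sqrt x \<in> {0<..}" by auto
    then show "x \<in> (\<lambda>x. x\<^sup>2) ` {0<..}" by blast
  qed auto
  have "(\<integral>\<^sup>+x. ennreal (indicator {0<..} x * f x) \<partial>lborel) = ennreal (1/2) * ennreal (Gamma ((s + 1) / 2) * v powr (- ((s + 1) / 2)))"
  proof -
    have "(\<integral>\<^sup>+x. ennreal (indicator {0<..} x * f x) \<partial>lborel) =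
      (\<integral>\<^sup>+x. ennreal (1/2) * ennreal (indicator {0<..} x * (x powr ((s + 1) / 2 - 1) * exp (- x * v))) \<partial>lborel)"
      by (intro nn_integral_cong, subst ennreal_mult' [symmetric]) (auto simp: f_def)
    also have "\<dots> = ennreal (1/2) * (\<integral>\<^sup>+x. ennreal (indicator {0<..} x * (x powr ((s + 1) / 2 - 1) * exp (- x * v))) \<partial>lborel)"
      by (rule nn_integral_cmult) auto
    also have "(\<integral>\<^sup>+x. ennreal (indicator {0<..} x * (x powr ((s + 1) / 2 - 1) * exp (- x * v))) \<partial>lborel)
       = ennreal (Gamma ((s + 1) / 2) * v powr (- ((s + 1) / 2)))"
      by (rule nn_integral_Gamma_powr) (use s v in auto)
    finally show ?thesis .
  qed
  also have "\<dots> = ennreal b" unfolding b_def by (subst ennreal_mult' [symmetric]) auto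
  finally have nf: "(\<integral>\<^sup>+x. ennreal (indicator {0<..} x * f x) \<partial>lborel) = ennreal b" .
  have b0: "b \<ge> 0" using s v by (auto simp: b_def)
  have "((\<lambda>x. indicator {0<..} x * f x) has_integral b) UNIV"
    by (rule nn_integral_has_integral[OF _ _ nf b0]) (auto simp: f_def indicator_def)
  then have hi: "(f has_integral b) {0<..}"
    by (simp only: indicator_mult_eq_if has_integral_restrict_UNIV)
  have "f absolutely_integrable_on {0<..}"
    by (rule nonnegative_absolutely_integrable_1) (use hi in \<open>auto simp: f_def integrable_on_def\<close>)
  with hi have "f absolutely_integrable_on (\<lambda>x. x\<^sup>2) ` {0<..} \<and> integral ((\<lambda>x. x\<^sup>2) ` {0<..}) f = b"
    unfolding img by auto
  moreover have "((\<lambda>x. \<bar>2 * x\<bar> * f (x\<^sup>2)) absolutely_integrable_on {0<..} \<and> integral {0<..} (\<lambda>x. \<bar>2 * x\<bar> * f (x\<^sup>2)) = b)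
     \<longleftrightarrow> (f absolutely_integrable_on (\<lambda>x. x\<^sup>2) ` {0<..} \<and> integral ((\<lambda>x. x\<^sup>2) ` {0<..}) f = b)"
    by (rule has_absolute_integral_change_of_variables_1')
       (auto intro!: derivative_eq_intros inj_onI simp: power2_eq_iff)
  ultimately have "(\<lambda>x. \<bar>2 * x\<bar> * f (x\<^sup>2)) absolutely_integrable_on {0<..}" "integral {0<..} (\<lambda>x. \<bar>2 * x\<bar> * f (x\<^sup>2)) = b"
    by blast+
  then have "((\<lambda>x. \<bar>2 * x\<bar> * f (x\<^sup>2)) has_integral b) {0<..}"
    using absolutely_integrable_on_def has_integral_iff by blast
  then have "((\<lambda>x. x powr s * exp (- v * x\<^sup>2)) has_integral b) {0<..}"
  proof (rule has_integral_eq[rotated])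
    fix x :: real assume "x \<in> {0<..}"
    then have x: "x > 0" by simp
    have "\<bar>2 * x\<bar> * f (x\<^sup>2) = x powr 1 * (x powr 2) powr ((s + 1) / 2 - 1) * exp (- v * x\<^sup>2)"
      using x by (simp add: f_def powr_numeral)
    also have "x powr 1 * (x powr 2) powr ((s + 1) / 2 - 1) = x powr s"
      by (simp only: powr_powr powr_add [symmetric]) (simp add: field_simps)
    finally show "\<bar>2 * x\<bar> * f (x\<^sup>2) = x powr s * exp (- v * x\<^sup>2)" .
  qed
  then have "((\<lambda>x. indicator {0<..} x * (x powr s * exp (- v * x\<^sup>2))) has_integral b) UNIV"
    by (simp only: indicator_mult_eq_if has_integral_restrict_UNIV)
  from nn_integral_has_integral_lborel[OF _ _ this] show ?thesis
    unfolding b_def by simp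
qed

text \<open>Write 1/(x^2 + c^2) as the integral of exp(-v(x^2 + c^2)) over v > 0 and interchange:
  the x-integral is Gaussian and a Gamma integral in v remains. The product of Gamma values equals
  pi/cos(pi s/2), but is kept as it stands because its factors are wanted in the functional
  equation.\<close>

lemma nn_integral_powr_Lorentz:
  fixes s c :: real
  assumes s: "-1 < s" "s < 1" and c: "c > 0"
  shows "(\<integral>\<^sup>+x. ennreal (indicator {0<..} x * (x powr s / (x\<^sup>2 + c\<^sup>2))) \<partial>lborel)
           = ennreal (Gamma ((1 + s) / 2) * Gamma ((1 - s) / 2) * c powr (s - 1) / 2)"
proof -
  define h where "h = (\<lambda>x v::real. indicator {0<..} x * indicator {0<..} v * (x powr s * exp (- v * (x\<^sup>2 + c\<^sup>2))))"
  have hm [measurable]: "(\<lambda>(x,v). h x v) \<in> borel_measurable (lborel \<Otimes>\<^sub>M lborel)"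
    unfolding h_def by measurable
  have "(\<integral>\<^sup>+x. ennreal (indicator {0<..} x * (x powr s / (x\<^sup>2 + c\<^sup>2))) \<partial>lborel) = (\<integral>\<^sup>+x. \<integral>\<^sup>+v. ennreal (h x v) \<partial>lborel \<partial>lborel)"
  proof (rule nn_integral_cong)
    fix x :: real
    have p: "x\<^sup>2 + c\<^sup>2 > 0" using c by (simp add: add_nonneg_pos)
    have "(\<integral>\<^sup>+v. ennreal (h x v) \<partial>lborel) = (\<integral>\<^sup>+v. ennreal (indicator {0<..} x * x powr s) * ennreal (indicator {0<..} v * (v powr (1 - 1) * exp (- v * (x\<^sup>2 + c\<^sup>2)))) \<partial>lborel)"
      by (intro nn_integral_cong) (auto simp: h_def ennreal_mult' [symmetric] indicator_def)
    also have "\<dots> = ennreal (indicator {0<..} x * x powr s) * ennreal (Gamma 1 * (x\<^sup>2 + c\<^sup>2) powr (- 1))"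
      by (subst nn_integral_cmult, measurable, subst nn_integral_Gamma_powr) (use p in auto)
    also have "\<dots> = ennreal (indicator {0<..} x * (x powr s / (x\<^sup>2 + c\<^sup>2)))"
      using p by (subst ennreal_mult' [symmetric]) (auto simp: powr_minus field_simps)
    finally show "ennreal (indicator {0<..} x * (x powr s / (x\<^sup>2 + c\<^sup>2))) = (\<integral>\<^sup>+v. ennreal (h x v) \<partial>lborel)" by simp
  qed
  also have "\<dots> = (\<integral>\<^sup>+v. \<integral>\<^sup>+x. ennreal (h x v) \<partial>lborel \<partial>lborel)"
    by (rule lborel_pair.Fubini') measurable
  also have "\<dots> = (\<integral>\<^sup>+v. ennreal (Gamma ((1 + s) / 2) / 2) * ennreal (indicator {0<..} v * (v powr ((1 - s) / 2 - 1) * exp (- v * c\<^sup>2))) \<partial>lborel)"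
  proof (rule nn_integral_cong)
    fix v :: real
    show "(\<integral>\<^sup>+x. ennreal (h x v) \<partial>lborel) = ennreal (Gamma ((1 + s) / 2) / 2) * ennreal (indicator {0<..} v * (v powr ((1 - s) / 2 - 1) * exp (- v * c\<^sup>2)))"
    proof (cases "v > 0")
      case True
      have "(\<integral>\<^sup>+x. ennreal (h x v) \<partial>lborel) = (\<integral>\<^sup>+x. ennreal (exp (- v * c\<^sup>2)) * ennreal (indicator {0<..} x * (x powr s * exp (- v * x\<^sup>2))) \<partial>lborel)"
        using True by (intro nn_integral_cong) (auto simp: h_def ennreal_mult' [symmetric] indicator_def exp_add [symmetric] algebra_simps)
      also have "\<dots> = ennreal (exp (- v * c\<^sup>2)) * ennreal (Gamma ((s + 1) / 2) * v powr (- ((s + 1) / 2)) / 2)"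
        by (subst nn_integral_cmult, measurable, subst nn_integral_powr_gauss) (use True s in auto)
      also have "- ((s + 1) / 2) = (1 - s) / 2 - 1" by (simp add: field_simps)
      finally show ?thesis using True s by (auto simp: ennreal_mult' [symmetric] mult_ac add_ac)
    qed (simp add: h_def)
  qed
  also have "\<dots> = ennreal (Gamma ((1 + s) / 2) / 2) * ennreal (Gamma ((1 - s) / 2) * (c\<^sup>2) powr (- ((1 - s) / 2)))"
    by (subst nn_integral_cmult, measurable, subst nn_integral_Gamma_powr) (use s c in auto)
  also have "(c\<^sup>2) powr (- ((1 - s) / 2)) = c powr (s - 1)"
  proof -
    have "(c\<^sup>2) powr (- ((1 - s) / 2)) = c powr (2 * (- ((1 - s) / 2)))"
      using c by (simp only: powr_powr flip: powr_numeral)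
    also have "2 * (- ((1 - s) / 2)) = s - 1" by (simp add: field_simps)
    finally show ?thesis .
  qed
  finally show ?thesis using s by (simp add: ennreal_mult' [symmetric] mult_ac)
qed

text \<open>The Bose-Einstein factor without its first two Laurent terms at 0, that is coth(x/2)/2 -
  1/x. It is positive for x > 0, as the nonnegative integrals below demand.\<close>

definition planck :: "real \<Rightarrow> real" where "planck x = 1 / (exp x - 1) + 1 / 2 - 1 / x"

text \<open>Each partial fraction is a Lorentz kernel of width \<open>c n\<close>; scaling extracts
  the factor \<open>real (Suc n) powr (s - 1)\<close>, and the sum over n is zeta at 1 - s.\<close>

lemma nn_integral_planck_spectral:
  fixes s Z :: real
  assumes s: "-1 < s" "s < 0" and Z: "(\<lambda>n. real (Suc n) powr (s - 1)) sums Z"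
  shows "(\<integral>\<^sup>+x. ennreal (indicator {0<..} x * (x powr (s - 1) * planck x)) \<partial>lborel)
     = ennreal ((2 * pi) powr (s - 1) * Gamma ((1 + s) / 2) * Gamma ((1 - s) / 2) * Z)"
proof -
  define c where "c = (\<lambda>n. 2 * pi * real (Suc n))"
  let ?q = "\<lambda>n x. indicator {0<..} x * (x powr s / (x\<^sup>2 + (c n)\<^sup>2))"
  have c: "c n > 0" for n by (simp add: c_def)
  have "(\<integral>\<^sup>+x. ennreal (indicator {0<..} x * (x powr (s - 1) * planck x)) \<partial>lborel)
     = (\<integral>\<^sup>+x. (\<Sum>n. ennreal (2 * ?q n x)) \<partial>lborel)"
  proof (rule nn_integral_cong, rule suminf_ennreal_eq [symmetric])
    fix x :: real
    show "0 \<le> 2 * ?q n x" for n by simp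
    show "(\<lambda>n. 2 * ?q n x) sums (indicator {0<..} x * (x powr (s - 1) * planck x))"
    proof (cases "x > 0")
      case True
      have "(\<lambda>n. x powr (s - 1) * (2 * x / (x ^ 2 + (c n) ^ 2))) sums (x powr (s - 1) * planck x)"
        unfolding c_def planck_def by (intro sums_mult planck_partial_fractions True)
      moreover have "x powr (s - 1) * (2 * x / (x ^ 2 + (c n) ^ 2)) = 2 * (x powr s / (x\<^sup>2 + (c n)\<^sup>2))" for n
      proof -
        have "x powr s = x * x powr (s - 1)" using True powr_mult_base[of x "s - 1"] by simp
        then show ?thesis by simp
      qed
      ultimately have "(\<lambda>n. 2 * (x powr s / (x\<^sup>2 + (c n)\<^sup>2))) sums (x powr (s - 1) * planck x)"
        by (simp only:)
      then show ?thesis using True by simp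
    qed simp
  qed
  also have "\<dots> = (\<Sum>n. \<integral>\<^sup>+x. ennreal (2 * ?q n x) \<partial>lborel)"
    by (rule nn_integral_suminf) measurable
  also have "\<dots> = (\<Sum>n. ennreal ((2 * pi) powr (s - 1) * Gamma ((1 + s) / 2) * Gamma ((1 - s) / 2) * real (Suc n) powr (s - 1)))"
  proof (rule suminf_cong)
    fix n
    have "(\<integral>\<^sup>+x. ennreal (2 * ?q n x) \<partial>lborel)
       = (\<integral>\<^sup>+x. ennreal 2 * ennreal (?q n x) \<partial>lborel)"
      by (intro nn_integral_cong, subst ennreal_mult' [symmetric]) auto
    also have "\<dots> = ennreal 2 * (\<integral>\<^sup>+x. ennreal (?q n x) \<partial>lborel)"
      by (rule nn_integral_cmult) auto
    also have "\<dots> = ennreal (2 * (Gamma ((1 + s) / 2) * Gamma ((1 - s) / 2) * c n powr (s - 1) / 2))"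
      using s c by (subst nn_integral_powr_Lorentz) (auto simp only: ennreal_mult' [symmetric])
    also have "2 * (Gamma ((1 + s) / 2) * Gamma ((1 - s) / 2) * c n powr (s - 1) / 2) =
        (2 * pi) powr (s - 1) * Gamma ((1 + s) / 2) * Gamma ((1 - s) / 2) * real (Suc n) powr (s - 1)"
      unfolding c_def by (subst powr_mult) auto
    finally show "(\<integral>\<^sup>+x. ennreal (2 * ?q n x) \<partial>lborel)
       = ennreal ((2 * pi) powr (s - 1) * Gamma ((1 + s) / 2) * Gamma ((1 - s) / 2) * real (Suc n) powr (s - 1))" .
  qed
  also have "\<dots> = ennreal ((2 * pi) powr (s - 1) * Gamma ((1 + s) / 2) * Gamma ((1 - s) / 2) * Z)"
    by (rule suminf_ennreal_eq[OF _ sums_mult[OF Z]]) (use s in \<open>auto intro!: mult_nonneg_nonneg\<close>)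
  finally show ?thesis .
qed

text \<open>The case \<open>n = 0\<close> is included: the interval then starts at 0, where the
  second derivative is singular like \<open>x powr (- s - 1)\<close>. Multiplied by the kernel it
  behaves like \<open>x powr (- s)\<close>, which is continuous for \<open>s < 0\<close>.\<close>

lemma real_zeta_term_integral:
  fixes s :: real
  assumes s: "-1 < s" "s < 0"
  shows "((\<lambda>x. ((x - real n) * (real n + 1 - x) / 2) * x powr (- s - 2)) has_integral
            ((s - 1) * (real n powr (- s) + (real n + 1) powr (- s)) / 2 - real n powr (1 - s) + (real n + 1) powr (1 - s))
              / ((s - 1) * s * (s + 1))) {real n..real n+1}"
proof -
  have "((\<lambda>x. ((x - real n) * (real n + 1 - x) / 2) *\<^sub>R ((s - 1) * s * (s + 1) * x powr (- s - 2))) has_integral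
       (1/2) *\<^sub>R ((s - 1) * real n powr (- s) + (s - 1) * (real n + 1) powr (- s)) - (- ((real n + 1) powr (1 - s)) - (- (real n powr (1 - s))))) {real n..real n+1}"
  proof (rule trapezoid_error[where F'' = "\<lambda>x. - (s - 1) * s * x powr (- s - 1)"])
    show "continuous_on {real n..real n+1} (\<lambda>x. - (x powr (1 - s)))"
      by (intro continuous_on_minus continuous_on_mult continuous_on_powr' continuous_on_const continuous_on_id) (use s in auto)
    show "continuous_on {real n..real n+1} (\<lambda>x. (s - 1) * x powr (- s))"
      by (intro continuous_on_minus continuous_on_mult continuous_on_powr' continuous_on_const continuous_on_id) (use s in auto)
    show "continuous_on {real n..real n+1} (\<lambda>x. ((x - real n) * (real n + 1 - x) / 2) *\<^sub>R (- (s - 1) * s * x powr (- s - 1)))"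
    proof (cases "n = 0")
      case True
      have "continuous_on {0..1} (\<lambda>x::real. - (s - 1) * s * ((1 - x) / 2) * x powr (- s))"
        by (intro continuous_on_mult continuous_on_powr' continuous_on_const continuous_on_id) (use s in \<open>auto intro!: continuous_intros\<close>)
      then have "continuous_on {0..1} (\<lambda>x::real. ((x - 0) * (0 + 1 - x) / 2) *\<^sub>R (- (s - 1) * s * x powr (- s - 1)))"
      proof (rule continuous_on_eq)
        fix x :: real assume "x \<in> {0..1}"
        then have "x * x powr (- s - 1) = x powr (- s)" using powr_mult_base[of x "- s - 1"] by simp
        then show "- (s - 1) * s * ((1 - x) / 2) * x powr (- s) = ((x - 0) * (0 + 1 - x) / 2) *\<^sub>R (- (s - 1) * s * x powr (- s - 1))"
          unfolding real_scaleR_def by (metis (no_types, lifting) add_0 diff_zero mult.assoc mult.left_commute times_divide_eq_left)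
      qed
      then show ?thesis using True by simp
    next
      case False
      then show ?thesis by (intro continuous_intros) auto
    qed
    fix x assume "x \<in> {real n<..<real n+1}"
    then have x: "x > 0" by auto
    have D: "((\<lambda>x. c * x powr r) has_vector_derivative c * (r * x powr (r - 1))) (at x)" for c r
      unfolding has_real_derivative_iff_has_vector_derivative [symmetric]
      by (rule DERIV_cmult[OF has_real_derivative_powr[OF x]])
    show "((\<lambda>x. - (x powr (1 - s))) has_vector_derivative (s - 1) * x powr (- s)) (at x)"
      using D[of "-1" "1 - s"] by (simp add: algebra_simps)
    show "((\<lambda>x. (s - 1) * x powr (- s)) has_vector_derivative - (s - 1) * s * x powr (- s - 1)) (at x)"
      using D[of "s - 1" "- s"] by (simp add: algebra_simps)
    show "((\<lambda>x. - (s - 1) * s * x powr (- s - 1)) has_vector_derivative (s - 1) * s * (s + 1) * x powr (- s - 2)) (at x)"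
      using D[of "- (s - 1) * s" "- s - 1"] by (simp add: algebra_simps)
  qed
  moreover have "(1/2) *\<^sub>R ((s - 1) * real n powr (- s) + (s - 1) * (real n + 1) powr (- s)) - (- ((real n + 1) powr (1 - s)) - (- (real n powr (1 - s))))
     = (s - 1) * (real n powr (- s) + (real n + 1) powr (- s)) / 2 - real n powr (1 - s) + (real n + 1) powr (1 - s)"
    by (simp add: field_simps)
  moreover define K where "K = (s - 1) * s * (s + 1)"
  have K: "K \<noteq> 0" using s by (simp add: K_def)
  ultimately have "((\<lambda>x. ((x - real n) * (real n + 1 - x) / 2) *\<^sub>R (K * x powr (- s - 2)) / K) has_integral
     ((s - 1) * (real n powr (- s) + (real n + 1) powr (- s)) / 2 - real n powr (1 - s) + (real n + 1) powr (1 - s)) / K) {real n..real n+1}"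
    unfolding K_def [symmetric] by (intro has_integral_divide) (simp only:)
  moreover have "(\<lambda>x. ((x - real n) * (real n + 1 - x) / 2) *\<^sub>R (K * x powr (- s - 2)) / K) = (\<lambda>x. ((x - real n) * (real n + 1 - x) / 2) * x powr (- s - 2))"
    using K by auto
  ultimately show ?thesis unfolding K_def [symmetric] by (simp only:)
qed

text \<open>For \<open>s < 0\<close> the powers of 0 vanish, so the term at n = 0 is exactly the
  explicit part \<open>1 + (s - 1) / 2\<close> of \<open>zetaE\<close>, and the series can start at
  0.\<close>

lemma zetaE_of_real_series:
  fixes s :: real
  assumes s: "-1 < s" "s < 0"
  shows "(\<lambda>n. (s - 1) * (real n powr (- s) + (real n + 1) powr (- s)) / 2 - real n powr (1 - s) + (real n + 1) powr (1 - s))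
     sums Re (zetaE (of_real s))"
proof -
  define z where "z = (\<lambda>n. (s - 1) * (real n powr (- s) + (real n + 1) powr (- s)) / 2 - real n powr (1 - s) + (real n + 1) powr (1 - s))"
  have "(\<lambda>n. zeta_term (real (Suc n)) (of_real s)) sums (zetaE (of_real s) - (1 + (of_real s - 1) / 2))"
    unfolding zetaE_def using summable_zeta_term[of "of_real s"] s by (simp add: summable_sums)
  then have "(\<lambda>n. Re (zeta_term (real (Suc n)) (of_real s))) sums Re (zetaE (of_real s) - (1 + (of_real s - 1) / 2))"
    by (rule sums_Re)
  moreover have "Re (zeta_term (real (Suc n)) (of_real s)) = z (Suc n)" for n
  proof -
    have "zeta_term (real (Suc n)) (of_real s) = of_real (z (Suc n))"
      unfolding zeta_term_def z_def by (simp add: powr_Reals_eq)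
    then show ?thesis by simp
  qed
  moreover have "Re (zetaE (of_real s) - (1 + (of_real s - 1) / 2)) = Re (zetaE (of_real s)) - z 0"
    using s by (simp add: z_def)
  ultimately have "(\<lambda>n. z (Suc n)) sums (Re (zetaE (of_real s)) - z 0)" by (simp only:)
  then show ?thesis unfolding z_def [symmetric] by (simp add: sums_Suc_iff)
qed

text \<open>The trapezoidal errors of exp(-xy) over the intervals \<open>{n..n+1}\<close> form a
  geometric series in n with sum \<open>planck x / x ^ 2\<close>. Integrated against
  \<open>x powr (s + 1)\<close>, the exponential becomes
  \<open>Gamma (s + 2) * y powr (- s - 2)\<close> and each error becomes a term of
  \<open>zetaE\<close>. The sign in the second claim is needed to return from \<open>ennreal\<close>
  to the reals.\<close>

lemma nn_integral_planck_zeta: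
  fixes s :: real
  assumes s: "-1 < s" "s < 0"
  shows "(\<integral>\<^sup>+x. ennreal (indicator {0<..} x * (x powr (s - 1) * planck x)) \<partial>lborel)
     = ennreal (Gamma (s + 2) * (Re (zetaE (of_real s)) / ((s - 1) * s * (s + 1))))"
    and "Re (zetaE (of_real s)) / ((s - 1) * s * (s + 1)) \<ge> 0"
proof -
  let ?W = "Re (zetaE (of_real s)) / ((s - 1) * s * (s + 1))"
  define w where "w = (\<lambda>n y. (y - real n) * (real n + 1 - y) / 2)"
  have w0: "w n y \<ge> 0" if "y \<in> {real n..real n + 1}" for n y using that by (auto simp: w_def)
  define \<tau> where "\<tau> = (\<lambda>n. ((s - 1) * (real n powr (- s) + (real n + 1) powr (- s)) / 2 - real n powr (1 - s) + (real n + 1) powr (1 - s)) / ((s - 1) * s * (s + 1)))"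
  have int_\<tau>: "((\<lambda>x. w n x * x powr (- s - 2)) has_integral \<tau> n) {real n..real n+1}" for n
    unfolding w_def \<tau>_def by (rule real_zeta_term_integral[OF s])
  have \<tau>0: "\<tau> n \<ge> 0" for n
    by (rule has_integral_nonneg[OF int_\<tau>]) (auto intro!: w0 mult_nonneg_nonneg)
  have \<tau>sums: "\<tau> sums ?W"
    unfolding \<tau>_def by (intro sums_divide zetaE_of_real_series s)
  show "Re (zetaE (of_real s)) / ((s - 1) * s * (s + 1)) \<ge> 0"
    by (rule sums_le[OF _ sums_zero \<tau>sums]) (rule \<tau>0)
  \<comment> \<open>The closed form of the trapezoidal error on \<open>{n..n+1}\<close> of the
    function exp(-xy)/x^2 of y.\<close>
  define k where "k = (\<lambda>n x. (exp (- x * real n) + exp (- x * (real n + 1))) / (2 * x ^ 2) - (exp (- x * real n) - exp (- x * (real n + 1))) / x ^ 3)"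
  have int_k: "((\<lambda>y. w n y * exp (- x * y)) has_integral k n x) {real n..real n+1}" if x: "x > 0" for n x
  proof -
    have "((\<lambda>y. ((y - real n) * (real n + 1 - y) / 2) *\<^sub>R exp (- x * y)) has_integral
       (1/2) *\<^sub>R (exp (- x * real n) / x ^ 2 + exp (- x * (real n + 1)) / x ^ 2) - (- exp (- x * (real n + 1)) / x ^ 3 - (- exp (- x * real n) / x ^ 3))) {real n..real n+1}"
    proof (rule trapezoid_error[where F'' = "\<lambda>y. - exp (- x * y) / x"])
      fix y
      show "((\<lambda>y. - exp (- x * y) / x ^ 3) has_vector_derivative exp (- x * y) / x ^ 2) (at y)"
        "((\<lambda>y. exp (- x * y) / x ^ 2) has_vector_derivative - exp (- x * y) / x) (at y)"
        "((\<lambda>y. - exp (- x * y) / x) has_vector_derivative exp (- x * y)) (at y)"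
        unfolding has_real_derivative_iff_has_vector_derivative [symmetric]
        using x by (auto intro!: derivative_eq_intros simp: power2_eq_square power3_eq_cube)
    qed (use x in \<open>auto intro!: continuous_intros\<close>)
    moreover have "(1/2) *\<^sub>R (exp (- x * real n) / x ^ 2 + exp (- x * (real n + 1)) / x ^ 2) - (- exp (- x * (real n + 1)) / x ^ 3 - (- exp (- x * real n) / x ^ 3)) = k n x"
      unfolding k_def by (simp add: add_divide_distrib diff_divide_distrib)
    ultimately show ?thesis unfolding w_def by simp
  qed
  let ?k = "\<lambda>n x. indicator {0<..} x * (x powr (s + 1) * k n x)"
  have k0: "k n x \<ge> 0" if "x > 0" for n x
    by (rule has_integral_nonneg[OF int_k[OF that]]) (auto intro!: w0 mult_nonneg_nonneg)
  have k_sums: "(\<lambda>n. x powr (s + 1) * k n x) sums (x powr (s - 1) * planck x)" if x: "x > 0" for x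
  proof -
    have e: "exp x > 1" using x by simp
    have "(\<lambda>n. exp (- x) ^ n) sums (1 / (1 - exp (- x)))"
      by (rule geometric_sums) (use x in simp)
    then have "(\<lambda>n. exp (- x * real n)) sums (1 / (1 - exp (- x)))"
      by (simp add: exp_of_nat_mult [symmetric] mult.commute)
    from sums_mult[OF this, of "(1 + exp (- x)) / (2 * x ^ 2) - (1 - exp (- x)) / x ^ 3"]
    have "(\<lambda>n. ((1 + exp (- x)) / (2 * x ^ 2) - (1 - exp (- x)) / x ^ 3) * exp (- x * real n)) sums
       (((1 + exp (- x)) / (2 * x ^ 2) - (1 - exp (- x)) / x ^ 3) * (1 / (1 - exp (- x))))" .
    moreover have "((1 + exp (- x)) / (2 * x ^ 2) - (1 - exp (- x)) / x ^ 3) * exp (- x * real n) = k n x" for n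
    proof -
      have "exp (- x * (real n + 1)) = exp (- x * real n) * exp (- x)" by (simp add: exp_add [symmetric] algebra_simps)
      then show ?thesis unfolding k_def by (simp add: algebra_simps add_divide_distrib diff_divide_distrib)
    qed
    moreover have "((1 + exp (- x)) / (2 * x ^ 2) - (1 - exp (- x)) / x ^ 3) * (1 / (1 - exp (- x)))
       = planck x / x ^ 2"
      using x e unfolding planck_def by (simp add: exp_minus divide_simps power2_eq_square power3_eq_cube) (simp add: algebra_simps)
    ultimately have "(\<lambda>n. x powr (s + 1) * k n x) sums (x powr (s + 1) * (planck x / x ^ 2))"
      by (intro sums_mult) simp
    moreover have "x powr (s + 1) = x powr (s - 1) * x ^ 2"
    proof -
      have "x powr (s + 1) = x powr (s - 1) * x powr 2" by (simp add: add.commute flip: powr_add)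
      then show ?thesis using x by (simp add: powr_numeral)
    qed
    ultimately show ?thesis using x by simp
  qed
  have "(\<integral>\<^sup>+x. ennreal (indicator {0<..} x * (x powr (s - 1) * planck x)) \<partial>lborel)
     = (\<integral>\<^sup>+x. (\<Sum>n. ennreal (?k n x)) \<partial>lborel)"
  proof (rule nn_integral_cong, rule suminf_ennreal_eq [symmetric])
    fix x :: real
    show "0 \<le> ?k n x" for n by (auto simp: indicator_def k0)
    show "(\<lambda>n. ?k n x) sums (indicator {0<..} x * (x powr (s - 1) * planck x))"
      using k_sums[of x] by (cases "x > 0") auto
  qed
  also have "\<dots> = (\<Sum>n. \<integral>\<^sup>+x. ennreal (?k n x) \<partial>lborel)"
    unfolding k_def by (rule nn_integral_suminf) measurable
  also have "\<dots> = (\<Sum>n. ennreal (Gamma (s + 2) * \<tau> n))"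
  proof (rule suminf_cong)
    fix n
    define h where "h = (\<lambda>x y::real. indicator {0<..} x * indicator {real n..real n+1} y * (x powr (s + 1) * w n y * exp (- x * y)))"
    have [measurable]: "(\<lambda>(x,y). h x y) \<in> borel_measurable (lborel \<Otimes>\<^sub>M lborel)"
      unfolding h_def w_def by measurable
    have "(\<integral>\<^sup>+x. ennreal (?k n x) \<partial>lborel) = (\<integral>\<^sup>+x. \<integral>\<^sup>+y. ennreal (h x y) \<partial>lborel \<partial>lborel)"
    proof (rule nn_integral_cong)
      fix x :: real
      show "ennreal (?k n x) = (\<integral>\<^sup>+y. ennreal (h x y) \<partial>lborel)"
      proof (cases "x > 0")
        case True
        have "(\<integral>\<^sup>+y. ennreal (h x y) \<partial>lborel) = (\<integral>\<^sup>+y. ennreal (indicator {real n..real n+1} y * (x powr (s + 1) * (w n y * exp (- x * y)))) \<partial>lborel)"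
          using True by (intro nn_integral_cong) (simp add: h_def mult_ac)
        also have "\<dots> = ennreal (x powr (s + 1) * k n x)"
          by (rule nn_integral_has_integral_lebesgue[OF _ has_integral_mult_right[OF int_k[OF True]]])
             (auto intro!: mult_nonneg_nonneg w0)
        finally show ?thesis using True by simp
      qed (simp add: h_def)
    qed
    also have "\<dots> = (\<integral>\<^sup>+y. \<integral>\<^sup>+x. ennreal (h x y) \<partial>lborel \<partial>lborel)"
      by (rule lborel_pair.Fubini') measurable
    also have "\<dots> = (\<integral>\<^sup>+y. ennreal (indicator {real n..real n+1} y * (Gamma (s + 2) * (w n y * y powr (- s - 2)))) \<partial>lborel)"
    proof (rule nn_integral_cong)
      fix y :: real
      \<comment> \<open>The point 0 lies only in the interval of n = 0, and the weight
        \<open>w\<close> vanishes at it, so both sides are 0 there.\<close>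
      consider "y \<notin> {real n..real n+1}" | "y \<in> {real n..real n+1}" "y = 0" | "y \<in> {real n..real n+1}" "y > 0" by fastforce
      then show "(\<integral>\<^sup>+x. ennreal (h x y) \<partial>lborel) = ennreal (indicator {real n..real n+1} y * (Gamma (s + 2) * (w n y * y powr (- s - 2))))"
      proof cases
        case 3
        have "(\<integral>\<^sup>+x. ennreal (h x y) \<partial>lborel) = (\<integral>\<^sup>+x. ennreal (w n y) * ennreal (indicator {0<..} x * (x powr ((s + 2) - 1) * exp (- x * y))) \<partial>lborel)"
          using 3 w0[of y n] by (intro nn_integral_cong, subst ennreal_mult' [symmetric]) (auto simp: h_def mult_ac add_ac)
        also have "\<dots> = ennreal (w n y) * ennreal (Gamma (s + 2) * y powr (- (s + 2)))"
          by (subst nn_integral_cmult, measurable, subst nn_integral_Gamma_powr) (use 3 s in auto)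
        also have "\<dots> = ennreal (w n y * (Gamma (s + 2) * y powr (- (s + 2))))"
          using 3 w0[of y n] by (subst ennreal_mult') auto
        finally show ?thesis using 3 by (simp add: mult_ac)
      qed (simp_all add: h_def w_def)
    qed
    also have "\<dots> = ennreal (Gamma (s + 2) * \<tau> n)"
      by (rule nn_integral_has_integral_lebesgue) (use s in \<open>auto intro!: mult_nonneg_nonneg w0 has_integral_mult_right int_\<tau>\<close>)
    finally show "(\<integral>\<^sup>+x. ennreal (?k n x) \<partial>lborel) = ennreal (Gamma (s + 2) * \<tau> n)" .
  qed
  also have "\<dots> = ennreal (Gamma (s + 2) * ?W)"
    by (rule suminf_ennreal_eq[OF _ sums_mult[OF \<tau>sums]]) (use s in \<open>auto intro!: mult_nonneg_nonneg \<tau>0\<close>)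
  finally show "(\<integral>\<^sup>+x. ennreal (indicator {0<..} x * (x powr (s - 1) * planck x)) \<partial>lborel)
     = ennreal (Gamma (s + 2) * ?W)" .
qed

text \<open>Equate the two evaluations of the Mellin integral. Duplication at s/2 + 1 splits
  \<open>Gamma (s + 2)\<close> into Gamma(s/2 + 1) and Gamma((1 + s)/2) up to elementary factors;
  the latter cancels against the spectral side, and the symmetric form is left.\<close>

lemma zetaE_functional_equation_real:
  fixes s :: real
  assumes s: "-1 < s" "s < 0"
  shows "Re (zetaE (of_real s)) * Gamma (s / 2 + 1) * pi powr (- s / 2)
     = Re (zetaE (of_real (1 - s))) * Gamma ((1 - s) / 2 + 1) * pi powr (- (1 - s) / 2)"
proof -
  define E1 E2 where "E1 = Re (zetaE (of_real s))" and "E2 = Re (zetaE (of_real (1 - s)))"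
  \<comment> \<open>Zeta at 1 - s is \<open>zetaE\<close> at 1 - s divided by (1 - s) - 1 =
    -s.\<close>
  have Z: "(\<lambda>n. real (Suc n) powr (s - 1)) sums (E2 / (- s))"
  proof -
    have "(\<lambda>n. Re (1 / of_nat (Suc n) powr of_real (1 - s))) sums Re (zetaE (of_real (1 - s)) / (of_real (1 - s) - 1))"
      by (intro sums_Re zetaE_conv_series) (use s in auto)
    moreover have "Re (1 / of_nat (Suc n) powr of_real (1 - s)) = real (Suc n) powr (s - 1)" for n
    proof -
      have "1 / of_nat (Suc n) powr of_real (1 - s) = complex_of_real (1 / real (Suc n) powr (1 - s))"
        using powr_of_real[of "real (Suc n)" "1 - s"] by simp
      also have "1 / real (Suc n) powr (1 - s) = real (Suc n) powr (s - 1)"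
        using powr_minus_divide[of "real (Suc n)" "1 - s"] by simp
      finally show ?thesis by simp
    qed
    moreover have "Re (zetaE (of_real (1 - s)) / (of_real (1 - s) - 1)) = E2 / (- s)"
    proof -
      have "complex_of_real (1 - s) - 1 = of_real (- s)" by simp
      then show ?thesis unfolding E2_def by (simp only: Re_divide_of_real)
    qed
    ultimately show ?thesis by (simp only:)
  qed
  have E2: "E2 / (- s) \<ge> 0"
    by (rule sums_le[OF _ sums_zero Z]) auto
  have "ennreal (Gamma (s + 2) * (E1 / ((s - 1) * s * (s + 1)))) = ennreal ((2 * pi) powr (s - 1) * Gamma ((1 + s) / 2) * Gamma ((1 - s) / 2) * (E2 / (- s)))"
    using nn_integral_planck_zeta(1)[OF s] nn_integral_planck_spectral[OF s Z] by (simp add: E1_def)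
  moreover have "Gamma (s + 2) * (E1 / ((s - 1) * s * (s + 1))) \<ge> 0"
    using s nn_integral_planck_zeta(2)[OF s] by (intro mult_nonneg_nonneg) (auto simp: E1_def)
  moreover have "(2 * pi) powr (s - 1) * Gamma ((1 + s) / 2) * Gamma ((1 - s) / 2) * (E2 / (- s)) \<ge> 0"
    using s E2 by (intro mult_nonneg_nonneg) auto
  ultimately have eq: "Gamma (s + 2) * (E1 / ((s - 1) * s * (s + 1))) = (2 * pi) powr (s - 1) * Gamma ((1 + s) / 2) * Gamma ((1 - s) / 2) * (E2 / (- s))"
    by (simp add: ennreal_inj)
  have "(s / 2 + 1) \<notin> \<int>\<^sub>\<le>\<^sub>0" "(s / 2 + 1) + 1 / 2 \<notin> \<int>\<^sub>\<le>\<^sub>0"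
    using s by (auto elim!: nonpos_Ints_cases)
  then have "complex_of_real (s / 2 + 1) \<notin> \<int>\<^sub>\<le>\<^sub>0" "complex_of_real (s / 2 + 1) + 1 / 2 \<notin> \<int>\<^sub>\<le>\<^sub>0"
    using of_real_in_nonpos_Ints_iff[where 'a=complex, of "s/2+1"] of_real_in_nonpos_Ints_iff[where 'a=complex, of "s/2+1+1/2"] by auto
  from Gamma_legendre_duplication[OF this]
  have "complex_of_real (Gamma (s / 2 + 1) * Gamma (s / 2 + 1 + 1 / 2)) = complex_of_real (exp ((1 - 2 * (s / 2 + 1)) * ln 2) * sqrt pi * Gamma (s + 2))"
    by (simp add: Gamma_complex_of_real [symmetric] exp_of_real [symmetric] algebra_simps)
  then have dup: "Gamma (s / 2 + 1) * Gamma (s / 2 + 1 + 1 / 2) = exp ((1 - 2 * (s / 2 + 1)) * ln 2) * sqrt pi * Gamma (s + 2)"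
    by (simp only: of_real_eq_iff)
  define G1 G2 G3 where "G1 = Gamma (s / 2 + 1)" and "G2 = Gamma ((1 + s) / 2)" and "G3 = Gamma ((1 - s) / 2)"
  have G: "G1 > 0" "G2 > 0" "G3 > 0" using s by (auto simp: G1_def G2_def G3_def)
  have g2: "Gamma (s / 2 + 1 + 1 / 2) = (1 + s) / 2 * G2"
  proof -
    have "(1 + s) / 2 \<notin> \<int>\<^sub>\<le>\<^sub>0" using s by (auto elim!: nonpos_Ints_cases)
    moreover have "(1 + s) / 2 + 1 = s / 2 + 1 + 1 / 2" by (simp add: field_simps)
    ultimately show ?thesis using Gamma_plus1[of "(1 + s) / 2"] unfolding G2_def by metis
  qed
  have g3: "Gamma ((1 - s) / 2 + 1) = (1 - s) / 2 * G3"
  proof -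
    have "(1 - s) / 2 \<notin> \<int>\<^sub>\<le>\<^sub>0" using s by (auto elim!: nonpos_Ints_cases)
    then show ?thesis using Gamma_plus1[of "(1 - s) / 2"] unfolding G3_def by metis
  qed
  have "exp ((1 - 2 * (s / 2 + 1)) * ln 2) = (2::real) powr (- s - 1)" by (simp add: powr_def algebra_simps)
  from dup[unfolded this g2, folded G1_def]
  have "G1 * ((1 + s) / 2 * G2) = 2 powr (- s - 1) * sqrt pi * Gamma (s + 2)" .
  then have dup': "Gamma (s + 2) = 2 powr (s + 1) * (1 + s) / 2 * G1 * G2 / sqrt pi"
    by (simp add: powr_diff powr_add powr_minus field_simps)
  have p: "(2 * pi) powr (s - 1) = 2 powr (s + 1) / 4 * pi powr (s - 1)"
    by (simp add: powr_mult powr_diff powr_add field_simps)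
  have "2 powr (s + 1) * (1 + s) / 2 * G1 * G2 / sqrt pi * (E1 / ((s - 1) * s * (s + 1))) = 2 powr (s + 1) / 4 * pi powr (s - 1) * G2 * G3 * (E2 / (- s))"
    using eq unfolding dup' p G2_def G3_def by (simp add: mult_ac)
  moreover have "a * (1 + s) / 2 * G1 * G2 / r * (E1 / ((s - 1) * s * (s + 1))) = (a * G2 / 2) * (G1 / r * E1 / ((s - 1) * s))" for a r
  proof -
    have "(1 + s) * (E1 / ((s - 1) * s * (s + 1))) = E1 / ((s - 1) * s)" using s by (simp add: add.commute)
    moreover have "a * (1 + s) / 2 * G1 * G2 / r * (E1 / ((s - 1) * s * (s + 1))) = (a * G2 / 2) * (G1 / r * ((1 + s) * (E1 / ((s - 1) * s * (s + 1)))))"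
      by (simp add: mult_ac)
    ultimately show ?thesis by (simp only: times_divide_eq_right)
  qed
  moreover have "a / 4 * p * G2 * G3 * (E2 / (- s)) = (a * G2 / 2) * (p / 2 * G3 * (E2 / (- s)))" for a p
    by simp
  ultimately have "(2 powr (s + 1) * G2 / 2) * (G1 / sqrt pi * E1 / ((s - 1) * s)) = (2 powr (s + 1) * G2 / 2) * (pi powr (s - 1) / 2 * G3 * (E2 / (- s)))"
    by metis
  then have "G1 / sqrt pi * E1 / ((s - 1) * s) = pi powr (s - 1) / 2 * G3 * (E2 / (- s))"
    using G by (subst (asm) mult_left_cancel) auto
  moreover have "X = Y / 2 * G3 * E2 * (1 - s)" if "X / ((s - 1) * s) = Y / 2 * G3 * (E2 / (- s))" for X Y
  proof -
    have "X = X / ((s - 1) * s) * ((s - 1) * s)" using s by simp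
    also have "\<dots> = Y / 2 * G3 * E2 * (1 - s)"
    proof -
      have "E2 / (- s) * ((s - 1) * s) = E2 * (1 - s)" using s by (simp add: divide_simps) (simp add: algebra_simps)
      then show ?thesis unfolding that by (simp only: mult.assoc)
    qed
    finally show ?thesis .
  qed
  ultimately have "G1 / sqrt pi * E1 = pi powr (s - 1) / 2 * G3 * E2 * (1 - s)" by blast
  then have "G1 / sqrt pi * E1 = pi powr (s - 1) * ((1 - s) / 2 * G3) * E2"
    by (simp add: mult_ac)
  then have m: "(G1 / sqrt pi * E1) * pi powr ((1 - s) / 2) = (pi powr (s - 1) * ((1 - s) / 2 * G3) * E2) * pi powr ((1 - s) / 2)"
    by (simp only:)
  have r1: "(1 / sqrt pi) * pi powr ((1 - s) / 2) = pi powr (- s / 2)"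
  proof -
    have "1 / sqrt pi = pi powr (- (1 / 2))" by (simp add: powr_minus powr_half_sqrt inverse_eq_divide)
    then have "(1 / sqrt pi) * pi powr ((1 - s) / 2) = pi powr (- (1 / 2) + (1 - s) / 2)" by (simp only: powr_add)
    also have "- (1 / 2) + (1 - s) / 2 = - s / 2" by (simp add: field_simps)
    finally show ?thesis .
  qed
  have r2: "pi powr (s - 1) * pi powr ((1 - s) / 2) = pi powr (- (1 - s) / 2)"
    by (simp add: powr_add [symmetric] field_simps)
  have "G1 * E1 * pi powr (- s / 2) = (G1 / sqrt pi * E1) * pi powr ((1 - s) / 2)"
    unfolding r1 [symmetric] by simp
  also have "\<dots> = (pi powr (s - 1) * pi powr ((1 - s) / 2)) * ((1 - s) / 2 * G3) * E2"
    unfolding m by (simp only: mult_ac)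
  finally have "G1 * E1 * pi powr (- s / 2) = pi powr (- (1 - s) / 2) * ((1 - s) / 2 * G3) * E2"
    unfolding r2 .
  then show ?thesis unfolding g3 E1_def E2_def G1_def by (simp add: mult_ac)
qed

section \<open>The completed zeta function\<close>

text \<open>Riemann's xi function: s/2 times Gamma(s/2) is written as Gamma(s/2 + 1), which leaves
  no removable singularity at s = 0.\<close>

definition xi1 :: "complex \<Rightarrow> complex" where
  "xi1 s = zetaE s * Gamma (s / 2 + 1) * of_real pi powr (- s / 2)"

text \<open>By the functional equation the two branches agree on the whole strip -1 < Re s < 2, so
  reflection continues \<open>xi1\<close> past its boundary line.\<close>

definition xi :: "complex \<Rightarrow> complex" where
  "xi s = (if Re s > -1 then xi1 s else xi1 (1 - s))"

lemma half_plus_one_not_nonpos_Int: "Re s > -1 \<Longrightarrow> s / 2 + 1 \<notin> \<int>\<^sub>\<le>\<^sub>0"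
  by (auto elim!: nonpos_Ints_cases simp: complex_eq_iff)

lemma xi1_holomorphic: "xi1 holomorphic_on {s. Re s > -1}"
  unfolding xi1_def
  by (intro holomorphic_intros zetaE_holomorphic) (auto simp: half_plus_one_not_nonpos_Int)

lemma xi1_of_real:
  assumes "x > -1"
  shows "xi1 (of_real x) = of_real (Re (zetaE (of_real x)) * Gamma (x / 2 + 1) * pi powr (- x / 2))"
proof -
  have "cnj (zetaE (of_real x)) = zetaE (of_real x)" using cnj_zetaE[of "of_real x"] assms by simp
  then have "zetaE (of_real x) = of_real (Re (zetaE (of_real x)))" by (simp add: complex_eq_iff)
  moreover have "Gamma (of_real x / 2 + 1) = complex_of_real (Gamma (x / 2 + 1))"
    by (simp flip: Gamma_complex_of_real)
  moreover have "complex_of_real pi powr (- of_real x / 2) = of_real (pi powr (- x / 2))"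
    by (simp flip: powr_of_real)
  ultimately show ?thesis unfolding xi1_def by (metis of_real_mult)
qed

lemma xi1_functional_equation:
  assumes "-1 < Re s" "Re s < 2"
  shows "xi1 s = xi1 (1 - s)"
proof -
  let ?D = "{s. Re s > -1} \<inter> {s. Re s < 2}"
  have "xi1 s - xi1 (1 - s) = 0"
  proof (rule analytic_continuation[where f = "\<lambda>s. xi1 s - xi1 (1 - s)" and S = ?D and U = "of_real ` {-1<..<0}" and \<xi> = "- 1 / 2"])
    have "(\<lambda>s. xi1 (1 - s)) holomorphic_on ?D"
      by (rule holomorphic_on_compose_gen[OF _ xi1_holomorphic, unfolded o_def]) (auto intro!: holomorphic_intros)
    then show "(\<lambda>s. xi1 s - xi1 (1 - s)) holomorphic_on ?D"
      by (intro holomorphic_on_diff holomorphic_on_subset[OF xi1_holomorphic]) auto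
    show "open ?D" by (intro open_Int open_halfspace_Re_gt open_halfspace_Re_lt)
    show "connected ?D" by (intro convex_connected convex_Int convex_halfspace_Re_gt convex_halfspace_Re_lt)
    show "(- 1 / 2 :: complex) islimpt of_real ` {-1<..<0}"
      unfolding islimpt_approachable
    proof (intro allI impI)
      fix e :: real assume e: "e > 0"
      define x where "x = - 1 / 2 + min (e / 2) (1 / 4)"
      have "x \<in> {-1<..<0}" "x \<noteq> - 1 / 2" "\<bar>x - (- 1 / 2)\<bar> < e" using e by (auto simp: x_def min_def)
      then have "complex_of_real x \<in> of_real ` {-1<..<0}" "complex_of_real x \<noteq> of_real (- 1 / 2)" "dist (complex_of_real x) (of_real (- 1 / 2)) < e"
        by (blast, simp only: of_real_eq_iff not_False_eq_True, simp only: dist_of_real dist_real_def)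
      then show "\<exists>x'\<in>complex_of_real ` {-1<..<0}. x' \<noteq> - 1 / 2 \<and> dist x' (- 1 / 2) < e"
        by (intro bexI[of _ "of_real x"]) simp_all
    qed
    fix z assume "z \<in> complex_of_real ` {-1<..<0}"
    then obtain x where x: "-1 < x" "x < 0" and z: "z = of_real x" by auto
    have "1 - z = of_real (1 - x)" by (simp add: z)
    then have "xi1 (1 - z) = xi1 z"
      using xi1_of_real[of "1 - x"] xi1_of_real[of x] x zetaE_functional_equation_real[OF x]
      by (simp only: z)
    then show "xi1 z - xi1 (1 - z) = 0" by simp
  qed (use assms in auto)
  then show ?thesis by simp
qed

lemma xi_holomorphic: "xi holomorphic_on A"
proof -
  have 1: "xi holomorphic_on {s. Re s > -1}"
    by (rule holomorphic_transform[OF xi1_holomorphic]) (simp add: xi_def)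
  have "(\<lambda>s. xi1 (1 - s)) holomorphic_on {s. Re s < 2}"
    by (rule holomorphic_on_compose_gen[OF _ xi1_holomorphic, unfolded o_def]) (auto intro!: holomorphic_intros)
  then have 2: "xi holomorphic_on {s. Re s < 2}"
  proof (rule holomorphic_transform)
    fix s assume "s \<in> {s. Re s < 2}"
    then show "xi1 (1 - s) = xi s"
      by (cases "Re s > -1") (simp_all add: xi_def xi1_functional_equation [symmetric])
  qed
  have "xi holomorphic_on {s. Re s > -1} \<union> {s. Re s < 2}"
    by (rule holomorphic_on_Un[OF 1 2 open_halfspace_Re_gt open_halfspace_Re_lt])
  then show ?thesis by (rule holomorphic_on_subset) auto
qed

lemma xi_symmetric: "xi (1 - s) = xi s"
proof -
  consider "Re s \<le> -1" | "Re s > -1" "Re s < 2" | "Re s \<ge> 2" by linarith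
  then show ?thesis
    by cases (simp_all add: xi_def xi1_functional_equation [symmetric])
qed

lemma xi_cnj: "xi (cnj s) = cnj (xi s)"
proof -
  have "xi1 (cnj s) = cnj (xi1 s)" if "Re s > -1" for s
    using cnj_zetaE[OF that] cnj_Gamma[of "s / 2 + 1"] by (simp add: xi1_def cnj_powr)
  from this[of s] this[of "1 - s"] show ?thesis by (auto simp: xi_def)
qed

text \<open>This resolves the definite description in the definition of \<open>zeta\<close>: the
  formula proves existence, and uniqueness holds because the plane without 1 is connected. All later
  facts about \<open>zeta\<close> go through the entire function \<open>xi\<close> or through the
  series.\<close>

lemma zeta_eq_xi: "zeta = (\<lambda>s. xi s * rGamma (s / 2 + 1) * of_real pi powr (s / 2) / (s - 1))"
  and zeta_conv_series: "1 < Re s \<Longrightarrow> zeta s = (\<Sum>n. 1 / (of_nat (Suc n)) powr s)"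
proof -
  define z where "z = (\<lambda>s. xi s * rGamma (s / 2 + 1) * of_real pi powr (s / 2) / (s - 1))"
  have z_hol: "z holomorphic_on (- {1})"
    unfolding z_def by (intro holomorphic_intros xi_holomorphic) auto
  have z_series: "z s = (\<Sum>n. 1 / (of_nat (Suc n)) powr s)" if s: "1 < Re s" for s
  proof -
    have "of_real pi powr (- s / 2) * of_real pi powr (s / 2) = (1::complex)"
      by (simp flip: powr_add)
    moreover have "Gamma (s / 2 + 1) * rGamma (s / 2 + 1) = 1"
      using half_plus_one_not_nonpos_Int[of s] s by (simp add: rGamma_inverse_Gamma Gamma_eq_zero_iff)
    moreover have "z s = zetaE s * (Gamma (s / 2 + 1) * rGamma (s / 2 + 1)) * (of_real pi powr (- s / 2) * of_real pi powr (s / 2)) / (s - 1)"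
      using s by (simp add: z_def xi_def xi1_def mult_ac)
    ultimately have "z s = zetaE s / (s - 1)" by simp
    then show ?thesis using zetaE_conv_series[OF s] by (simp add: sums_iff)
  qed
  have "zeta = z" unfolding zeta_def
  proof (rule the_equality)
    \<comment> \<open>Division by zero gives \<open>z 1 = 0\<close>, in agreement with the value
      prescribed at the pole.\<close>
    show "z holomorphic_on (- {1}) \<and> (\<forall>s. 1 < Re s \<longrightarrow> z s = (\<Sum>n. 1 / (of_nat (Suc n)) powr s)) \<and> z 1 = 0"
      using z_hol z_series by (auto simp: z_def)
    fix f :: "complex \<Rightarrow> complex"
    assume f: "f holomorphic_on (- {1}) \<and> (\<forall>s. 1 < Re s \<longrightarrow> f s = (\<Sum>n. 1 / (of_nat (Suc n)) powr s)) \<and> f 1 = 0"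
    show "f = z"
    proof
      fix s show "f s = z s"
      proof (cases "s = 1")
        case False
        show ?thesis
        proof (rule analytic_continuation_open[of "{s. 1 < Re s}" "- {1}" f z])
          show "connected (- {1::complex})" by (rule connected_punctured_universe) simp
          have "(2::complex) \<in> {s. 1 < Re s}" by simp
          then show "{s. 1 < Re s} \<noteq> {}" by blast
        qed (use f z_hol z_series False in \<open>auto simp: open_halfspace_Re_gt\<close>)
      qed (use f in \<open>auto simp: z_def\<close>)
    qed
  qed
  then show "zeta = (\<lambda>s. xi s * rGamma (s / 2 + 1) * of_real pi powr (s / 2) / (s - 1))"
    "1 < Re s \<Longrightarrow> zeta s = (\<Sum>n. 1 / (of_nat (Suc n)) powr s)"
    using z_series by (simp_all add: z_def)
qed

section \<open>The zeros of xi and their multiplicities\<close>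

lemma zeta_2: "zeta 2 = of_real (pi\<^sup>2 / 6)"
proof -
  have "(\<Sum>n. 1 / (of_nat (Suc n)) powr 2) = (\<Sum>n. complex_of_real (1 / real (Suc n) ^ 2))"
    by (rule suminf_cong) (simp add: powr_numeral del: of_nat_Suc)
  also have "(\<lambda>n. complex_of_real (1 / real (Suc n) ^ 2)) sums of_real (pi\<^sup>2 / 6)"
    using inverse_squares_sums by (intro sums_of_real) (simp add: add.commute)
  then have "(\<Sum>n. complex_of_real (1 / real (Suc n) ^ 2)) = of_real (pi\<^sup>2 / 6)" by (rule sums_unique [symmetric])
  finally show ?thesis by (subst zeta_conv_series) simp_all
qed

lemma xi_1: "xi 1 \<noteq> 0"
  by (simp add: xi_def xi1_def zetaE_1 Gamma_eq_zero_iff half_plus_one_not_nonpos_Int[of 1, simplified])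

lemma rGamma_half_plus_one_eq_0_iff: "rGamma (s / 2 + 1 :: complex) = 0 \<longleftrightarrow> (\<exists>n::nat. s = - 2 * of_nat (Suc n))"
proof
  assume "rGamma (s / 2 + 1) = 0"
  then have "s / 2 + 1 \<in> \<int>\<^sub>\<le>\<^sub>0" by (simp add: rGamma_eq_zero_iff)
  then obtain n where "s / 2 + 1 = - of_nat n" by (auto elim!: nonpos_Ints_cases')
  moreover have "s = 2 * (s / 2 + 1) - 2" by simp
  ultimately have "s = 2 * (- of_nat n) - 2" by (simp only:)
  then have "s = - 2 * of_nat (Suc n)" by simp
  then show "\<exists>n::nat. s = - 2 * of_nat (Suc n)" by blast
next
  assume "\<exists>n::nat. s = - 2 * of_nat (Suc n)"
  then obtain n :: nat where "s = - 2 * of_nat (Suc n)" by blast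
  then have "s / 2 + 1 = - of_nat n" by (simp add: complex_eq_iff field_simps)
  then show "rGamma (s / 2 + 1) = 0" by (simp add: rGamma_eq_zero_iff)
qed


text \<open>Comparison with zeta(2): the terms after the first have absolute values summing to at
  most pi^2/6 - 1 < 1.\<close>

lemma zetaE_nonzero_Re_ge_2:
  assumes "Re s \<ge> 2"
  shows "zetaE s \<noteq> 0"
proof
  assume "zetaE s = 0"
  define f where "f = (\<lambda>n. 1 / of_nat (Suc n) powr s)"
  have "f sums 0" unfolding f_def using zetaE_conv_series[of s] assms \<open>zetaE s = 0\<close> by simp
  moreover have "f 0 = 1" by (simp add: f_def)
  ultimately have fs: "(\<lambda>n. f (Suc n)) sums - 1" by (simp add: sums_Suc_iff)
  have "(\<lambda>n. 1 / (real n + 1)\<^sup>2) sums (pi\<^sup>2 / 6)"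
    using inverse_squares_sums by (simp add: add.commute)
  then have gs: "(\<lambda>n. 1 / (real (Suc n) + 1)\<^sup>2) sums (pi\<^sup>2 / 6 - 1)"
    by (subst sums_Suc_iff) simp
  have "norm (f (Suc n)) \<le> 1 / (real (Suc n) + 1)\<^sup>2" for n
  proof -
    have "norm (f (Suc n)) = 1 / real (Suc (Suc n)) powr Re s"
      unfolding f_def by (simp add: norm_divide norm_powr_real_powr del: of_nat_Suc)
    also have "\<dots> \<le> 1 / real (Suc (Suc n)) powr 2"
      using assms by (intro divide_left_mono powr_mono) auto
    finally show ?thesis by (simp add: powr_numeral add_ac)
  qed
  then have "norm (\<Sum>n. f (Suc n)) \<le> (\<Sum>n. 1 / (real (Suc n) + 1)\<^sup>2)"
    by (intro norm_suminf_le sums_summable[OF gs])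
  then have "1 \<le> pi\<^sup>2 / 6 - 1" using fs gs by (simp add: sums_iff)
  moreover have "pi\<^sup>2 < 3.2\<^sup>2" using pi_approx by (intro power_strict_mono) auto
  ultimately show False by (simp add: power2_eq_square)
qed

lemma xi_nonzero_Re_ge_2: "Re s \<ge> 2 \<Longrightarrow> xi s \<noteq> 0"
  using zetaE_nonzero_Re_ge_2[of s] half_plus_one_not_nonpos_Int[of s]
  by (simp add: xi_def xi1_def Gamma_eq_zero_iff)

text \<open>On [1/2, 1] the error terms sum to at most (1 - x)/4 times pi^2/6, which is below (1 -
  x)/2, so the real part of \<open>zetaE\<close> is at least x. Beyond 1 the Dirichlet series is at
  least its first term. With the symmetry of \<open>xi\<close> this keeps the base of the contour
  free of zeros.\<close>

lemma zetaE_real_nonzero: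
  fixes x :: real
  assumes x: "x \<ge> 1 / 2"
  shows "zetaE (of_real x) \<noteq> 0"
proof (cases "x \<le> 1")
  case True
  have gs: "(\<lambda>n. 1 / real (Suc n) ^ 2) sums (pi\<^sup>2 / 6)"
    using inverse_squares_sums by (simp add: add.commute)
  have "norm (zeta_term (real (Suc n)) (of_real x)) \<le> (1 - x) / 4 * (1 / real (Suc n) ^ 2)" for n
  proof -
    have "norm (zeta_term (real (Suc n)) (of_real x)) \<le> norm ((of_real x - 1) * of_real x * (of_real x + 1) :: complex) / 8 * real (Suc n) powr (- Re (of_real x) - 2)"
      by (rule norm_zeta_term_le) (use x in auto)
    also have "norm ((of_real x - 1) * of_real x * (of_real x + 1) :: complex) = (1 - x) * x * (x + 1)"
    proof -
      have "(of_real x - 1) * of_real x * (of_real x + 1) = complex_of_real ((x - 1) * x * (x + 1))" by simp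
      then show ?thesis using x True by (simp only: norm_of_real) (simp add: abs_mult)
    qed
    also have "(1 - x) * x * (x + 1) / 8 * real (Suc n) powr (- Re (of_real x) - 2) \<le> (1 - x) * 1 * 2 / 8 * real (Suc n) powr (- 2)"
      using x True by (intro mult_mono divide_right_mono powr_mono) auto
    also have "real (Suc n) powr (- 2) = 1 / real (Suc n) ^ 2"
      by (simp add: powr_minus powr_numeral inverse_eq_divide)
    finally show ?thesis by (simp add: divide_simps)
  qed
  then have "norm (\<Sum>n. zeta_term (real (Suc n)) (of_real x)) \<le> (\<Sum>n. (1 - x) / 4 * (1 / real (Suc n) ^ 2))"
    by (intro norm_suminf_le sums_summable[OF sums_mult[OF gs]])
  also have "\<dots> = (1 - x) / 4 * (pi\<^sup>2 / 6)" using sums_mult[OF gs, of "(1 - x) / 4"] unfolding sums_iff by blast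
  also have "\<dots> \<le> (1 - x) / 4 * 2"
  proof -
    have "pi\<^sup>2 < 3.2\<^sup>2" using pi_approx by (intro power_strict_mono) auto
    then show ?thesis using True by (intro mult_left_mono) (auto simp: power2_eq_square)
  qed
  finally have *: "norm (\<Sum>n. zeta_term (real (Suc n)) (of_real x)) \<le> (1 - x) / 2" by simp
  have "Re (zetaE (of_real x)) = 1 + (x - 1) / 2 + Re (\<Sum>n. zeta_term (real (Suc n)) (of_real x))"
    by (simp add: zetaE_def)
  moreover have "Re (\<Sum>n. zeta_term (real (Suc n)) (of_real x)) \<ge> - ((1 - x) / 2)"
    using * abs_Re_le_cmod[of "\<Sum>n. zeta_term (real (Suc n)) (of_real x)"] by linarith
  ultimately have "Re (zetaE (of_real x)) \<ge> x" by (simp add: field_simps)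
  then show ?thesis using x by auto
next
  case False
  define f where "f = (\<lambda>n. 1 / real (Suc n) powr x)"
  have "(\<lambda>n. Re (1 / of_nat (Suc n) powr of_real x)) sums Re (zetaE (of_real x) / (of_real x - 1))"
    by (intro sums_Re zetaE_conv_series) (use False in auto)
  moreover have "Re (1 / of_nat (Suc n) powr of_real x) = f n" for n
  proof -
    have "1 / of_nat (Suc n) powr of_real x = complex_of_real (f n)"
      using powr_of_real[of "real (Suc n)" x] by (simp add: f_def)
    then show ?thesis by (simp only: Re_complex_of_real)
  qed
  ultimately have "f sums Re (zetaE (of_real x) / (of_real x - 1))" by (simp only:)
  then have "(\<Sum>n<1. f n) \<le> Re (zetaE (of_real x) / (of_real x - 1))"
    using sum_le_suminf[of f "{..<1}"] by (simp add: sums_iff f_def)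
  then have "Re (zetaE (of_real x) / (of_real x - 1)) \<ge> 1" by (simp add: f_def)
  then show ?thesis by auto
qed

lemma xi_real_nonzero: "xi (of_real x) \<noteq> 0"
proof -
  have *: "xi (of_real x) \<noteq> 0" if "x \<ge> 1 / 2" for x
    using zetaE_real_nonzero[OF that] half_plus_one_not_nonpos_Int[of "of_real x"] that
    by (simp add: xi_def xi1_def Gamma_eq_zero_iff)
  show ?thesis using *[of x] *[of "1 - x"] xi_symmetric[of "of_real x"] by (cases "x \<ge> 1/2") auto
qed

lemma xi_zero_Re: "xi s = 0 \<Longrightarrow> -1 < Re s \<and> Re s < 2"
  using xi_nonzero_Re_ge_2[of s] xi_nonzero_Re_ge_2[of "1 - s"] xi_symmetric[of s] by force

lemma xi_zero_Im:
  assumes "xi s = 0"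
  shows "Im s \<noteq> 0"
proof
  assume "Im s = 0"
  then have "s = of_real (Re s)" by (simp add: complex_eq_iff)
  then show False using xi_real_nonzero[of "Re s"] assms by simp
qed

text \<open>The factor \<open>rGamma\<close> carries exactly the trivial zeros. Conversely a zero of
  \<open>xi\<close> is not real, so it is neither a trivial zero nor the point 1.\<close>

lemma nontrivial_zeros_eq: "nontrivial_zeros = {s. xi s = 0}"
proof -
  have "s \<in> nontrivial_zeros \<longleftrightarrow> xi s = 0" for s
  proof
    assume "s \<in> nontrivial_zeros"
    then show "xi s = 0"
      using rGamma_half_plus_one_eq_0_iff[of s]
      by (auto simp: nontrivial_zeros_def zeta_eq_xi)
  next
    assume x: "xi s = 0"
    then have "s \<noteq> 1" using xi_1 by auto
    moreover have "s \<noteq> - 2 * of_nat (Suc n)" for n using xi_zero_Im[OF x] by auto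
    ultimately show "s \<in> nontrivial_zeros" using x by (auto simp: nontrivial_zeros_def zeta_eq_xi)
  qed
  then show ?thesis by auto
qed

lemma xi_analytic: "xi analytic_on A"
  by (rule analytic_on_subset[of _ UNIV]) (simp_all add: analytic_on_open xi_holomorphic)

lemma eventually_xi_nonzero: "\<forall>\<^sub>F z in at \<rho>. xi z \<noteq> 0"
proof -
  have "\<forall>\<^sub>F z in at \<rho>. xi z \<noteq> 0 \<and> z \<in> UNIV"
    by (rule non_zero_neighbour_alt[OF xi_holomorphic, of UNIV \<rho> 1]) (auto simp: xi_1)
  then show ?thesis by (rule eventually_mono) simp
qed

text \<open>The cofactor \<open>g\<close> of \<open>xi\<close> in \<open>zeta\<close> is holomorphic
  and nonzero at \<open>\<rho>\<close>, again because zeros of \<open>xi\<close> are not real; hence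
  it has order 0 there.\<close>

lemma mult_zero_eq:
  assumes "xi \<rho> = 0"
  shows "mult_zero \<rho> = of_int (zorder xi \<rho>)"
proof -
  have r1: "\<rho> \<noteq> 1" using assms xi_1 by auto
  define g :: "complex \<Rightarrow> complex" where "g = (\<lambda>s. rGamma (s / 2 + 1) * of_real pi powr (s / 2) / (s - 1))"
  have g_hol: "g holomorphic_on (- {1})" unfolding g_def by (intro holomorphic_intros) auto
  then have "g analytic_on (- {1})" by (subst analytic_on_open) auto
  then have g_an: "g analytic_on {\<rho>}" by (rule analytic_on_subset) (use r1 in auto)
  have g_nz: "g \<rho> \<noteq> 0"
    using r1 xi_zero_Im[OF assms] rGamma_half_plus_one_eq_0_iff[of \<rho>] by (auto simp: g_def)
  have "\<forall>\<^sub>F z in at \<rho>. g z \<noteq> 0 \<and> z \<in> - {1}"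
    by (rule non_zero_neighbour_alt[OF g_hol, of \<rho> \<rho>])
       (use r1 g_nz in \<open>auto intro!: connected_punctured_universe\<close>)
  with eventually_xi_nonzero have "\<forall>\<^sub>F z in at \<rho>. xi z * g z \<noteq> 0" by eventually_elim auto
  from zorder_times_analytic[OF xi_analytic g_an this]
  have "zorder (\<lambda>s. xi s * g s) \<rho> = zorder xi \<rho> + zorder g \<rho>" .
  moreover have "zorder g \<rho> = 0"
    by (rule zorder_eqI[of "- {1}" \<rho> g]) (use r1 g_nz g_hol in auto)
  moreover have "zeta = (\<lambda>s. xi s * g s)" by (auto simp: zeta_eq_xi g_def)
  ultimately show ?thesis by (simp add: mult_zero_def)
qed

section \<open>Stirling's formula and the Riemann--Siegel theta function\<close>

text \<open>The Peano kernel of the midpoint rule with its first Euler--Maclaurin correction.\<close>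

definition midpoint_kernel :: "real \<Rightarrow> real \<Rightarrow> real" where
  "midpoint_kernel a x = (let v = min (x - a) (a + 1 - x) in (v\<^sup>2 / 2 - v ^ 4) / 24)"

text \<open>The maximum 1/384 is attained at the midpoint \<open>v = 1 / 2\<close>.\<close>

lemma midpoint_kernel_bounds:
  assumes "x \<in> {a..a+1}"
  shows "0 \<le> midpoint_kernel a x" "midpoint_kernel a x \<le> 1 / 384"
proof -
  define v where "v = min (x - a) (a + 1 - x)"
  have v: "0 \<le> v" "v \<le> 1 / 2" using assms by (auto simp: v_def min_def)
  have k: "midpoint_kernel a x = (v\<^sup>2 / 2 - v ^ 4) / 24" by (simp add: midpoint_kernel_def v_def Let_def)
  have "v\<^sup>2 \<le> (1 / 2)\<^sup>2" using v by (intro power_mono) auto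
  then have "v\<^sup>2 * v\<^sup>2 \<le> (1 / 4) * v\<^sup>2" by (intro mult_right_mono) (auto simp: power2_eq_square)
  then have "v ^ 4 \<le> (1 / 4) * v\<^sup>2" by (simp flip: power_add)
  then show "0 \<le> midpoint_kernel a x" unfolding k by (simp add: field_simps) (smt (verit) zero_le_power2)
  have "0 \<le> (v\<^sup>2 - 1 / 4)\<^sup>2" by simp
  then have "v\<^sup>2 / 2 - v ^ 4 \<le> 1 / 16" by (simp add: power2_diff field_simps flip: power_mult)
  then show "midpoint_kernel a x \<le> 1 / 384" unfolding k by simp
qed

text \<open>Four integrations by parts on each half interval. At the midpoint the kernel and its
  second derivative match from both sides and the first derivative vanishes, while the third
  derivative jumps by 1 and so produces \<open>f (a + 1 / 2)\<close>. The value 1/24 of the second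
  derivative at the ends gives the correction in \<open>f1\<close>.\<close>

lemma midpoint_error:
  fixes F :: "real \<Rightarrow> real"
  assumes F: "\<And>x. (F has_real_derivative f x) (at x)"
    and f: "\<And>x. (f has_real_derivative f1 x) (at x)"
    and f1: "\<And>x. (f1 has_real_derivative f2 x) (at x)"
    and f2: "\<And>x. (f2 has_real_derivative f3 x) (at x)"
    and f3: "\<And>x. (f3 has_real_derivative f4 x) (at x)"
  shows "((\<lambda>x. midpoint_kernel a x * f4 x) has_integral f (a + 1 / 2) + (f1 (a + 1) - f1 a) / 24 - (F (a + 1) - F a)) {a..a+1}"
proof -
  define K where "K = (\<lambda>v::real. (v\<^sup>2 / 2 - v ^ 4) / 24)"
  define G1 where "G1 = (\<lambda>x. K (x - a) * f3 x - ((x - a) - 4 * (x - a) ^ 3) / 24 * f2 x + (1 - 12 * (x - a)\<^sup>2) / 24 * f1 x + (x - a) * f x - F x)"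
  define G2 where "G2 = (\<lambda>x. K (a + 1 - x) * f3 x + ((a + 1 - x) - 4 * (a + 1 - x) ^ 3) / 24 * f2 x + (1 - 12 * (a + 1 - x)\<^sup>2) / 24 * f1 x - (a + 1 - x) * f x - F x)"
  have "((\<lambda>x. K (x - a) * f4 x) has_integral G1 (a + 1 / 2) - G1 a) {a..a+1/2}"
  proof (rule has_integral_FTC)
    fix x
    have "(G1 has_real_derivative K (x - a) * f4 x) (at x)"
      unfolding G1_def K_def
      by (rule derivative_eq_intros F f f1 f2 f3 refl | simp)+ (simp add: field_simps power2_eq_square power3_eq_cube power4_eq_xxxx)
    then show "(G1 has_real_derivative K (x - a) * f4 x) (at x within {a..a+1/2})" by (rule has_field_derivative_at_within)
  qed simp
  then have 1: "((\<lambda>x. midpoint_kernel a x * f4 x) has_integral G1 (a + 1 / 2) - G1 a) {a..a+1/2}"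
    by (rule has_integral_eq[rotated]) (auto simp: midpoint_kernel_def K_def Let_def min_def)
  have "((\<lambda>x. K (a + 1 - x) * f4 x) has_integral G2 (a + 1) - G2 (a + 1 / 2)) {a+1/2..a+1}"
  proof (rule has_integral_FTC)
    fix x
    have "(G2 has_real_derivative K (a + 1 - x) * f4 x) (at x)"
      unfolding G2_def K_def
      by (rule derivative_eq_intros F f f1 f2 f3 refl | simp)+ (simp add: field_simps power2_eq_square power3_eq_cube power4_eq_xxxx)
    then show "(G2 has_real_derivative K (a + 1 - x) * f4 x) (at x within {a+1/2..a+1})" by (rule has_field_derivative_at_within)
  qed simp
  then have 2: "((\<lambda>x. midpoint_kernel a x * f4 x) has_integral G2 (a + 1) - G2 (a + 1 / 2)) {a+1/2..a+1}"
    by (rule has_integral_eq[rotated]) (auto simp: midpoint_kernel_def K_def Let_def min_absorb2)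
  have "((\<lambda>x. midpoint_kernel a x * f4 x) has_integral (G1 (a + 1 / 2) - G1 a) + (G2 (a + 1) - G2 (a + 1 / 2))) {a..a+1}"
    by (rule has_integral_combine[OF _ _ 1 2]) auto
  also have "(G1 (a + 1 / 2) - G1 a) + (G2 (a + 1) - G2 (a + 1 / 2)) = f (a + 1 / 2) + (f1 (a + 1) - f1 a) / 24 - (F (a + 1) - F a)"
    by (simp add: G1_def G2_def K_def power2_eq_square power3_eq_cube power4_eq_xxxx field_simps)
  finally show ?thesis .
qed

text \<open>The summand is the argument of k + 1/2 + it, \<open>F\<close> is an antiderivative of
  it, and \<open>R\<close> is the remainder of the corrected midpoint rule. The fourth derivative
  changes sign at x = t, so each bound has its own majorant, chosen to have an elementary
  antiderivative (\<open>P1\<close>, \<open>P2\<close>). The lower bound is the sharper one, as it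
  feeds the upper bound for the phase, where little room is left.\<close>

lemma arctan_midpoint_sum:
  fixes t :: real and M :: nat
  assumes t: "t > 0"
  defines "F \<equiv> \<lambda>x. pi / 2 * x - x * arctan (x / t) + t / 2 * ln (t\<^sup>2 + x\<^sup>2)"
  defines "R \<equiv> (\<Sum>k<M. pi / 2 - arctan ((real k + 1 / 2) / t)) - (F (real M) - F 0) + (1 / t - t / (t\<^sup>2 + (real M)\<^sup>2)) / 24"
  shows "- 1 / (128 * t ^ 3) \<le> R" "R \<le> 1 / (64 * t ^ 3)"
proof -
  have r: "t\<^sup>2 + x\<^sup>2 > 0" for x using t by (simp add: add_pos_nonneg)
  define f where "f = (\<lambda>x. pi / 2 - arctan (x / t))"
  define q where "q = (\<lambda>x. inverse (t\<^sup>2 + x\<^sup>2))"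
  define f1 where "f1 = (\<lambda>x. - t * q x ^ Suc 0)"
  define f2 where "f2 = (\<lambda>x. 2 * t * x * q x ^ Suc 1)"
  define f3 where "f3 = (\<lambda>x. 2 * t * (t\<^sup>2 - 3 * x\<^sup>2) * q x ^ Suc 2)"
  define f4 where "f4 = (\<lambda>x. 24 * t * x * (x\<^sup>2 - t\<^sup>2) * q x ^ 4)"
  have datan: "((\<lambda>x. arctan (x / t)) has_real_derivative t / (t\<^sup>2 + x\<^sup>2)) (at x)" for x
  proof -
    have "((\<lambda>x. arctan (x / t)) has_real_derivative inverse (1 + (x / t)\<^sup>2) * (1 / t)) (at x)"
      using t by (auto intro!: derivative_eq_intros)
    also have "inverse (1 + (x / t)\<^sup>2) * (1 / t) = t / (t\<^sup>2 + x\<^sup>2)"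
    proof -
      have "1 + (x / t)\<^sup>2 = (t\<^sup>2 + x\<^sup>2) / t\<^sup>2" using t by (simp add: field_simps)
      then show ?thesis using t by (simp add: power2_eq_square)
    qed
    finally show ?thesis .
  qed
  have dF: "(F has_real_derivative f x) (at x)" for x
  proof -
    have "(F has_real_derivative pi / 2 - (1 * arctan (x / t) + t / (t\<^sup>2 + x\<^sup>2) * x) + t / 2 * (1 / (t\<^sup>2 + x\<^sup>2) * (2 * x))) (at x)"
    proof -
      have "((\<lambda>x. ln (t\<^sup>2 + x\<^sup>2)) has_real_derivative 1 / (t\<^sup>2 + x\<^sup>2) * (2 * x)) (at x)"
        using r[of x] by (auto intro!: derivative_eq_intros)
      moreover have "((\<lambda>x. pi / 2 * x) has_real_derivative pi / 2) (at x)"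
        by (rule DERIV_cmult_Id)
      ultimately show ?thesis unfolding F_def
        by (intro DERIV_add DERIV_diff DERIV_mult[OF DERIV_ident datan] DERIV_cmult)
    qed
    then show ?thesis unfolding f_def by simp
  qed
  have df: "(f has_real_derivative f1 x) (at x)" for x
    unfolding f_def by (rule DERIV_cong[OF DERIV_diff[OF DERIV_const datan]]) (simp add: f1_def q_def divide_inverse)
  have dq: "(q has_real_derivative - (2 * x * q x ^ 2)) (at x)" for x
    unfolding q_def using r[of x] by (auto intro!: derivative_eq_intros simp: power2_eq_square)
  \<comment> \<open>Inserting this factor 1 brings the powers of \<open>q\<close> in a derivative to
    a common degree.\<close>
  have q: "q x * (t\<^sup>2 + x\<^sup>2) = 1" for x
    unfolding q_def using r[of x] by (intro left_inverse) (metis less_irrefl)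
  have df1: "(f1 has_real_derivative f2 x) (at x)" for x
    unfolding f1_def f2_def by (rule derivative_eq_intros dq refl)+ (simp add: numeral_eq_Suc algebra_simps)
  have df2: "(f2 has_real_derivative f3 x) (at x)" for x
  proof -
    have "(f2 has_real_derivative 2 * t * q x ^ Suc 1 - 8 * t * x\<^sup>2 * q x ^ 3) (at x)"
      unfolding f2_def by (rule derivative_eq_intros dq refl)+ (simp add: numeral_eq_Suc algebra_simps)
    also have "2 * t * q x ^ Suc 1 - 8 * t * x\<^sup>2 * q x ^ 3 = 2 * t * q x ^ 2 * (q x * (t\<^sup>2 + x\<^sup>2)) - 8 * t * x\<^sup>2 * q x ^ 3"
      unfolding q by (simp add: power2_eq_square)
    also have "\<dots> = f3 x" unfolding f3_def by (simp add: algebra_simps power2_eq_square power3_eq_cube)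
    finally show ?thesis .
  qed
  have df3: "(f3 has_real_derivative f4 x) (at x)" for x
  proof -
    have "(f3 has_real_derivative (- 12 * t * x) * q x ^ 3 - 12 * t * x * (t\<^sup>2 - 3 * x\<^sup>2) * q x ^ 4) (at x)"
      unfolding f3_def by (rule derivative_eq_intros dq refl)+ (simp add: numeral_eq_Suc algebra_simps)
    also have "(- 12 * t * x) * q x ^ 3 - 12 * t * x * (t\<^sup>2 - 3 * x\<^sup>2) * q x ^ 4 = (- 12 * t * x) * q x ^ 3 * (q x * (t\<^sup>2 + x\<^sup>2)) - 12 * t * x * (t\<^sup>2 - 3 * x\<^sup>2) * q x ^ 4"
      unfolding q by simp
    also have "\<dots> = f4 x" unfolding f4_def by (simp add: algebra_simps power2_eq_square power3_eq_cube power4_eq_xxxx)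
    finally show ?thesis .
  qed
  define P1 where "P1 = (\<lambda>x. - 3 * t ^ 5 * q x ^ Suc 3)"
  define P2 where "P2 = (\<lambda>x. - 6 * t * q x ^ Suc 1)"
  have dP1: "(P1 has_real_derivative 24 * t ^ 5 * x * q x ^ 5) (at x)" for x
    unfolding P1_def by (rule derivative_eq_intros dq refl)+ (simp add: numeral_eq_Suc algebra_simps)
  have dP2: "(P2 has_real_derivative 24 * t * x * q x ^ 3) (at x)" for x
    unfolding P2_def by (rule derivative_eq_intros dq refl)+ (simp add: numeral_eq_Suc algebra_simps)
  have q0: "q x > 0" for x using r[of x] by (simp add: q_def)
  \<comment> \<open>The factor t^2 - x^2 is first completed to t^4 - x^4, and only then is x^4
    dropped. This yields the constant 1/128; dropping x^2 at once would yield 1/96, too large for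
    the final margin.\<close>
  have b1: "- f4 x \<le> 24 * t ^ 5 * x * q x ^ 5" if "x \<ge> 0" for x
  proof -
    have "- f4 x = 24 * t * x * q x ^ 4 * (q x * (t\<^sup>2 + x\<^sup>2)) * (t\<^sup>2 - x\<^sup>2)"
      unfolding q f4_def by (simp add: algebra_simps)
    also have "\<dots> = 24 * t * x * q x ^ 5 * (t ^ 4 - x ^ 4)"
      by (simp add: algebra_simps numeral_eq_Suc)
    also have "\<dots> \<le> 24 * t * x * q x ^ 5 * t ^ 4"
      using that t q0[of x] by (intro mult_left_mono) (auto intro!: mult_nonneg_nonneg)
    also have "\<dots> = 24 * t ^ 5 * x * q x ^ 5" by (simp add: numeral_eq_Suc)
    finally show ?thesis .
  qed
  have b2: "f4 x \<le> 24 * t * x * q x ^ 3" if "x \<ge> 0" for x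
  proof -
    have "f4 x \<le> 24 * t * x * (t\<^sup>2 + x\<^sup>2) * q x ^ 4"
      unfolding f4_def using that t q0[of x] by (intro mult_right_mono mult_left_mono) (auto intro!: mult_nonneg_nonneg)
    also have "\<dots> = 24 * t * x * q x ^ 3 * (q x * (t\<^sup>2 + x\<^sup>2))" by (simp add: numeral_eq_Suc)
    finally show ?thesis unfolding q by simp
  qed
  define e where "e = (\<lambda>k. f (real k + 1 / 2) + (f1 (real k + 1) - f1 (real k)) / 24 - (F (real k + 1) - F (real k)))"
  have e: "((\<lambda>x. midpoint_kernel (real k) x * f4 x) has_integral e k) {real k..real k+1}" for k
    unfolding e_def by (rule midpoint_error[OF dF df df1 df2 df3])
  have I1: "((\<lambda>x. 1 / 384 * (24 * t ^ 5 * x * q x ^ 5)) has_integral 1 / 384 * (P1 (real k + 1) - P1 (real k))) {real k..real k+1}" for k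
    by (intro has_integral_mult_right has_integral_FTC has_field_derivative_at_within[OF dP1]) simp
  have I2: "((\<lambda>x. 1 / 384 * (24 * t * x * q x ^ 3)) has_integral 1 / 384 * (P2 (real k + 1) - P2 (real k))) {real k..real k+1}" for k
    by (intro has_integral_mult_right has_integral_FTC has_field_derivative_at_within[OF dP2]) simp
  have kb: "midpoint_kernel a x * y \<le> 1 / 384 * z" if "x \<in> {a..a+1}" "y \<le> z" "0 \<le> z" for a x y z
  proof -
    have "midpoint_kernel a x * y \<le> midpoint_kernel a x * z"
      using midpoint_kernel_bounds[OF that(1)] that by (intro mult_left_mono) auto
    also have "\<dots> \<le> 1 / 384 * z"
      using midpoint_kernel_bounds[OF that(1)] that by (intro mult_right_mono) auto
    finally show ?thesis .
  qed
  have e1: "- e k \<le> 1 / 384 * (P1 (real k + 1) - P1 (real k))" for k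
  proof (rule has_integral_le[OF has_integral_neg[OF e] I1])
    fix x assume x: "x \<in> {real k..real k+1}"
    have "midpoint_kernel (real k) x * (- f4 x) \<le> 1 / 384 * (24 * t ^ 5 * x * q x ^ 5)"
      by (rule kb[OF x b1]) (use x t q0[of x] in \<open>auto intro!: mult_nonneg_nonneg\<close>)
    then show "- (midpoint_kernel (real k) x * f4 x) \<le> 1 / 384 * (24 * t ^ 5 * x * q x ^ 5)" by simp
  qed
  have e2: "e k \<le> 1 / 384 * (P2 (real k + 1) - P2 (real k))" for k
  proof (rule has_integral_le[OF e I2])
    fix x assume x: "x \<in> {real k..real k+1}"
    show "midpoint_kernel (real k) x * f4 x \<le> 1 / 384 * (24 * t * x * q x ^ 3)"
      by (rule kb[OF x b2]) (use x t q0[of x] in \<open>auto intro!: mult_nonneg_nonneg\<close>)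
  qed
  have tel: "(\<Sum>k<M. h (real k + 1) - h (real k)) = h (real M) - h 0" for h :: "real \<Rightarrow> real"
    using sum_lessThan_telescope[of "\<lambda>k. h (real k)" M] by (simp add: add.commute)
  have Re: "R = (\<Sum>k<M. e k)"
  proof -
    have "(\<Sum>k<M. e k) = (\<Sum>k<M. f (real k + 1 / 2)) + (\<Sum>k<M. f1 (real k + 1) - f1 (real k)) / 24 - (\<Sum>k<M. F (real k + 1) - F (real k))"
      unfolding e_def by (simp add: sum.distrib sum_subtractf flip: sum_divide_distrib)
    also have "\<dots> = (\<Sum>k<M. f (real k + 1 / 2)) + (f1 (real M) - f1 0) / 24 - (F (real M) - F 0)"
      unfolding tel ..
    also have "f1 (real M) = - (t / (t\<^sup>2 + (real M)\<^sup>2))" by (simp add: f1_def q_def divide_inverse)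
    also have "f1 0 = - (1 / t)" using t by (simp add: f1_def q_def power2_eq_square field_simps)
    also have "(\<Sum>k<M. f (real k + 1 / 2)) + (- (t / (t\<^sup>2 + (real M)\<^sup>2)) - - (1 / t)) / 24 - (F (real M) - F 0) = R"
      unfolding R_def f_def by simp
    finally show ?thesis by simp
  qed
  have "- R = (\<Sum>k<M. - e k)" by (simp add: Re sum_negf)
  also have "\<dots> \<le> (\<Sum>k<M. 1 / 384 * (P1 (real k + 1) - P1 (real k)))" by (intro sum_mono e1)
  also have "\<dots> = 1 / 384 * (P1 (real M) - P1 0)" unfolding sum_distrib_left [symmetric] tel ..
  also have "\<dots> \<le> 1 / 384 * (- P1 0)" using t q0[of "real M"] by (simp add: P1_def)
  also have "\<dots> = 1 / (128 * t ^ 3)" using t by (simp add: P1_def q_def field_simps numeral_eq_Suc)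
  finally show "- 1 / (128 * t ^ 3) \<le> R" by simp
  have "R \<le> (\<Sum>k<M. 1 / 384 * (P2 (real k + 1) - P2 (real k)))" unfolding Re by (intro sum_mono e2)
  also have "\<dots> = 1 / 384 * (P2 (real M) - P2 0)" unfolding sum_distrib_left [symmetric] tel ..
  also have "\<dots> \<le> 1 / 384 * (- P2 0)" using t q0[of "real M"] by (simp add: P2_def)
  also have "\<dots> = 1 / (64 * t ^ 3)" using t by (simp add: P2_def q_def field_simps numeral_eq_Suc)
  finally show "R \<le> 1 / (64 * t ^ 3)" .
qed

lemma Im_Ln_Complex: "x > 0 \<Longrightarrow> t > 0 \<Longrightarrow> Im (Ln (Complex x t)) = pi / 2 - arctan (x / t)"
  using arctan_inverse[of "x / t"] by (subst Im_Ln_eq) (auto simp: complex_eq_iff)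

text \<open>At 1/2 + it the imaginary parts of the logarithms in \<open>ln_Gamma_series\<close> are
  the summands of the midpoint sum above. That sum enters with a minus sign, so its lower bound
  gives the upper bound here; both survive the limit.\<close>

lemma Im_ln_Gamma_half_bounds:
  assumes t: "t > 0"
  defines "g \<equiv> Im (ln_Gamma (Complex (1/2) t))"
  shows "t * ln t - t + 1 / (24 * t) - 1 / (64 * t ^ 3) \<le> g" "g \<le> t * ln t - t + 1 / (24 * t) + 1 / (128 * t ^ 3)"
proof -
  define z where "z = Complex (1/2) t"
  define F where "F = (\<lambda>x. pi / 2 * x - x * arctan (x / t) + t / 2 * ln (t\<^sup>2 + x\<^sup>2))"
  define s where "s = (\<lambda>M::nat. \<Sum>k<M. pi / 2 - arctan ((real k + 1 / 2) / t))"
  have z: "z \<notin> \<int>\<^sub>\<le>\<^sub>0" by (auto simp: z_def complex_eq_iff elim!: nonpos_Ints_cases)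
  have L: "(\<lambda>n. Im (ln_Gamma_series z n)) \<longlonglongrightarrow> g"
    unfolding g_def z_def [symmetric] by (intro tendsto_Im ln_Gamma_complex_LIMSEQ z)
  have S: "Im (ln_Gamma_series z n) = t * ln (real n) - s (Suc n)" if n: "n > 0" for n
  proof -
    have "Im (Ln (z / of_nat k + 1)) = pi / 2 - arctan ((real k + 1 / 2) / t)" if "k \<in> {1..n}" for k
    proof -
      have "z / of_nat k + 1 = Complex (1 / 2 / real k + 1) (t / real k)"
        using that by (simp add: z_def complex_eq_iff)
      moreover have "(1 / 2 / real k + 1) / (t / real k) = (real k + 1 / 2) / t" using that t by (simp add: field_simps)
      ultimately show ?thesis using that t Im_Ln_Complex[of "1 / 2 / real k + 1" "t / real k"] by (simp add: add_pos_pos)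
    qed
    then have "Im (\<Sum>k=1..n. Ln (z / of_nat k + 1)) = (\<Sum>k=1..n. pi / 2 - arctan ((real k + 1 / 2) / t))" by simp
    moreover have "Im (Ln z) = pi / 2 - arctan ((real 0 + 1 / 2) / t)" using t Im_Ln_Complex[of "1/2" t] by (simp add: z_def)
    moreover have "s (Suc n) = (pi / 2 - arctan ((real 0 + 1 / 2) / t)) + (\<Sum>k=1..n. pi / 2 - arctan ((real k + 1 / 2) / t))"
    proof -
      have "{..<Suc n} = insert 0 {1..n}" by auto
      then show ?thesis unfolding s_def by simp
    qed
    moreover have "Im (z * Ln (of_nat n)) = t * ln (real n)"
      using n by (simp add: z_def Ln_of_nat)
    ultimately show ?thesis by (simp add: ln_Gamma_series_def)
  qed
  have lim: "(\<lambda>n. t * ln (real n) - (F (real (Suc n)) - F 0) + (1 / t - t / (t\<^sup>2 + (real (Suc n))\<^sup>2)) / 24) \<longlonglongrightarrow> t * ln t - t + 1 / (24 * t)"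
  proof -
    have "(\<lambda>n. t * ln (real n) - F (real (Suc n))) \<longlonglongrightarrow> - t"
      unfolding F_def using t by real_asymp
    moreover have "(\<lambda>n. t / (t\<^sup>2 + (real (Suc n))\<^sup>2)) \<longlonglongrightarrow> 0"
      using t by real_asymp
    ultimately have "(\<lambda>n. (t * ln (real n) - F (real (Suc n))) + F 0 + (1 / t - t / (t\<^sup>2 + (real (Suc n))\<^sup>2)) / 24) \<longlonglongrightarrow> - t + F 0 + (1 / t - 0) / 24"
      by (intro tendsto_intros) auto
    moreover have "F 0 = t * ln t" using t by (simp add: F_def ln_realpow)
    ultimately show ?thesis by (simp add: algebra_simps)
  qed
  show "t * ln t - t + 1 / (24 * t) - 1 / (64 * t ^ 3) \<le> g"
  proof (rule LIMSEQ_le[OF tendsto_diff[OF lim tendsto_const] L], rule exI[of _ 1], safe)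
    fix n :: nat assume "n \<ge> 1"
    then show "t * ln (real n) - (F (real (Suc n)) - F 0) + (1 / t - t / (t\<^sup>2 + (real (Suc n))\<^sup>2)) / 24 - 1 / (64 * t ^ 3) \<le> Im (ln_Gamma_series z n)"
      using arctan_midpoint_sum(2)[OF t, of "Suc n"] S[of n] unfolding s_def F_def by simp
  qed
  show "g \<le> t * ln t - t + 1 / (24 * t) + 1 / (128 * t ^ 3)"
  proof (rule LIMSEQ_le[OF L tendsto_add[OF lim tendsto_const]], rule exI[of _ 1], safe)
    fix n :: nat assume "n \<ge> 1"
    then show "Im (ln_Gamma_series z n) \<le> t * ln (real n) - (F (real (Suc n)) - F 0) + (1 / t - t / (t\<^sup>2 + (real (Suc n))\<^sup>2)) / 24 + 1 / (128 * t ^ 3)"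
      using arctan_midpoint_sum(1)[OF t, of "Suc n"] S[of n] unfolding s_def F_def by simp
  qed
qed

text \<open>A continuous function with values in the multiples of 2 pi is constant on a connected
  set. It is used to compare two continuous choices of an argument.\<close>

lemma continuous_cis_eq_1_constant:
  fixes D :: "'a :: topological_space \<Rightarrow> real"
  assumes A: "connected A" and D: "continuous_on A D" and 1: "\<And>t. t \<in> A \<Longrightarrow> cis (D t) = 1"
    and "s \<in> A" "t \<in> A"
  shows "D s = D t"
proof -
  have k: "\<exists>k::int. D t = 2 * pi * k" if "t \<in> A" for t
  proof -
    have "cos (D t) = 1" using arg_cong[OF 1[OF that], of Re] by simp
    then obtain k :: int where "D t = k * (2 * pi)" using cos_one_2pi_int by auto
    then show ?thesis by (intro exI[of _ k]) simp
  qed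
  have "D constant_on A"
  proof (rule continuous_discrete_range_constant[OF A D])
    fix x assume x: "x \<in> A"
    show "\<exists>e>0. \<forall>y. y \<in> A \<and> D y \<noteq> D x \<longrightarrow> e \<le> norm (D y - D x)"
    proof (intro exI[of _ "2 * pi"] conjI allI impI)
      fix y assume y: "y \<in> A \<and> D y \<noteq> D x"
      obtain k l :: int where kl: "D x = 2 * pi * k" "D y = 2 * pi * l" using k x y by blast
      then have "l \<noteq> k" using y by auto
      then have "1 \<le> \<bar>real_of_int (l - k)\<bar>" by linarith
      then have "2 * pi * 1 \<le> 2 * pi * \<bar>real_of_int (l - k)\<bar>" by (intro mult_left_mono) auto
      also have "\<dots> = \<bar>2 * pi * real_of_int (l - k)\<bar>" by (simp add: abs_mult)
      finally show "2 * pi \<le> norm (D y - D x)" unfolding kl by (simp add: algebra_simps)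
    qed simp
  qed
  then show ?thesis using assms unfolding constant_on_def by metis
qed

lemma cos_ii_of_real: "cos (\<i> * of_real y) = of_real (cosh y)"
  by (simp add: cosh_def cos_exp_eq exp_of_real scaleR_conv_of_real flip: exp_of_real)

lemma sin_ii_of_real: "sin (\<i> * of_real y) = \<i> * of_real (sinh y)"
  by (simp add: sinh_def sin_exp_eq exp_of_real scaleR_conv_of_real field_simps flip: exp_of_real)

lemma sgn_Gamma:
  assumes "Re z > 0"
  shows "sgn (Gamma z) = cis (Im (ln_Gamma z))"
proof -
  have "z \<notin> \<int>\<^sub>\<le>\<^sub>0" using assms by (auto elim!: nonpos_Ints_cases)
  then have "Gamma z = exp (ln_Gamma z)" by (simp add: Gamma_complex_altdef)
  then show ?thesis by (simp add: sgn_eq exp_eq_polar norm_mult)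
qed

text \<open>This moves the phase from 1/4 + it/2, where theta needs it, to 1/2 + it, where the
  midpoint sum applies. Duplication at z = 1/4 + it/2 involves z + 1/2, which is the conjugate of 1
  - z; reflection turns that factor into a second \<open>Gamma z\<close>, and sin(pi z) has argument
  \<open>arctan (tanh (pi * t / 2))\<close>. This settles the identity modulo 2 pi; continuity and
  the value at t = 0 do the rest.\<close>

lemma Im_ln_Gamma_quarter:
  "2 * Im (ln_Gamma (Complex (1/4) (t/2))) = Im (ln_Gamma (Complex (1/2) t)) - t * ln 2 - arctan (tanh (pi * t / 2))"
proof -
  define D where "D = (\<lambda>t. 2 * Im (ln_Gamma (Complex (1/4) (t/2))) - Im (ln_Gamma (Complex (1/2) t)) + t * ln 2 + arctan (tanh (pi * t / 2)))"
  have "cis (D t) = 1" for t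
  proof -
    define z where "z = Complex (1/4) (t/2)"
    have z: "z \<notin> \<int>\<^sub>\<le>\<^sub>0" "z + 1 / 2 \<notin> \<int>\<^sub>\<le>\<^sub>0" by (auto simp: z_def complex_eq_iff elim!: nonpos_Ints_cases)
    have 2: "2 * z = Complex (1/2) t" by (simp add: z_def complex_eq_iff)
    have "sgn (Gamma z) * sgn (Gamma (z + 1/2)) = sgn (exp ((1 - 2*z) * of_real (ln 2))) * sgn (complex_of_real (sqrt pi)) * sgn (Gamma (2*z))"
      using arg_cong[OF Gamma_legendre_duplication[OF z], of sgn] by (simp add: sgn_mult)
    also have "sgn (complex_of_real (sqrt pi)) = 1" by (simp add: sgn_of_real)
    also have "sgn (exp ((1 - 2*z) * of_real (ln 2))) = cis (- (t * ln 2))"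
      by (simp add: sgn_eq exp_eq_polar norm_mult z_def)
    also have "Gamma (z + 1/2) = cnj (Gamma (1 - z))"
    proof -
      have "z + 1/2 = cnj (1 - z)" by (simp add: z_def complex_eq_iff)
      then show ?thesis by (simp only: cnj_Gamma)
    qed
    also have "sgn (cnj (Gamma (1 - z))) = sgn (Gamma z) * cis (arctan (tanh (pi * t / 2)))"
    proof -
      define y where "y = pi * t / 2"
      have "complex_of_real pi * z = of_real (pi / 4) + \<i> * of_real y" by (simp add: z_def y_def complex_eq_iff)
      then have "sin (of_real pi * z) = of_real (sin (pi / 4)) * cos (\<i> * of_real y) + of_real (cos (pi / 4)) * sin (\<i> * of_real y)"
        by (simp only: sin_add sin_of_real cos_of_real)
      also have "\<dots> = of_real (sqrt 2 / 2 * cosh y) * (1 + \<i> * of_real (tanh y))"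
        unfolding sin_45 cos_45 cos_ii_of_real sin_ii_of_real by (simp add: complex_eq_iff tanh_def)
      finally have "sin (of_real pi * z) = of_real (sqrt 2 / 2 * cosh y) * (1 + \<i> * of_real (tanh y))" .
      moreover have "sqrt 2 / 2 * cosh y > 0" by simp
      ultimately have s: "sgn (sin (of_real pi * z)) = sgn (1 + \<i> * of_real (tanh y))"
        by (simp only: sgn_mult sgn_of_real sgn_pos) simp
      also have "\<dots> = cis (arctan (tanh y))"
      proof -
        have "norm (1 + \<i> * complex_of_real (tanh y)) = sqrt (1 + (tanh y)\<^sup>2)" by (simp add: cmod_def)
        then show ?thesis by (simp add: sgn_eq complex_eq_iff cos_arctan sin_arctan)
      qed
      finally have s: "sgn (sin (of_real pi * z)) = cis (arctan (tanh y))" .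
      have nz: "sin (of_real pi * z) \<noteq> 0" using s by (metis cis_neq_zero sgn_zero)
      have "Gamma z * Gamma (1 - z) * sin (of_real pi * z) = of_real pi"
        using nz Gamma_reflection_complex[of z] by simp
      then have "sgn (Gamma z) * sgn (Gamma (1 - z)) * sgn (sin (of_real pi * z)) = 1"
        using arg_cong[of _ _ sgn] by (metis sgn_mult sgn_of_real sgn_pos pi_gt_zero of_real_1)
      then have *: "sgn (Gamma z) * cis (arctan (tanh y)) * sgn (Gamma (1 - z)) = 1" unfolding s by (simp add: mult_ac)
      have "Gamma (1 - z) \<noteq> 0" using * by auto
      then have "sgn (Gamma (1 - z)) * cnj (sgn (Gamma (1 - z))) = 1"
        by (simp add: complex_norm_square [symmetric] norm_sgn)
      then have "sgn (Gamma z) * cis (arctan (tanh y)) * (sgn (Gamma (1 - z)) * cnj (sgn (Gamma (1 - z)))) = sgn (Gamma z) * cis (arctan (tanh y))" by simp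
      then have "cnj (sgn (Gamma (1 - z))) = sgn (Gamma z) * cis (arctan (tanh y))"
        using * by (metis mult.assoc mult_1)
      then show ?thesis by (simp add: sgn_eq y_def)
    qed
    finally have "sgn (Gamma z) * (sgn (Gamma z) * cis (arctan (tanh (pi * t / 2)))) = cis (- (t * ln 2)) * sgn (Gamma (2 * z))" by simp
    then have "cis (Im (ln_Gamma z) + (Im (ln_Gamma z) + arctan (tanh (pi * t / 2)))) = cis (- (t * ln 2) + Im (ln_Gamma (2 * z)))"
      using sgn_Gamma[of z] sgn_Gamma[of "2 * z"] by (simp add: z_def cis_mult)
    then have "cis (D t) * cis (- (t * ln 2) + Im (ln_Gamma (2 * z))) = cis (- (t * ln 2) + Im (ln_Gamma (2 * z)))"
      unfolding cis_mult D_def 2 unfolding z_def by (simp add: algebra_simps)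
    then show ?thesis by simp
  qed
  moreover have "continuous_on UNIV D"
    unfolding D_def Complex_eq
    by (intro continuous_intros continuous_on_compose2[OF continuous_on_ln_Gamma_complex[of "- \<real>\<^sub>\<le>\<^sub>0"]])
       (auto simp: complex_nonpos_Reals_iff)
  ultimately have "D t = D 0" by (intro continuous_cis_eq_1_constant[of UNIV]) auto
  moreover have "D 0 = 0"
  proof -
    have "Im (ln_Gamma (Complex x 0)) = 0" if "x > 0" for x
      using ln_Gamma_complex_of_real[OF that] by (simp add: complex_of_real_def)
    then show ?thesis by (simp add: D_def)
  qed
  ultimately show ?thesis by (simp add: D_def)
qed

definition rs_theta :: "real \<Rightarrow> real" where
  "rs_theta t = Im (ln_Gamma (Complex (1/4) (t/2))) - t / 2 * ln pi"

lemma continuous_on_rs_theta: "continuous_on A rs_theta"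
  unfolding rs_theta_def Complex_eq
  by (intro continuous_intros continuous_on_compose2[OF continuous_on_ln_Gamma_complex[of "- \<real>\<^sub>\<le>\<^sub>0"]])
     (auto simp: complex_nonpos_Reals_iff)

text \<open>By the addition formula the difference is exactly arctan(exp(-2y)).\<close>

lemma arctan_tanh_bounds: "0 \<le> pi / 4 - arctan (tanh y) \<and> pi / 4 - arctan (tanh y) \<le> exp (- 2 * y)" if "y \<ge> 0" for y :: real
proof -
  have T: "0 \<le> tanh y" "tanh y < 1" using that tanh_real_bounds[of y] by (auto simp: tanh_real_nonneg_iff)
  have "arctan 1 + arctan (- tanh y) = arctan ((1 + - tanh y) / (1 - 1 * (- tanh y)))"
    by (rule arctan_add) (use T in auto)
  then have "pi / 4 - arctan (tanh y) = arctan ((1 - tanh y) / (1 + tanh y))" by (simp add: arctan_one arctan_minus)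
  also have "(1 - tanh y) / (1 + tanh y) = exp (- 2 * y)"
  proof -
    have "(1 - (1 - q) / (1 + q)) / (1 + (1 - q) / (1 + q)) = q" if "q > 0" for q :: real
    proof -
      have "1 - (1 - q) / (1 + q) = 2 * q / (1 + q)" "1 + (1 - q) / (1 + q) = 2 / (1 + q)"
        using that by (simp_all add: field_simps)
      then show ?thesis using that by simp
    qed
    then show ?thesis unfolding tanh_real_altdef by simp
  qed
  finally have e: "pi / 4 - arctan (tanh y) = arctan (exp (- 2 * y))" .
  then show ?thesis by (simp add: arctan_le_self)
qed

text \<open>
  The leading term of the error is \<open>1/(48 \<pi> t)\<close>, only half a percent below \<open>1/(150 t)\<close>; at \<open>t = 2\<pi>\<close>
  this just leaves room for the remainder \<open>1/(256 \<pi> t\<^sup>3)\<close> of Stirling's formula.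
\<close>

lemma rs_theta_approx:
  assumes t: "t \<ge> 2 * pi"
  shows "0 \<le> rs_theta t / pi + 1 - L t" "rs_theta t / pi + 1 - L t \<le> 1 / (150 * t)"
proof -
  have t6: "t \<ge> 6.28" using t pi_approx by simp
  then have t0: "t > 0" by simp
  define g where "g = Im (ln_Gamma (Complex (1/2) t)) - (t * ln t - t)"
  have g: "1 / (24 * t) - 1 / (64 * t ^ 3) \<le> g" "g \<le> 1 / (24 * t) + 1 / (128 * t ^ 3)"
    using Im_ln_Gamma_half_bounds[OF t0] by (auto simp: g_def)
  define h where "h = pi / 4 - arctan (tanh (pi * t / 2))"
  have h: "0 \<le> h" "h \<le> exp (- (pi * t))" using arctan_tanh_bounds[of "pi * t / 2"] t0 by (auto simp: h_def)
  \<comment> \<open>The limit pi/4 of the arctangent contributes -1/8 after halving and division by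
    pi; with the 1 on the left this is the constant 7/8 in \<open>L\<close>.\<close>
  have eq: "rs_theta t / pi + 1 - L t = (g + h) / (2 * pi)"
  proof -
    have "rs_theta t = (g + h) / 2 + t / 2 * (ln t - 1 - ln 2 - ln pi) - pi / 8"
      using Im_ln_Gamma_quarter[of t] unfolding rs_theta_def g_def h_def by (simp add: field_simps)
    then have "rs_theta t / pi = (g + h) / (2 * pi) + t / (2 * pi) * (ln t - 1 - ln 2 - ln pi) - 1 / 8"

    proof -
      have "(a + t / 2 * X - pi / 8) / pi = a / pi + t / (2 * pi) * X - 1 / 8" for a X
        by (simp add: field_simps)
      then show ?thesis using \<open>rs_theta t = _\<close> by simp
    qed
    moreover have "ln t - 1 - ln 2 - ln pi = ln (t / (2 * pi)) - 1" using t0 by (simp add: ln_div ln_mult)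
    ultimately have "rs_theta t / pi = (g + h) / (2 * pi) + t / (2 * pi) * (ln (t / (2 * pi)) - 1) - 1 / 8"
      by (simp only:)
    then show ?thesis unfolding L_def by linarith
  qed
  have "1 / (64 * t ^ 3) \<le> 1 / (24 * t)"
  proof -
    have "24 * t * 1 \<le> 64 * t * t ^ 2" using t6 by (intro mult_mono) (auto simp: one_le_power)
    then show ?thesis using t0 by (intro divide_left_mono) (auto simp: power2_eq_square power3_eq_cube)
  qed
  then show "0 \<le> rs_theta t / pi + 1 - L t" unfolding eq using g h by (intro divide_nonneg_pos) auto
  \<comment> \<open>The constant 0.0008 is what the margin below can spare. A quadratic Taylor bound
    gives 1.4 t \<le> exp(t/2); its sixth power and 3 < pi bound exp(pi t) from below, and 1.4^6
    times 6^3 exceeds 1/0.0008.\<close>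
  have ex: "exp (- (pi * t)) * t ^ 3 \<le> 0.0008"
  proof -
    have "1.4 * t \<le> 1 + t / 2 + (t / 2)\<^sup>2 / 2"
    proof -
      have "0 \<le> (t - 6.28) * (t - 0.92)" using t6 by (intro mult_nonneg_nonneg) auto
      also have "\<dots> \<le> 8 * (1 + t / 2 + (t / 2)\<^sup>2 / 2 - 1.4 * t)"
        using t6 by (simp add: power2_eq_square algebra_simps) (simp add: field_simps)
      finally show ?thesis by simp
    qed
    also have "\<dots> \<le> exp (t / 2)" using t0 by (intro exp_lower_Taylor_quadratic) auto
    finally have "(1.4 * t) ^ 6 \<le> exp (t / 2) ^ 6" using t0 by (intro power_mono) auto
    also have "exp (t / 2) ^ 6 = exp (3 * t)" by (simp flip: exp_of_nat_mult)
    also have "\<dots> \<le> exp (pi * t)" using t0 pi_approx by simp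
    finally have 1: "(1.4 * t) ^ 6 \<le> exp (pi * t)" .
    have "t ^ 3 * (6 ^ 3) \<le> t ^ 3 * t ^ 3" using t6 by (intro mult_left_mono power_mono) auto
    moreover have "t ^ 3 * t ^ 3 = t ^ 6" by (simp flip: power_add)
    ultimately have "t ^ 3 * 216 \<le> t ^ 6" by simp
    moreover have "(1.4 * t) ^ 6 = 7.529536 * t ^ 6" unfolding power_mult_distrib by (simp add: power_divide)
    moreover have "t ^ 3 \<ge> 0" using t0 by simp
    moreover have "x \<le> 0.0008 * (7.529536 * y)" if "x * 216 \<le> y" "0 \<le> x" for x y :: real
      using that by (simp add: field_simps)
    ultimately have "t ^ 3 \<le> 0.0008 * (1.4 * t) ^ 6" by (simp only:)
    also have "\<dots> \<le> 0.0008 * exp (pi * t)" using 1 by simp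
    finally show ?thesis by (simp add: exp_minus field_simps)
  qed
  have "(g + h) * t ^ 3 \<le> (1 / (24 * t) + 1 / (128 * t ^ 3) + exp (- (pi * t))) * t ^ 3"
    using g h t0 by (intro mult_right_mono) auto
  also have "\<dots> = t\<^sup>2 / 24 + 1 / 128 + exp (- (pi * t)) * t ^ 3"
    using t0 by (simp add: algebra_simps power2_eq_square power3_eq_cube)
  also have "\<dots> \<le> t\<^sup>2 / 24 + 1 / 128 + 0.0008" by (intro add_left_mono ex)
  \<comment> \<open>The tight step: at t = 6.28 the two sides differ by about 0.00006, and the
    difference grows with t^2.\<close>
  also have "\<dots> \<le> (2 * 3.1415 / 150) * t\<^sup>2"
  proof -
    have "6.28\<^sup>2 \<le> t\<^sup>2" using t6 by (intro power_mono) auto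
    then show ?thesis by (simp add: power2_eq_square)
  qed
  also have "\<dots> \<le> (2 * pi / 150) * t\<^sup>2" using pi_approx by (intro mult_right_mono) auto
  also have "\<dots> = (2 * pi) / (150 * t) * t ^ 3" using t0 by (simp add: power2_eq_square power3_eq_cube)
  finally have "(g + h) * t ^ 3 \<le> (2 * pi) / (150 * t) * t ^ 3" .
  then have "g + h \<le> (2 * pi) / (150 * t)" by (rule mult_right_le_imp_le) (use t0 in simp)
  then have "(g + h) / (2 * pi) \<le> ((2 * pi) / (150 * t)) / (2 * pi)" by (intro divide_right_mono) auto
  then show "rs_theta t / pi + 1 - L t \<le> 1 / (150 * t)" unfolding eq by simp
qed

section \<open>The argument principle and the counting function\<close>

text \<open>Two lifts starting at 0 differ by a continuous function with values in the multiples of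
  2 pi, hence coincide. Nonvanishing of \<open>f\<close> along the path is what determines the
  argument at each point.\<close>

lemma arg_variation_eqI:
  assumes \<theta>: "continuous_on {0..1} \<theta>" "\<theta> 0 = 0"
    and eq: "\<And>t. t \<in> {0..1} \<Longrightarrow> f (g t) = of_real (norm (f (g t))) * exp (\<i> * of_real (\<theta> t))"
    and nz: "\<And>t. t \<in> {0..1} \<Longrightarrow> f (g t) \<noteq> 0"
  shows "arg_variation g f = \<theta> 1"
  unfolding arg_variation_def
proof (rule the_equality)
  show "\<exists>\<theta>'. continuous_on {0..1} \<theta>' \<and> \<theta>' 0 = 0 \<and>
      (\<forall>t\<in>{0..1}. f (g t) = of_real (norm (f (g t))) * exp (\<i> * of_real (\<theta>' t))) \<and> \<theta> 1 = \<theta>' 1"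
    using \<theta> eq by blast
  fix v
  assume "\<exists>\<theta>'. continuous_on {0..1} \<theta>' \<and> \<theta>' 0 = 0 \<and>
      (\<forall>t\<in>{0..1}. f (g t) = of_real (norm (f (g t))) * exp (\<i> * of_real (\<theta>' t))) \<and> v = \<theta>' 1"
  then obtain \<theta>' where \<theta>': "continuous_on {0..1} \<theta>'" "\<theta>' 0 = 0" "v = \<theta>' 1"
    and eq': "\<And>t. t \<in> {0..1} \<Longrightarrow> f (g t) = of_real (norm (f (g t))) * exp (\<i> * of_real (\<theta>' t))" by blast
  have "\<theta>' 1 - \<theta> 1 = \<theta>' 0 - \<theta> 0"
  proof (rule continuous_cis_eq_1_constant[where D = "\<lambda>t. \<theta>' t - \<theta> t" and A = "{0..1::real}"])
    fix t :: real assume t: "t \<in> {0..1}"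
    have "of_real (norm (f (g t))) * cis (\<theta>' t) = of_real (norm (f (g t))) * cis (\<theta> t)"
      using eq[OF t] eq'[OF t] by (simp add: cis_conv_exp)
    then have "cis (\<theta>' t) = cis (\<theta> t)" using nz[OF t] by simp
    then show "cis (\<theta>' t - \<theta> t) = 1" by (simp flip: cis_divide)
  qed (use \<theta> \<theta>' in \<open>auto intro!: continuous_intros\<close>)
  then show "v = \<theta> 1" using \<theta> \<theta>' by simp
qed

text \<open>The chain rule on the smooth pieces; the finitely many corners are negligible.\<close>

lemma contour_integral_compose:
  assumes \<gamma>: "valid_path \<gamma>" and f: "f analytic_on (path_image \<gamma>)"
  shows "contour_integral (f \<circ> \<gamma>) h = contour_integral \<gamma> (\<lambda>w. deriv f w * h (f w))"
proof -
  obtain K where K: "finite K" "\<gamma> C1_differentiable_on {0..1} - K"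
    using \<gamma> unfolding valid_path_def piecewise_C1_differentiable_on_def by blast
  show ?thesis unfolding contour_integral_integral
  proof (rule integral_spike)
    show "negligible K" using K by (simp add: negligible_finite)
    fix x assume x: "x \<in> {0..1} - K"
    have "\<gamma> differentiable at x" using K x by (meson C1_differentiable_on_eq)
    moreover have "f field_differentiable at (\<gamma> x)"
      using f x by (intro analytic_on_imp_differentiable_at) (auto simp: path_image_def)
    ultimately show "deriv f (\<gamma> x) * h (f (\<gamma> x)) * vector_derivative \<gamma> (at x) = h ((f \<circ> \<gamma>) x) * vector_derivative (f \<circ> \<gamma>) (at x)"
      by (simp add: vector_derivative_chain_at_general)
  qed
qed

text \<open>A continuous logarithm \<open>q\<close> of \<open>f\<close> along the path changes by 2
  pi i times the winding number of the image path about 0, which is the integral of the logarithmic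
  derivative. The positive start value makes \<open>Im (q 0)\<close> a multiple of 2 pi, so
  subtracting it leaves a valid argument that starts at 0.\<close>

lemma arg_variation_eq_contour_integral:
  assumes \<gamma>: "valid_path \<gamma>" and f: "f analytic_on (path_image \<gamma>)"
    and nz: "\<And>z. z \<in> path_image \<gamma> \<Longrightarrow> f z \<noteq> 0" and start: "f (\<gamma> 0) = of_real r" "r > 0"
  shows "arg_variation \<gamma> f = Im (contour_integral \<gamma> (\<lambda>z. deriv f z / f z))"
proof -
  obtain A where A: "open A" "path_image \<gamma> \<subseteq> A" "f holomorphic_on A" using f by (auto simp: analytic_on_holomorphic)
  have p: "valid_path (f \<circ> \<gamma>)"
  proof (rule valid_path_compose[OF \<gamma>])
    show "f field_differentiable at x" if "x \<in> path_image \<gamma>" for x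
      using that f by (rule analytic_on_imp_differentiable_at[rotated])
    have "deriv f holomorphic_on A" using A by (intro holomorphic_deriv)
    then show "continuous_on (path_image \<gamma>) (deriv f)"
      using A by (meson continuous_on_subset holomorphic_on_imp_continuous_on)
  qed
  have 0: "0 \<notin> path_image (f \<circ> \<gamma>)" using nz by (auto simp: path_image_compose)
  obtain q where q: "path q" "pathfinish q - pathstart q = 2 * of_real pi * \<i> * winding_number (f \<circ> \<gamma>) 0"
      "\<And>t. t \<in> {0..1} \<Longrightarrow> (f \<circ> \<gamma>) t = 0 + exp (q t)"
    using winding_number_as_continuous_log[OF valid_path_imp_path[OF p] 0] by metis
  have "2 * of_real pi * \<i> * winding_number (f \<circ> \<gamma>) 0 = contour_integral (f \<circ> \<gamma>) (\<lambda>w. 1 / (w - 0))"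
    by (subst winding_number_valid_path[OF p 0]) simp
  also have "\<dots> = contour_integral \<gamma> (\<lambda>w. deriv f w * (1 / (f w - 0)))"
    by (rule contour_integral_compose[OF \<gamma> f])
  finally have q': "q 1 - q 0 = contour_integral \<gamma> (\<lambda>z. deriv f z / f z)"
    using q(2) by (simp add: pathfinish_def pathstart_def)
  define \<theta> where "\<theta> = (\<lambda>t. Im (q t) - Im (q 0))"
  have c0: "cis (Im (q 0)) = 1"
  proof -
    have "of_real r = of_real (exp (Re (q 0))) * cis (Im (q 0))" using q(3)[of 0] start by (simp add: exp_eq_polar)
    moreover from arg_cong[OF this, of norm] have "exp (Re (q 0)) = r" using start by (simp add: norm_mult)
    ultimately show ?thesis using start by simp
  qed
  have "arg_variation \<gamma> f = \<theta> 1"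
  proof (rule arg_variation_eqI)
    show "continuous_on {0..1} \<theta>" using q(1) unfolding \<theta>_def path_def by (intro continuous_intros)
    fix t :: real assume t: "t \<in> {0..1}"
    have ft: "f (\<gamma> t) = exp (q t)" using q(3)[OF t] by simp
    show "f (\<gamma> t) \<noteq> 0" unfolding ft by simp
    have "exp (\<i> * of_real (\<theta> t)) = cis (Im (q t)) / cis (Im (q 0))"
      by (simp only: cis_conv_exp [symmetric] \<theta>_def cis_divide)
    then show "f (\<gamma> t) = of_real (norm (f (\<gamma> t))) * exp (\<i> * of_real (\<theta> t))"
      unfolding ft by (simp add: c0 exp_eq_polar norm_mult)
  qed (simp add: \<theta>_def)
  then show ?thesis by (simp add: \<theta>_def flip: q')
qed

text \<open>The map s to 1 - cnj s is the reflection in the critical line. The logarithmic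
  derivative of \<open>xi\<close> satisfies the hypothesis by symmetry and conjugation.\<close>

lemma contour_integral_linepath_reflect:
  assumes "\<And>s. f (1 - cnj s) = - cnj (f s)"
  shows "contour_integral (linepath (1 - cnj a) (1 - cnj b)) f = cnj (contour_integral (linepath a b) f)"
proof -
  have eq: "linepath (1 - cnj a) (1 - cnj b) x = 1 - cnj (linepath a b x)" for x
    by (simp add: linepath_def algebra_simps scaleR_conv_of_real)
  then show ?thesis
    unfolding contour_integral_integral integral_cnj
    by (intro integral_cong) (simp only: vector_derivative_linepath_at eq assms, simp add: algebra_simps)
qed

lemma contour_integral_linepath_cnj:
  assumes "\<And>s. f (cnj s) = cnj (f s)"
  shows "contour_integral (linepath (cnj a) (cnj b)) f = cnj (contour_integral (linepath a b) f)"
proof -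
  have eq: "linepath (cnj a) (cnj b) x = cnj (linepath a b x)" for x
    by (simp add: linepath_def algebra_simps scaleR_conv_of_real)
  then show ?thesis
    unfolding contour_integral_integral integral_cnj
    by (intro integral_cong) (simp only: vector_derivative_linepath_at eq assms, simp add: algebra_simps)
qed

lemma xi_differentiable: "xi field_differentiable at z"
  using xi_holomorphic[of UNIV] by (simp add: holomorphic_on_def)

lemma deriv_xi: "(xi has_field_derivative deriv xi z) (at z)"
  using xi_differentiable by (simp add: field_differentiable_derivI)

lemma deriv_xi_symmetric: "deriv xi (1 - z) = - deriv xi z"
proof -
  have "((\<lambda>s. xi (1 - s)) has_field_derivative deriv xi (1 - z) * (- 1)) (at z)"
    by (rule DERIV_chain2[OF deriv_xi]) (auto intro!: derivative_eq_intros)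
  then have "(xi has_field_derivative - deriv xi (1 - z)) (at z)" by (simp add: xi_symmetric)
  from DERIV_unique[OF this deriv_xi] show ?thesis by (metis minus_minus)
qed

lemma deriv_xi_cnj: "deriv xi (cnj z) = cnj (deriv xi z)"
proof -
  have "(cnj \<circ> xi \<circ> cnj has_field_derivative cnj (deriv xi (cnj z))) (at z)"
    by (rule has_field_derivative_cnj_cnj[OF deriv_xi])
  moreover have "cnj \<circ> xi \<circ> cnj = xi" by (auto simp: xi_cnj)
  ultimately have "(xi has_field_derivative cnj (deriv xi (cnj z))) (at z)" by simp
  from DERIV_unique[OF this deriv_xi] show ?thesis by (metis complex_cnj_cnj)
qed

lemma finite_xi_zeros:
  assumes "bounded B"
  shows "finite {s \<in> B. xi s = 0}"
proof (cases "xi constant_on UNIV")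
  case True
  then have "xi s \<noteq> 0" for s using xi_1 unfolding constant_on_def by (metis UNIV_I)
  then show ?thesis by simp
next
  case False
  have "finite {s \<in> closure B. xi s = 0}"
    by (rule holomorphic_compact_finite_zeros[OF xi_holomorphic[of UNIV]])
       (use False assms in \<open>auto simp: compact_closure\<close>)
  then show ?thesis by (rule finite_subset[rotated]) (use closure_subset in auto)
qed

lemma is_ordinate_iff: "is_ordinate T \<longleftrightarrow> (\<exists>s. xi s = 0 \<and> Im s = T)"
  by (auto simp: is_ordinate_def nontrivial_zeros_eq)

text \<open>The left half of the boundary is the mirror image of the right half traversed backwards,
  so it contributes minus the conjugate: real parts cancel and imaginary parts double. The integral
  along the real axis is real.\<close>

lemma N0_eq_contour_integral:
  assumes T: "T > 0" "\<not> is_ordinate T"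
  defines "G \<equiv> \<lambda>z. deriv xi z / xi z"
  shows "Im (contour_integral (S_path T) G) = pi * N0 T"
    and "\<And>z. z \<in> path_image (S_path T) \<Longrightarrow> xi z \<noteq> 0"
proof -
  have nzT: "xi s \<noteq> 0" if "Im s = T" for s using T that by (auto simp: is_ordinate_iff)
  have nz2: "xi s \<noteq> 0" if "Re s = 2 \<or> Re s = -1 \<or> Im s = 0" for s
    using that xi_zero_Re[of s] xi_zero_Im[of s] by auto
  define a3 m a4 where "a3 = Complex 2 T" and "m = Complex (1/2) T" and "a4 = Complex (-1) T"
  have G_cont: "continuous_on A G" if "\<And>s. s \<in> A \<Longrightarrow> xi s \<noteq> 0" for A
    unfolding G_def
    by (intro continuous_intros holomorphic_on_imp_continuous_on holomorphic_deriv[of _ UNIV, THEN holomorphic_on_subset] xi_holomorphic)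
       (use that in auto)
  have seg1: "xi s \<noteq> 0" if "s \<in> closed_segment (-1) 2" for s
    by (rule nz2) (use that closed_segment_same_Im[of "-1" 2] in auto)
  have seg2: "xi s \<noteq> 0" if "s \<in> closed_segment 2 a3" for s
    by (rule nz2) (use that closed_segment_same_Re[of 2 a3] in \<open>auto simp: a3_def\<close>)
  have seg3: "xi s \<noteq> 0" if "s \<in> closed_segment a3 a4" for s
    by (rule nzT) (use that closed_segment_same_Im[of a3 a4] in \<open>auto simp: a3_def a4_def\<close>)
  have seg3a: "xi s \<noteq> 0" if "s \<in> closed_segment a3 m" for s
    by (rule nzT) (use that closed_segment_same_Im[of a3 m] in \<open>auto simp: a3_def m_def\<close>)
  have seg4: "xi s \<noteq> 0" if "s \<in> closed_segment a4 (-1)" for s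
    by (rule nz2) (use that closed_segment_same_Re[of a4 "-1"] in \<open>auto simp: a4_def\<close>)
  show "xi z \<noteq> 0" if "z \<in> path_image (S_path T)" for z
    using that seg2 seg3a unfolding S_path_def a3_def m_def by (auto simp: path_image_join)
  let ?I = "\<lambda>a b. contour_integral (linepath a b) G"
  have J: "contour_integral (S_path T) G = ?I 2 a3 + ?I a3 m"
    unfolding S_path_def a3_def [symmetric] m_def [symmetric]
    by (intro contour_integral_join contour_integrable_continuous_linepath G_cont seg2 seg3a) auto
  have Gr: "G (1 - cnj s) = - cnj (G s)" for s
    unfolding G_def by (simp add: deriv_xi_symmetric deriv_xi_cnj xi_symmetric xi_cnj)
  have Gc: "G (cnj s) = cnj (G s)" for s
    unfolding G_def by (simp add: deriv_xi_cnj xi_cnj)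
  have rp: "rectpath (-1) a3 = linepath (-1) 2 +++ linepath 2 a3 +++ linepath a3 a4 +++ linepath a4 (-1)"
    by (simp add: rectpath_def Let_def a3_def a4_def complex_eq_iff) (simp add: Complex_eq)
  have I: "contour_integral (rectpath (-1) a3) G = ?I (-1) 2 + (?I 2 a3 + (?I a3 a4 + ?I a4 (-1)))"
    unfolding rp using seg1 seg2 seg3 seg4
    by (subst contour_integral_join contour_integrable_joinI;
        (intro contour_integrable_joinI contour_integrable_continuous_linepath G_cont)?; simp)+
  have m_seg: "m \<in> closed_segment a3 a4"
    by (auto simp: closed_segment_same_Im a3_def a4_def m_def closed_segment_eq_real_ivl)
  have I34: "?I a3 a4 = ?I a3 m + ?I m a4"
    by (rule contour_integral_split_linepath[OF G_cont m_seg]) (rule seg3)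
  have "?I a4 m = cnj (?I a3 m)"
    using contour_integral_linepath_reflect[where f = G, OF Gr, of a3 m] by (simp add: a3_def a4_def m_def complex_eq_iff Complex_eq)
  moreover have "?I m a4 = - ?I a4 m"
    by (rule contour_integral_reverse_linepath, rule G_cont, rule nzT)
       (use closed_segment_same_Im[of m a4] in \<open>auto simp: m_def a4_def\<close>)
  ultimately have Im4: "?I m a4 = - cnj (?I a3 m)" by simp
  have "?I (-1) a4 = cnj (?I 2 a3)"
    using contour_integral_linepath_reflect[where f = G, OF Gr, of 2 a3] by (simp add: a3_def a4_def complex_eq_iff Complex_eq)
  moreover have "?I a4 (-1) = - ?I (-1) a4"
    by (rule contour_integral_reverse_linepath) (use seg4 in \<open>auto intro!: G_cont\<close>)
  ultimately have I4: "?I a4 (-1) = - cnj (?I 2 a3)" by simp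
  have "Im (?I (-1) 2) = 0"
    using contour_integral_linepath_cnj[where f = G, OF Gc, of "-1" 2] by (simp add: complex_eq_iff)
  then have ImI: "Im (contour_integral (rectpath (-1) a3) G) = 2 * Im (contour_integral (S_path T) G)"
    unfolding I I34 Im4 I4 J by simp
  \<comment> \<open>An open box around the closed rectangle serves as the domain of the argument
    principle; zeros of \<open>xi\<close> in it but outside the rectangle get winding number
    0.\<close>
  define B where "B = box (Complex (-2) (-1)) (Complex 3 (T + 1))"
  define pz where "pz = {w \<in> B. xi w = 0 \<or> w \<in> {}}"
  have "finite pz" unfolding pz_def using finite_xi_zeros[of B] by (simp add: B_def)
  have pi: "path_image (rectpath (-1) a3) = cbox (-1) a3 - box (-1) a3"
    by (rule path_image_rectpath_cbox_minus_box) (use T in \<open>auto simp: a3_def\<close>)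
  have pnz: "xi z \<noteq> 0" if "z \<in> path_image (rectpath (-1) a3)" for z
    using that seg1 seg2 seg3 seg4 unfolding rp by (auto simp: path_image_join)
  have ap: "contour_integral (rectpath (-1) a3) (\<lambda>x. deriv xi x * 1 / xi x) = 2 * pi * \<i> * (\<Sum>p\<in>pz. winding_number (rectpath (-1) a3) p * 1 * zorder xi p)"
    unfolding pz_def
  proof (rule argument_principle)
    show "open B" "connected B" unfolding B_def by (auto intro: convex_connected)
    show "path_image (rectpath (-1) a3) \<subseteq> B - {w \<in> B. xi w = 0 \<or> w \<in> {}}"
    proof
      fix z assume z: "z \<in> path_image (rectpath (-1) a3)"
      then have "z \<in> B" using pi T by (auto simp: B_def in_box_complex_iff in_cbox_complex_iff a3_def)
      then show "z \<in> B - {w \<in> B. xi w = 0 \<or> w \<in> {}}" using pnz[OF z] by auto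
    qed
    show "\<forall>z. z \<notin> B \<longrightarrow> winding_number (rectpath (-1) a3) z = 0"
      using T by (auto intro!: winding_number_rectpath_outside simp: B_def in_box_complex_iff in_cbox_complex_iff a3_def)
    show "finite {w \<in> B. xi w = 0 \<or> w \<in> {}}" using \<open>finite pz\<close> unfolding pz_def .
  qed (auto intro!: xi_holomorphic)
  define Z where "Z = {\<rho>\<in>nontrivial_zeros. 0 < Im \<rho> \<and> Im \<rho> \<le> T}"
  have Zpz: "Z \<subseteq> pz"
    using xi_zero_Re by (force simp: Z_def pz_def B_def nontrivial_zeros_eq in_box_complex_iff)
  have "(\<Sum>p\<in>pz. winding_number (rectpath (-1) a3) p * 1 * zorder xi p) = (\<Sum>p\<in>Z. of_real (mult_zero p))"
  proof (rule sum.mono_neutral_cong_right[OF \<open>finite pz\<close> Zpz])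
    show "\<forall>i\<in>pz - Z. winding_number (rectpath (-1) a3) i * 1 * zorder xi i = 0"
    proof
      fix i assume i: "i \<in> pz - Z"
      then have "xi i = 0" by (auto simp: pz_def)
      then have "i \<notin> cbox (-1) a3" using i xi_zero_Im[of i]
        by (auto simp: Z_def nontrivial_zeros_eq in_cbox_complex_iff a3_def)
      then have "winding_number (rectpath (-1) a3) i = 0"
        using T by (intro winding_number_rectpath_outside) (auto simp: a3_def)
      then show "winding_number (rectpath (-1) a3) i * 1 * zorder xi i = 0" by simp
    qed
    fix p assume p: "p \<in> Z"
    then have x: "xi p = 0" by (auto simp: Z_def nontrivial_zeros_eq)
    have "p \<in> box (-1) a3"
      using p xi_zero_Re[OF x] nzT[of p] x by (force simp: Z_def in_box_complex_iff a3_def)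
    then have "winding_number (rectpath (-1) a3) p = 1" by (rule winding_number_rectpath)
    then show "winding_number (rectpath (-1) a3) p * 1 * zorder xi p = of_real (mult_zero p)"
      by (simp add: mult_zero_eq[OF x])
  qed
  then have "contour_integral (rectpath (-1) a3) G = 2 * pi * \<i> * of_real (N0 T)"
    using ap unfolding G_def by (simp add: N0_def Z_def)
  then show "Im (contour_integral (S_path T) G) = pi * N0 T" using ImI by simp
qed

text \<open>On \<open>U\<close>, the right half-plane cut along (0, 1], xi is zeta times
  exp(\<open>H\<close>)/2 with a single-valued \<open>H\<close>, so that factor contributes only an
  endpoint difference. \<open>Im (H 2)\<close> vanishes; at 1/2 + iT the points s and s - 1 are
  mirror images in the imaginary axis, so their arguments add up to pi, the source of the 1 in the
  formula.\<close>

lemma N0_eq: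
  assumes T: "T > 0" "\<not> is_ordinate T"
  shows "N0 T = rs_theta T / pi + 1 + S0 T"
proof -
  define U where "U = {s. Re s > 0} \<inter> {s. s - 1 \<notin> \<real>\<^sub>\<le>\<^sub>0}"
  have U: "open U"
  proof -
    have "{s::complex. s - 1 \<notin> \<real>\<^sub>\<le>\<^sub>0} = (\<lambda>s. s - 1) -` (- \<real>\<^sub>\<le>\<^sub>0)" by auto
    moreover have "open ((\<lambda>s::complex. s - 1) -` (- \<real>\<^sub>\<le>\<^sub>0))"
      by (intro open_vimage continuous_intros) (auto simp: closed_nonpos_Reals_complex open_Compl)
    ultimately show ?thesis unfolding U_def by (simp add: open_Int open_halfspace_Re_gt)
  qed
  have U0: "Re s > 0" "s - 1 \<notin> \<real>\<^sub>\<le>\<^sub>0" "s \<noteq> 1" "s \<noteq> 0" "s \<notin> \<real>\<^sub>\<le>\<^sub>0" "s / 2 \<notin> \<real>\<^sub>\<le>\<^sub>0" if "s \<in> U" for s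
    using that by (auto simp: U_def complex_nonpos_Reals_iff)
  define H where "H = (\<lambda>s. Ln s + Ln (s - 1) + ln_Gamma (s / 2) - s / 2 * of_real (ln pi))"
  have H_hol: "H holomorphic_on U"
  proof -
    have "(\<lambda>s. ln_Gamma (s / 2)) holomorphic_on U"
      by (rule holomorphic_on_compose_gen[of "\<lambda>s. s / 2" U ln_Gamma "- \<real>\<^sub>\<le>\<^sub>0", unfolded o_def])
         (auto intro!: holomorphic_intros dest: U0)
    then show ?thesis unfolding H_def by (intro holomorphic_intros) (auto dest: U0)
  qed
  have zeta_hol: "zeta holomorphic_on - {1}"
    unfolding zeta_eq_xi by (intro holomorphic_intros xi_holomorphic) auto
  have xi_eq: "xi s = exp (H s) / 2 * zeta s" if s: "s \<in> U" for s
  proof -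
    note u = U0[OF s]
    have ni: "s / 2 \<notin> \<int>\<^sub>\<le>\<^sub>0" using u(6) nonpos_Ints_subset_nonpos_Reals by blast
    have "exp (H s) = s * (s - 1) * Gamma (s / 2) * exp (- (s / 2 * of_real (ln pi)))"
    proof -
      have "H s = Ln s + Ln (s - 1) + ln_Gamma (s / 2) + (- (s / 2 * of_real (ln pi)))" by (simp add: H_def)
      then have "exp (H s) = exp (Ln s) * exp (Ln (s - 1)) * exp (ln_Gamma (s / 2)) * exp (- (s / 2 * of_real (ln pi)))"
        by (simp only: exp_add)
      moreover have "exp (ln_Gamma (s / 2)) = Gamma (s / 2)" using ni by (simp add: Gamma_complex_altdef)
      moreover have "exp (Ln s) = s" "exp (Ln (s - 1)) = s - 1" using u by simp_all
      ultimately show ?thesis by (simp only:)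
    qed
    moreover have "exp (- (s / 2 * of_real (ln pi))) = inverse (of_real pi powr (s / 2))"
      by (simp add: powr_def Ln_of_real exp_minus)
    moreover have "Gamma (s / 2 + 1) = s / 2 * Gamma (s / 2)" using Gamma_plus1[OF ni] .
    ultimately have e: "exp (H s) / 2 = (s - 1) * Gamma (s / 2 + 1) * inverse (of_real pi powr (s / 2))"
      by simp
    have "rGamma (s / 2 + 1) = inverse (Gamma (s / 2 + 1))" by (rule rGamma_inverse_Gamma)
    moreover have "Gamma (s / 2 + 1) \<noteq> 0"
      using half_plus_one_not_nonpos_Int[of s] u by (simp add: Gamma_eq_zero_iff)
    ultimately show ?thesis unfolding e zeta_eq_xi using u by (simp add: field_simps)
  qed
  define \<gamma> where "\<gamma> = S_path T"
  have vp: "valid_path \<gamma>" unfolding \<gamma>_def S_path_def by (intro valid_path_join) auto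
  have pU: "path_image \<gamma> \<subseteq> U"
  proof -
    have "closed_segment 2 (Complex 2 T) \<subseteq> U"
      using closed_segment_same_Re[of 2 "Complex 2 T"] by (auto simp: U_def complex_nonpos_Reals_iff)
    moreover have "closed_segment (Complex 2 T) (Complex (1/2) T) \<subseteq> U"
      using closed_segment_same_Im[of "Complex 2 T" "Complex (1/2) T"] T
      by (auto simp: U_def complex_nonpos_Reals_iff closed_segment_eq_real_ivl)
    ultimately show ?thesis unfolding \<gamma>_def S_path_def by (auto simp: path_image_join)
  qed
  have xnz: "xi z \<noteq> 0" if "z \<in> path_image \<gamma>" for z
    using N0_eq_contour_integral(2)[OF T] that unfolding \<gamma>_def .
  have znz: "zeta z \<noteq> 0" if "z \<in> path_image \<gamma>" for z
    using xi_eq[of z] xnz[OF that] pU that by auto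
  have an: "zeta analytic_on path_image \<gamma>"
  proof -
    have "zeta analytic_on - {1}" using zeta_hol by (subst analytic_on_open) auto
    then show ?thesis by (rule analytic_on_subset) (use pU U0(3) in auto)
  qed
  have zeta2: "zeta (\<gamma> 0) = of_real (pi\<^sup>2 / 6)" "pi\<^sup>2 / 6 > 0"
    by (simp_all add: \<gamma>_def S_path_def joinpaths_def linepath_def zeta_2)
  have av: "arg_variation \<gamma> zeta = Im (contour_integral \<gamma> (\<lambda>z. deriv zeta z / zeta z))"
    by (rule arg_variation_eq_contour_integral[OF vp an znz zeta2])
  have dlog: "deriv xi z / xi z = deriv H z + deriv zeta z / zeta z" if z: "z \<in> path_image \<gamma>" for z
  proof -
    have zU: "z \<in> U" using pU z by auto
    have "(H has_field_derivative deriv H z) (at z)" by (rule holomorphic_derivI[OF H_hol U zU])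
    moreover have "(zeta has_field_derivative deriv zeta z) (at z)"
      by (rule holomorphic_derivI[OF zeta_hol]) (use U0[OF zU] in auto)
    ultimately have "((\<lambda>s. exp (H s) / 2 * zeta s) has_field_derivative
         exp (H z) * deriv H z / 2 * zeta z + deriv zeta z * (exp (H z) / 2)) (at z)"
      by (auto intro!: derivative_eq_intros)
    then have "(xi has_field_derivative exp (H z) * deriv H z / 2 * zeta z + deriv zeta z * (exp (H z) / 2)) (at z)"
      by (rule has_field_derivative_transform_within_open[OF _ U zU]) (simp add: xi_eq)
    from DERIV_unique[OF deriv_xi this]
    show ?thesis unfolding xi_eq[OF zU] using znz[OF z] by (simp add: field_simps)
  qed
  have dH: "(deriv H has_contour_integral (H (pathfinish \<gamma>) - H (pathstart \<gamma>))) \<gamma>"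
  proof (rule contour_integral_primitive[OF _ vp pU])
    fix x assume x: "x \<in> U"
    show "(H has_field_derivative deriv H x) (at x within U)"
      using holomorphic_derivI[OF H_hol U x] by (rule has_field_derivative_at_within)
  qed
  have "(\<lambda>z. deriv zeta z / zeta z) contour_integrable_on \<gamma>"
  proof -
    have "continuous_on (path_image \<gamma>) (\<lambda>z. deriv zeta z / zeta z)"
    proof (intro continuous_on_divide)
      have "deriv zeta holomorphic_on - {1}" by (rule holomorphic_deriv[OF zeta_hol]) auto
      then show "continuous_on (path_image \<gamma>) (deriv zeta)"
        by (rule continuous_on_subset[OF holomorphic_on_imp_continuous_on]) (use pU U0(3) in auto)
      show "continuous_on (path_image \<gamma>) zeta"
        by (rule continuous_on_subset[OF holomorphic_on_imp_continuous_on[OF zeta_hol]]) (use pU U0(3) in auto)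
    qed (use znz in auto)
    then have c: "continuous_on (closed_segment 2 (Complex 2 T)) (\<lambda>z. deriv zeta z / zeta z)"
       "continuous_on (closed_segment (Complex 2 T) (Complex (1/2) T)) (\<lambda>z. deriv zeta z / zeta z)"
      unfolding \<gamma>_def S_path_def by (auto simp: path_image_join elim: continuous_on_subset)
    show ?thesis unfolding \<gamma>_def S_path_def
      by (intro contour_integrable_joinI contour_integrable_continuous_linepath c) auto
  qed
  then have zi: "((\<lambda>z. deriv zeta z / zeta z) has_contour_integral contour_integral \<gamma> (\<lambda>z. deriv zeta z / zeta z)) \<gamma>"
    by (rule has_contour_integral_integral)
  have "((\<lambda>z. deriv xi z / xi z) has_contour_integral (H (pathfinish \<gamma>) - H (pathstart \<gamma>) + contour_integral \<gamma> (\<lambda>z. deriv zeta z / zeta z))) \<gamma>"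
    by (rule has_contour_integral_eq[OF has_contour_integral_add[OF dH zi]]) (simp add: dlog)
  then have "contour_integral \<gamma> (\<lambda>z. deriv xi z / xi z) = H (Complex (1/2) T) - H 2 + contour_integral \<gamma> (\<lambda>z. deriv zeta z / zeta z)"
    by (simp add: contour_integral_unique \<gamma>_def S_path_def)
  then have "pi * N0 T = Im (H (Complex (1/2) T)) - Im (H 2) + pi * S0 T"
    using N0_eq_contour_integral(1)[OF T] av unfolding \<gamma>_def S0_def by simp
  moreover have "Im (H 2) = 0"
    using ln_Gamma_complex_of_real[of 1] Ln_of_real[of 2] by (simp add: H_def)
  moreover have "Im (H (Complex (1/2) T)) = pi + rs_theta T"
  proof -
    have "Im (Ln (Complex (1/2) T)) + Im (Ln (Complex (1/2) T - 1)) = pi"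
    proof -
      have "Complex (1/2) T - 1 = Complex (-1/2) T" by (simp add: complex_eq_iff)
      moreover have "Im (Ln (Complex (-1/2) T)) = pi / 2 - arctan ((-1/2) / T)"
      proof -
        have e: "arctan (1 / (T * 2)) = pi / 2 - arctan (T * 2)"
          unfolding inverse_eq_divide [symmetric] by (rule arctan_inverse) (use T in simp)
        have "Im (Ln (Complex (-1/2) T)) = pi - arctan (T * 2)"
          using T by (subst Im_Ln_eq) (auto simp: complex_eq_iff arctan_minus mult.commute)
        moreover have "(- 1 / 2) / T = - (1 / (T * 2))" by simp
        ultimately show ?thesis using e by (simp only: arctan_minus)
      qed
      moreover have "Im (Ln (Complex (1/2) T)) = pi / 2 - arctan ((1/2) / T)"
        using T by (intro Im_Ln_Complex) auto
      ultimately show ?thesis using arctan_minus[of "(1/2) / T"] by simp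
    qed
    moreover have "Complex (1/2) T / 2 = Complex (1/4) (T/2)" by (simp add: complex_eq_iff)
    ultimately show ?thesis unfolding H_def rs_theta_def by simp
  qed
  ultimately have "pi * N0 T = pi * (rs_theta T / pi + 1 + S0 T)" by (simp add: algebra_simps)
  then show ?thesis by simp
qed

section \<open>Jumps of the counting function and the averaged values at ordinates\<close>

definition zeros_upto :: "real \<Rightarrow> complex set" where
  "zeros_upto T = {\<rho>\<in>nontrivial_zeros. 0 < Im \<rho> \<and> Im \<rho> \<le> T}"

lemma finite_zeros_upto: "finite (zeros_upto T)"
proof -
  have "bounded (cbox (Complex (-1) 0) (Complex 2 T))" by (rule bounded_cbox)
  from finite_xi_zeros[OF this] show ?thesis
    by (rule finite_subset[rotated]) (use xi_zero_Re in \<open>force simp: zeros_upto_def nontrivial_zeros_eq in_cbox_complex_iff\<close>)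
qed

lemma mult_zero_nonneg:
  assumes "\<rho> \<in> nontrivial_zeros"
  shows "mult_zero \<rho> \<ge> 0"
proof -
  have x: "xi \<rho> = 0" using assms by (simp add: nontrivial_zeros_eq)
  have "zorder xi \<rho> \<ge> 0"
    by (rule zorder_ge_0[OF xi_analytic]) (simp add: eventually_frequently eventually_xi_nonzero)
  then show ?thesis by (simp add: mult_zero_eq[OF x])
qed

lemma N0_eq_sum: "N0 T = (\<Sum>\<rho>\<in>zeros_upto T. mult_zero \<rho>)"
  by (simp add: N0_def zeros_upto_def)

lemma N0_mono: "s \<le> t \<Longrightarrow> N0 s \<le> N0 t"
  unfolding N0_eq_sum by (intro sum_mono2 finite_zeros_upto mult_zero_nonneg) (auto simp: zeros_upto_def)

lemma finite_ordinates: "finite {t. 0 < t \<and> t \<le> T \<and> is_ordinate t}"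
proof -
  have "{t. 0 < t \<and> t \<le> T \<and> is_ordinate t} \<subseteq> Im ` zeros_upto T"
    by (auto simp: is_ordinate_def zeros_upto_def)
  then show ?thesis by (rule finite_subset) (simp add: finite_zeros_upto)
qed

lemma eventually_not_ordinate:
  assumes "T > 0"
  shows "eventually (\<lambda>t. t > 0 \<and> \<not> is_ordinate t) (at T)"
proof -
  have "finite ({t. 0 < t \<and> t \<le> T + 1 \<and> is_ordinate t} - {T})" using finite_ordinates by simp
  then have "closed ({t. 0 < t \<and> t \<le> T + 1 \<and> is_ordinate t} - {T})" by (rule finite_imp_closed)
  then have "open ({0<..<T+1} - ({t. 0 < t \<and> t \<le> T + 1 \<and> is_ordinate t} - {T}))" by (intro open_Diff) auto
  moreover have "T \<in> {0<..<T+1} - ({t. 0 < t \<and> t \<le> T + 1 \<and> is_ordinate t} - {T})" using assms by auto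
  ultimately show ?thesis unfolding eventually_at_topological
    by (intro exI[of _ "{0<..<T+1} - ({t. 0 < t \<and> t \<le> T + 1 \<and> is_ordinate t} - {T})"]) auto
qed

lemma N0_at_right:
  assumes "T > 0"
  shows "eventually (\<lambda>t. N0 t = N0 T) (at_right T)"
proof -
  have "eventually (\<lambda>t. t > 0 \<and> \<not> is_ordinate t) (at T)" by (rule eventually_not_ordinate[OF assms])
  then obtain e where e: "e > 0" "\<And>t. t \<noteq> T \<Longrightarrow> dist t T < e \<Longrightarrow> \<not> is_ordinate t"
    unfolding eventually_at by blast
  have "N0 t = N0 T" if "T < t" "t < T + e" for t
  proof -
    have "zeros_upto t = zeros_upto T"
    proof
      show "zeros_upto t \<subseteq> zeros_upto T"
      proof
        fix \<rho> assume \<rho>: "\<rho> \<in> zeros_upto t"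
        then have "is_ordinate (Im \<rho>)" by (auto simp: zeros_upto_def is_ordinate_def)
        then have "\<not> (T < Im \<rho>)" using e(2)[of "Im \<rho>"] \<rho> that by (auto simp: zeros_upto_def dist_real_def)
        then show "\<rho> \<in> zeros_upto T" using \<rho> by (auto simp: zeros_upto_def)
      qed
    qed (use that in \<open>auto simp: zeros_upto_def\<close>)
    then show ?thesis by (simp add: N0_eq_sum)
  qed
  then show ?thesis using e(1) unfolding eventually_at_right_field by (intro exI[of _ "T + e"]) auto
qed

definition zeros_at :: "real \<Rightarrow> complex set" where
  "zeros_at T = {\<rho>\<in>nontrivial_zeros. Im \<rho> = T}"

lemma N0_at_left:
  assumes "T > 0"
  shows "eventually (\<lambda>t. N0 t = N0 T - (\<Sum>\<rho>\<in>zeros_at T. mult_zero \<rho>)) (at_left T)"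
proof -
  have "eventually (\<lambda>t. t > 0 \<and> \<not> is_ordinate t) (at T)" by (rule eventually_not_ordinate[OF assms])
  then obtain e where e: "e > 0" "\<And>t. t \<noteq> T \<Longrightarrow> dist t T < e \<Longrightarrow> \<not> is_ordinate t"
    unfolding eventually_at by blast
  have "N0 t = N0 T - (\<Sum>\<rho>\<in>zeros_at T. mult_zero \<rho>)" if "T - e < t" "t < T" for t
  proof -
    have "zeros_upto T = zeros_upto t \<union> zeros_at T"
    proof
      show "zeros_upto T \<subseteq> zeros_upto t \<union> zeros_at T"
      proof
        fix \<rho> assume \<rho>: "\<rho> \<in> zeros_upto T"
        then have "is_ordinate (Im \<rho>)" by (auto simp: zeros_upto_def is_ordinate_def)
        then have "\<not> (t < Im \<rho> \<and> Im \<rho> < T)" using e(2)[of "Im \<rho>"] \<rho> that by (auto simp: zeros_upto_def dist_real_def)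
        then show "\<rho> \<in> zeros_upto t \<union> zeros_at T" using \<rho> by (auto simp: zeros_upto_def zeros_at_def)
      qed
    qed (use that assms in \<open>auto simp: zeros_upto_def zeros_at_def\<close>)
    moreover have "finite (zeros_at T)"
      by (rule finite_subset[OF _ finite_zeros_upto[of T]]) (use assms in \<open>auto simp: zeros_upto_def zeros_at_def\<close>)
    moreover have "zeros_upto t \<inter> zeros_at T = {}" using that by (auto simp: zeros_upto_def zeros_at_def)
    ultimately show ?thesis unfolding N0_eq_sum by (simp add: sum.union_disjoint finite_zeros_upto)
  qed
  then show ?thesis using e(1) unfolding eventually_at_left_field by (intro exI[of _ "T - e"]) auto
qed

text \<open>Averaging the one-sided limits gives the zeros at height \<open>T\<close> weight 1/2,
  the convention of \<open>zero_sum_weight\<close>.\<close>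

lemma N_eq:
  assumes "T > 0"
  shows "N T = N0 T - (\<Sum>\<rho>\<in>zeros_at T. mult_zero \<rho>) / 2"
proof (cases "is_ordinate T")
  case True
  have "Lim (at_left T) N0 = N0 T - (\<Sum>\<rho>\<in>zeros_at T. mult_zero \<rho>)"
    by (intro tendsto_Lim tendsto_eventually N0_at_left assms) simp
  moreover have "Lim (at_right T) N0 = N0 T"
    by (intro tendsto_Lim tendsto_eventually N0_at_right assms) simp
  ultimately show ?thesis using True by (simp add: N_def field_simps)
next
  case False
  then have "zeros_at T = {}" by (auto simp: zeros_at_def is_ordinate_def)
  then show ?thesis using False by (simp add: N_def)
qed

text \<open>At an ordinate the one-sided limits of \<open>S0\<close> are read off from those of
  \<open>N0\<close>: the formula holds at all other nearby heights and \<open>rs_theta\<close> is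
  continuous.\<close>

lemma N_eq_S:
  assumes "T > 0"
  shows "N T = rs_theta T / pi + 1 + S T"
proof (cases "is_ordinate T")
  case True
  define h where "h = (\<lambda>t. rs_theta t / pi + 1)"
  have "continuous_on UNIV h" unfolding h_def by (intro continuous_intros continuous_on_rs_theta) auto
  then have h: "(h \<longlongrightarrow> h T) (at T)" by (simp add: continuous_on_def)
  have ev: "eventually (\<lambda>t. S0 t = N0 t - h t) (at T)"
    using eventually_not_ordinate[OF assms] by eventually_elim (simp add: N0_eq h_def)
  define l r where "l = N0 T - (\<Sum>\<rho>\<in>zeros_at T. mult_zero \<rho>)" and "r = N0 T"
  have N0l: "(N0 \<longlongrightarrow> l) (at_left T)" unfolding l_def by (intro tendsto_eventually N0_at_left assms)
  have N0r: "(N0 \<longlongrightarrow> r) (at_right T)" unfolding r_def by (intro tendsto_eventually N0_at_right assms)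
  have S0: "(S0 \<longlongrightarrow> c - h T) (at T within A)" if "(N0 \<longlongrightarrow> c) (at T within A)" for c A
  proof (rule Lim_transform_eventually[OF tendsto_diff[OF that tendsto_within_subset[OF h]]])
    show "\<forall>\<^sub>F x in at T within A. N0 x - h x = S0 x"
      by (rule filter_leD[OF at_le[OF subset_UNIV]]) (use ev in \<open>auto elim: eventually_mono\<close>)
  qed simp
  have 1: "Lim (at_left T) S0 = l - h T" by (intro tendsto_Lim S0 N0l) auto
  have 2: "Lim (at_right T) S0 = r - h T" by (intro tendsto_Lim S0 N0r) auto
  have "S T = (l + r) / 2 - h T" using True by (simp add: S_def 1 2 field_simps)
  moreover have "N T = (l + r) / 2" using N_eq[OF assms] by (simp add: l_def r_def field_simps)
  ultimately show ?thesis by (simp add: h_def)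
next
  case False
  then show ?thesis using N0_eq[OF assms] by (simp add: N_def S_def)
qed

section \<open>Bounds from the integral of S\<close>

context
  fixes f :: "real \<Rightarrow> real" and a :: real
  assumes int: "\<And>k::nat. f integrable_on {a..a + real k}"
begin

private definition trunc :: "nat \<Rightarrow> real \<Rightarrow> real" where
  "trunc k x = (if x \<in> {a..a + real k} then f x else 0)"

private lemma trunc_integral: "(trunc k has_integral integral {a..a + real k} f) {a..}"
  unfolding trunc_def [abs_def] by (rule has_integral_on_superset[of _ _ "{a..a + real k}"])
    (auto intro: has_integral_eq[OF _ integrable_integral[OF int]])

private lemma trunc_integrable: "trunc k integrable_on {a..}"
  using trunc_integral by (auto simp: integrable_on_def)

private lemma trunc_tendsto: "x \<ge> a \<Longrightarrow> (\<lambda>k. trunc k x) \<longlonglongrightarrow> f x"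
proof (rule tendsto_eventually)
  assume x: "x \<ge> a"
  obtain m :: nat where "x - a \<le> real m" using real_arch_simple by blast
  then show "\<forall>\<^sub>F k in sequentially. trunc k x = f x"
    using x by (intro eventually_sequentiallyI[of m]) (auto simp: trunc_def)
qed

lemma integrable_on_atLeast_nonneg:
  assumes nonneg: "\<And>x. x \<ge> a \<Longrightarrow> 0 \<le> f x" and bound: "\<And>k::nat. integral {a..a + real k} f \<le> C"
  shows "f integrable_on {a..}"
proof -
  have "f integrable_on {a..} \<and> (\<lambda>k. integral {a..} (trunc k)) \<longlonglongrightarrow> integral {a..} f"
  proof (rule monotone_convergence_increasing[OF trunc_integrable])
    show "trunc k x \<le> trunc (Suc k) x" if "x \<in> {a..}" for k x using that nonneg[of x] by (auto simp: trunc_def)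
    show "(\<lambda>k. trunc k x) \<longlonglongrightarrow> f x" if "x \<in> {a..}" for x using that trunc_tendsto by simp
    have "\<bar>integral {a..a + real k} f\<bar> \<le> C" for k
      using bound[of k] integral_nonneg[OF int[of k]] nonneg by auto
    then show "bounded (range (\<lambda>k. integral {a..} (trunc k)))"
      using integral_unique[OF trunc_integral] by (auto simp: bounded_iff)
  qed
  then show ?thesis by blast
qed

lemma integral_atLeast_limit:
  assumes h: "h integrable_on {a..}" and bound: "\<And>x. x \<ge> a \<Longrightarrow> \<bar>f x\<bar> \<le> h x"
  shows "f integrable_on {a..}" "(\<lambda>k. integral {a..a + real k} f) \<longlonglongrightarrow> integral {a..} f"
proof -
  have gb: "norm (trunc k x) \<le> h x" if "x \<in> {a..}" for k x
    using that bound[of x] by (auto simp: trunc_def)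
  show "f integrable_on {a..}"
    by (rule dominated_convergence(1)[OF trunc_integrable h gb]) (use trunc_tendsto in auto)
  have "(\<lambda>k. integral {a..} (trunc k)) \<longlonglongrightarrow> integral {a..} f"
    by (rule dominated_convergence(2)[OF trunc_integrable h gb]) (use trunc_tendsto in auto)
  then show "(\<lambda>k. integral {a..a + real k} f) \<longlonglongrightarrow> integral {a..} f"
    using integral_unique[OF trunc_integral] by simp
qed

end

section \<open>Regularity of S, S1 and Q away from the ordinates\<close>

lemma not_ordinate_imp_N_eq: "\<not> is_ordinate t \<Longrightarrow> N t = N0 t"
  by (simp add: N_def)

lemma integrable_N0: "N0 integrable_on {a..b}"
  by (rule integrable_on_mono_on) (auto intro!: mono_onI N0_mono)

lemma integrable_rs_theta: "rs_theta integrable_on {a..b}"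
  by (rule integrable_continuous_real[OF continuous_on_rs_theta])

text \<open>The point 0 joins the ordinates because integrals of \<open>S\<close> start there, while
  the formula for \<open>S\<close> is available for positive arguments only.\<close>

lemma finite_exceptional: "finite (insert 0 {t. 0 < t \<and> t \<le> T \<and> is_ordinate t})"
  using finite_ordinates by simp

lemma S_eq: "t > 0 \<Longrightarrow> \<not> is_ordinate t \<Longrightarrow> S t = N0 t - (rs_theta t / pi + 1)"
  using N_eq_S[of t] by (simp add: not_ordinate_imp_N_eq)

lemma integrable_S: "S integrable_on {0..t}"
proof (rule integrable_spike_finite[OF finite_exceptional[of t]])
  show "S x = N0 x - (rs_theta x / pi + 1)" if "x \<in> {0..t} - insert 0 {u. 0 < u \<and> u \<le> t \<and> is_ordinate u}" for x
    using that by (intro S_eq) auto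
  show "(\<lambda>x. N0 x - (rs_theta x / pi + 1)) integrable_on {0..t}"
    by (intro integrable_diff integrable_add integrable_N0 integrable_on_divide integrable_rs_theta integrable_const_ivl)
qed

lemma S1_diff:
  assumes "0 \<le> s" "s \<le> t"
  shows "S1 t - S1 s = integral {s..t} S"
  using Henstock_Kurzweil_Integration.integral_combine[OF assms integrable_S] by (simp add: S1_def)

lemma continuous_on_S1: "continuous_on {0..t} S1"
  unfolding S1_def by (rule indefinite_integral_continuous_1[OF integrable_S])

text \<open>Near \<open>t\<close> the counting function is constant, so \<open>S\<close> coincides
  there with the continuous function \<open>h\<close>.\<close>

lemma S1_has_derivative:
  assumes t: "t > 0" "\<not> is_ordinate t"
  shows "(S1 has_real_derivative S t) (at t)"
proof -
  define h where "h = (\<lambda>u. N0 t - (rs_theta u / pi + 1))"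
  have "continuous_on UNIV h" unfolding h_def by (intro continuous_intros continuous_on_rs_theta) auto
  then have h: "isCont h t" by (simp add: continuous_on_eq_continuous_at)
  have "zeros_at t = {}" using t by (auto simp: zeros_at_def is_ordinate_def)
  then have "\<forall>\<^sub>F u in at t. N0 u = N0 t"
    using N0_at_left[OF t(1)] N0_at_right[OF t(1)] by (simp add: eventually_at_split)
  with eventually_not_ordinate[OF t(1)] have "\<forall>\<^sub>F u in at t. S u = h u"
    by eventually_elim (simp add: S_eq h_def)
  moreover have "S t = h t" using S_eq[OF t] by (simp add: h_def)
  moreover have "(S \<longlongrightarrow> h t) (at t)"
    by (rule Lim_transform_eventually[OF h[unfolded isCont_def]])
       (use \<open>\<forall>\<^sub>F u in at t. S u = h u\<close> in eventually_elim, simp)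
  ultimately have "isCont S t" by (simp add: isCont_def)
  then have "continuous (at t within ({0..t+1} - {})) S" by (simp add: continuous_at_imp_continuous_at_within)
  then have "((\<lambda>u. integral {0..u} S) has_vector_derivative S t) (at t within ({0..t+1} - {}))"
    by (intro integral_has_vector_derivative_continuous_at integrable_S) (use t in auto)
  then have "(S1 has_vector_derivative S t) (at t within {0..t+1})"
    unfolding S1_def [abs_def] by simp
  moreover have "at t within {0..t+1} = at t" using t by (intro at_within_Icc_at) auto
  ultimately show ?thesis by (simp add: has_real_derivative_iff_has_vector_derivative)
qed

text \<open>The variant of \<open>Q\<close> without averaging at ordinates. It differs from
  \<open>Q\<close> only on a null set and contains the increasing function \<open>N0\<close>, from
  which integrability and the growth bound are derived.\<close>

definition Q0 :: "real \<Rightarrow> real" where "Q0 t = N0 t - L t"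
definition rem :: "real \<Rightarrow> real" where "rem t = rs_theta t / pi + 1 - L t"

lemma Q_eq_Q0: "\<not> is_ordinate t \<Longrightarrow> Q t = Q0 t"
  by (simp add: Q_def Q0_def not_ordinate_imp_N_eq)

lemma Q0_eq_S: "t > 0 \<Longrightarrow> \<not> is_ordinate t \<Longrightarrow> Q0 t = S t + rem t"
  using S_eq[of t] by (simp add: Q0_def rem_def)

lemma rem_bounds: "t \<ge> 2 * pi \<Longrightarrow> 0 \<le> rem t \<and> rem t \<le> 1 / (150 * t)"
  using rs_theta_approx unfolding rem_def by blast

lemma L_has_derivative:
  assumes "t > 0"
  shows "(L has_real_derivative ln (t / (2 * pi)) / (2 * pi)) (at t within A)"
  unfolding L_def [abs_def] using assms by (auto intro!: derivative_eq_intros)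

lemma continuous_on_L: "A \<subseteq> {0<..} \<Longrightarrow> continuous_on A L"
  by (rule DERIV_continuous_on[OF L_has_derivative]) auto

lemma continuous_on_rem: "A \<subseteq> {0<..} \<Longrightarrow> continuous_on A rem"
  unfolding rem_def [abs_def] by (intro continuous_intros continuous_on_rs_theta continuous_on_L) auto

lemma ln_2pi_nonneg: "t \<ge> 2 * pi \<Longrightarrow> ln (t / (2 * pi)) \<ge> 0"
  by (intro ln_ge_zero) (simp add: field_simps)

lemma two_pi_gt: "2 * pi > 6"
  using pi_approx by simp

lemma ln_ge_1: "t \<ge> 2 * pi \<Longrightarrow> ln t \<ge> 1"
proof -
  assume "t \<ge> 2 * pi"
  then have "t \<ge> 3" using two_pi_gt by simp
  then have "exp 1 \<le> t" using exp_le by linarith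
  then show ?thesis using ln_mono[of "exp 1" t] by (simp add: ln_ge_iff)
qed

lemma L_diff_bounds:
  assumes "2 * pi \<le> s" "s \<le> t" "t \<le> s + 1"
  shows "L s \<le> L t" "L t - L s \<le> ln t"
proof -
  have s: "s > 0" using assms two_pi_gt by linarith
  have "L t - L s \<le> ln t \<and> L s \<le> L t"
  proof (cases "s = t")
    case True
    then show ?thesis using ln_ge_1[of t] assms by simp
  next
    case False
    then have "s < t" using assms by simp
    from MVT2[OF this, of L "\<lambda>t. ln (t / (2 * pi)) / (2 * pi)"] L_has_derivative s
    obtain z where z: "s < z" "z < t" "L t - L s = (t - s) * (ln (z / (2 * pi)) / (2 * pi))"
      by (meson less_le_trans)
    have "ln (z / (2 * pi)) \<ge> 0" using z assms by (intro ln_2pi_nonneg) linarith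
    moreover have "z / (2 * pi) \<le> t"
    proof -
      have "z * 1 \<le> t * (2 * pi)" using z s two_pi_gt by (intro mult_mono) auto
      then show ?thesis by (simp add: field_simps)
    qed
    then have "ln (z / (2 * pi)) \<le> ln t" using z s by (intro ln_mono) auto
    moreover have "x / (2 * pi) \<le> x" if "x \<ge> 0" for x :: real
      using mult_left_mono[of 1 "2 * pi" x] two_pi_gt that by (simp add: divide_le_eq)
    ultimately have l: "0 \<le> ln (z / (2 * pi)) / (2 * pi)" "ln (z / (2 * pi)) / (2 * pi) \<le> ln t"
      by (auto intro: order_trans)
    have "(t - s) * (ln (z / (2 * pi)) / (2 * pi)) \<le> 1 * ln t"
      using assms l by (intro mult_mono) auto
    moreover have "(t - s) * (ln (z / (2 * pi)) / (2 * pi)) \<ge> 0"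
      using assms l by (intro mult_nonneg_nonneg) auto
    ultimately show ?thesis using z by simp
  qed
  then show "L s \<le> L t" "L t - L s \<le> ln t" by auto
qed

lemma integral_Q0:
  assumes "0 < s" "s \<le> t"
  shows "Q0 integrable_on {s..t}" "integral {s..t} Q0 = S1 t - S1 s + integral {s..t} rem"
proof -
  have L: "L integrable_on {s..t}" "rem integrable_on {s..t}"
    using assms by (auto intro!: integrable_continuous_real continuous_on_L continuous_on_rem)
  show "Q0 integrable_on {s..t}"
    unfolding Q0_def [abs_def] by (intro integrable_diff integrable_N0 L)
  have S: "S integrable_on {s..t}"
    by (rule integrable_on_subinterval[OF integrable_S[of t]]) (use assms in auto)
  have "integral {s..t} Q0 = integral {s..t} (\<lambda>u. S u + rem u)"
    by (rule integral_spike[OF negligible_finite[OF finite_exceptional[of t]]])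
       (use assms Q0_eq_S in auto)
  also have "\<dots> = integral {s..t} S + integral {s..t} rem" by (rule integral_add[OF S L(2)])
  finally show "integral {s..t} Q0 = S1 t - S1 s + integral {s..t} rem" using assms by (simp add: S1_diff)
qed

section \<open>A logarithmic bound for Q from the bound on S1\<close>

context
  fixes T0 A0 A1 :: real
  assumes T0: "2 * pi \<le> T0"
    and S1bound: "\<And>t. t \<ge> T0 \<Longrightarrow> \<bar>S1 t - S1 (168 * pi)\<bar> \<le> A0 + A1 * ln t"
begin

text \<open>With \<open>A1 < 0\<close> the majorant of an absolute value would become negative for
  large t.\<close>

lemma A1_nonneg: "A1 \<ge> 0"
proof (rule ccontr)
  assume "\<not> A1 \<ge> 0"
  then have A1: "A1 < 0" by simp
  define t where "t = max T0 (exp ((\<bar>A0\<bar> + 1) / (- A1)))"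
  have t: "t \<ge> T0" by (simp add: t_def)
  then have t: "t \<ge> T0" "t > 0" using T0 two_pi_gt by linarith+
  have "ln t \<ge> (\<bar>A0\<bar> + 1) / (- A1)" using t by (subst ln_ge_iff) (auto simp: t_def)
  then have "A1 * ln t \<le> A1 * ((\<bar>A0\<bar> + 1) / (- A1))" using A1 by (intro mult_left_mono_neg) auto
  also have "\<dots> = - (\<bar>A0\<bar> + 1)" using A1 by simp
  finally have "A0 + A1 * ln t < 0" by linarith
  then show False using S1bound[OF t(1)] by linarith
qed

text \<open>Since \<open>N0\<close> increases, \<open>N0 t\<close> is at most its mean over
  \<open>{t..t+1}\<close>. The mean of \<open>Q0\<close> is a difference of two values of
  \<open>S1\<close>, which explains the factor 2, plus the mean of \<open>rem\<close>, which is at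
  most 1.\<close>

lemma Q0_upper:
  assumes t: "t \<ge> T0"
  shows "Q0 t \<le> ln (t + 1) + 2 * (A0 + A1 * ln (t + 1)) + 1"
proof -
  have t6: "t > 6" using t T0 two_pi_gt by linarith
  have t2: "t \<ge> 2 * pi" using t T0 by simp
  have "N0 t = integral {t..t+1} (\<lambda>u. N0 t)" by simp
  also have "\<dots> \<le> integral {t..t+1} (\<lambda>u. Q0 u + L (t + 1))"
  proof (rule integral_le)
    show "(\<lambda>u. Q0 u + L (t + 1)) integrable_on {t..t+1}"
      using t6 by (intro integrable_add integral_Q0(1)) auto
    fix u assume u: "u \<in> {t..t+1}"
    then have "L u \<le> L (t + 1)" using t2 by (intro L_diff_bounds(1)) auto
    then show "N0 t \<le> Q0 u + L (t + 1)" using N0_mono[of t u] u by (simp add: Q0_def)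
  qed auto
  also have "\<dots> = integral {t..t+1} Q0 + L (t + 1)"
    using t6 by (subst integral_add) (auto intro!: integral_Q0(1))
  also have "integral {t..t+1} Q0 = S1 (t + 1) - S1 t + integral {t..t+1} rem"
    using t6 by (intro integral_Q0(2)) auto
  also have "integral {t..t+1} rem \<le> integral {t..t+1} (\<lambda>u. 1)"
  proof (rule integral_le)
    show "rem integrable_on {t..t+1}" using t6 by (intro integrable_continuous_real continuous_on_rem) auto
    fix u assume u: "u \<in> {t..t+1}"
    then have "rem u \<le> 1 / (150 * u)" using rem_bounds[of u] t2 by auto
    also have "\<dots> \<le> 1" using u t6 by simp
    finally show "rem u \<le> 1" .
  qed auto
  finally have "N0 t \<le> S1 (t + 1) - S1 t + 1 + L (t + 1)" by simp
  moreover have "L (t + 1) - L t \<le> ln (t + 1)" using t2 by (intro L_diff_bounds(2)) auto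
  moreover have "A1 * ln t \<le> A1 * ln (t + 1)" using A1_nonneg t6 by (intro mult_left_mono) auto
  ultimately show ?thesis using S1bound[OF t] S1bound[of "t + 1", OF order_trans[OF t]] unfolding Q0_def by simp
qed

text \<open>The same averaging from the other side: the mean over \<open>{t..t+1}\<close> is at most
  the value of \<open>N0\<close> at the right end, so the bound is obtained at
  \<open>t + 1\<close>.\<close>

lemma Q0_lower:
  assumes t: "t \<ge> T0"
  shows "Q0 (t + 1) \<ge> - (ln (t + 1) + 2 * (A0 + A1 * ln (t + 1)))"
proof -
  have t6: "t > 6" using t T0 two_pi_gt by linarith
  have t2: "t \<ge> 2 * pi" using t T0 by simp
  have "S1 (t + 1) - S1 t + L t \<le> integral {t..t+1} Q0 + L t"
  proof -
    have "integral {t..t+1} rem \<ge> 0"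
      using rem_bounds t2 t6 by (intro integral_nonneg integrable_continuous_real continuous_on_rem) auto
    then show ?thesis using t6 by (subst integral_Q0(2)) auto
  qed
  also have "\<dots> = integral {t..t+1} (\<lambda>u. Q0 u + L t)"
    using t6 by (subst integral_add) (auto intro!: integral_Q0(1))
  also have "\<dots> \<le> integral {t..t+1} (\<lambda>u. N0 (t + 1))"
  proof (rule integral_le)
    show "(\<lambda>u. Q0 u + L t) integrable_on {t..t+1}"
      using t6 by (intro integrable_add integral_Q0(1)) auto
    fix u assume u: "u \<in> {t..t+1}"
    then have "L t \<le> L u" using t2 by (intro L_diff_bounds(1)) auto
    then show "Q0 u + L t \<le> N0 (t + 1)" using N0_mono[of u "t + 1"] u by (simp add: Q0_def)
  qed auto
  also have "\<dots> = N0 (t + 1)" by simp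
  finally have "S1 (t + 1) - S1 t + L t \<le> N0 (t + 1)" .
  moreover have "L (t + 1) - L t \<le> ln (t + 1)" using t2 by (intro L_diff_bounds(2)) auto
  moreover have "A1 * ln t \<le> A1 * ln (t + 1)" using A1_nonneg t6 by (intro mult_left_mono) auto
  ultimately show ?thesis using S1bound[OF t] S1bound[of "t + 1", OF order_trans[OF t]] unfolding Q0_def by simp
qed

lemma Q0_bound: "\<exists>K\<ge>0. \<forall>t\<ge>T0. \<bar>Q0 t\<bar> \<le> K * ln t"
proof -
  define K1 where "K1 = 2 * (1 + 2 * A1) + 2 * \<bar>A0\<bar> + 1"
  define K2 where "K2 = \<bar>N0 (T0 + 1)\<bar> + \<bar>N0 T0\<bar> + \<bar>L T0\<bar> + \<bar>L (T0 + 1)\<bar>"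
  have t1: "\<bar>Q0 t\<bar> \<le> (K1 + K2) * ln t" if t: "t \<ge> T0" for t
  proof -
    have t2: "t \<ge> 2 * pi" using t T0 by simp
    then have t6: "t > 6" using two_pi_gt by linarith
    have l1: "ln t \<ge> 1" by (rule ln_ge_1[OF t2])
    have "t * 2 \<le> t * t" using t6 by (intro mult_left_mono) auto
    then have "t + 1 \<le> t ^ 2" using t6 unfolding power2_eq_square by linarith
    then have "ln (t + 1) \<le> ln (t ^ 2)" using t6 by (intro ln_mono) auto
    then have l2: "ln (t + 1) \<le> 2 * ln t" using t6 by (simp add: ln_realpow)
    have l3: "ln (t + 1) \<ge> ln t" using t6 by simp
    have K: "K1 \<ge> 0" "K2 \<ge> 0" using A1_nonneg by (auto simp: K1_def K2_def)
    have b: "ln (t + 1) + 2 * (A0 + A1 * ln (t + 1)) + 1 \<le> K1 * ln t"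
    proof -
      have "(1 + 2 * A1) * ln (t + 1) \<le> (1 + 2 * A1) * (2 * ln t)"
        using A1_nonneg l2 by (intro mult_left_mono) auto
      moreover have "(2 * \<bar>A0\<bar> + 1) * 1 \<le> (2 * \<bar>A0\<bar> + 1) * ln t" using l1 by (intro mult_left_mono) auto
      ultimately show ?thesis unfolding K1_def by (simp add: algebra_simps)
    qed
    have "K2 * 1 \<le> (K1 + K2) * ln t" using K l1 by (intro mult_mono) auto
    then have kk: "K1 * ln t \<le> (K1 + K2) * ln t" "K2 \<le> (K1 + K2) * ln t"
      using K l1 by (auto intro!: mult_right_mono)
    have up: "Q0 t \<le> (K1 + K2) * ln t" using Q0_upper[OF t] b kk by linarith
    have "- Q0 t \<le> (K1 + K2) * ln t"
    proof (cases "t \<ge> T0 + 1")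
      case True
      have "A1 * ln t \<le> A1 * ln (t + 1)" using A1_nonneg l3 by (intro mult_left_mono) auto
      then have "- Q0 t \<le> ln (t + 1) + 2 * (A0 + A1 * ln (t + 1)) + 1"
        using Q0_lower[of "t - 1"] True l3 by simp
      then show ?thesis using b kk by linarith
    next
      case False
      \<comment> \<open>On the first unit interval the lower bound would look back beyond
        \<open>T0\<close>, where nothing is assumed about \<open>S1\<close>; here monotonicity of
        \<open>N0\<close> and \<open>L\<close> gives the constant bound \<open>K2\<close>.\<close>
      have "N0 t \<ge> N0 T0" by (rule N0_mono[OF t])
      moreover have "L t \<le> L (T0 + 1)" using False t T0 by (intro L_diff_bounds(1)) auto
      ultimately have "- Q0 t \<le> K2" unfolding Q0_def K2_def by linarith
      then show ?thesis using kk by linarith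
    qed
    then show ?thesis using up by linarith
  qed
  moreover have "K1 + K2 \<ge> 0" using A1_nonneg by (auto simp: K1_def K2_def)
  ultimately show ?thesis by blast
qed

end

section \<open>Partial summation\<close>

lemma finite_zeros_between:
  assumes "T > 0"
  shows "finite {\<rho>\<in>nontrivial_zeros. T \<le> Im \<rho> \<and> Im \<rho> \<le> X}"
  by (rule finite_subset[OF _ finite_zeros_upto[of X]]) (use assms in \<open>auto simp: zeros_upto_def\<close>)

definition zero_weight :: "real \<Rightarrow> complex \<Rightarrow> real" where
  "zero_weight T \<rho> = (if Im \<rho> = T then 1/2 else 1) * mult_zero \<rho>"

text \<open>The half weight at height \<open>T\<close> matches the averaged value
  \<open>N T\<close>, whereas zeros at height \<open>t\<close> count fully, hence
  \<open>N0 t\<close>.\<close>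

lemma sum_zero_weight:
  assumes "T > 0" "T \<le> t"
  shows "(\<Sum>\<rho>\<in>{\<rho>\<in>nontrivial_zeros. T \<le> Im \<rho> \<and> Im \<rho> \<le> t}. zero_weight T \<rho>) = N0 t - N T"
proof -
  define B where "B = {\<rho>\<in>nontrivial_zeros. T < Im \<rho> \<and> Im \<rho> \<le> t}"
  have fin: "finite B" "finite (zeros_at T)"
    using finite_zeros_between[OF assms(1), of t] assms
    by (auto simp: B_def zeros_at_def elim!: rev_finite_subset)
  have "{\<rho>\<in>nontrivial_zeros. T \<le> Im \<rho> \<and> Im \<rho> \<le> t} = zeros_at T \<union> B"
    using assms by (auto simp: B_def zeros_at_def)
  moreover have "zeros_at T \<inter> B = {}" by (auto simp: B_def zeros_at_def)
  ultimately have "(\<Sum>\<rho>\<in>{\<rho>\<in>nontrivial_zeros. T \<le> Im \<rho> \<and> Im \<rho> \<le> t}. zero_weight T \<rho>) = (\<Sum>\<rho>\<in>zeros_at T. zero_weight T \<rho>) + (\<Sum>\<rho>\<in>B. zero_weight T \<rho>)"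
    using fin by (simp add: sum.union_disjoint)
  also have "(\<Sum>\<rho>\<in>zeros_at T. zero_weight T \<rho>) = (\<Sum>\<rho>\<in>zeros_at T. mult_zero \<rho>) / 2"
    by (simp add: zero_weight_def zeros_at_def sum_divide_distrib)
  also have "(\<Sum>\<rho>\<in>B. zero_weight T \<rho>) = (\<Sum>\<rho>\<in>B. mult_zero \<rho>)"
    by (intro sum.cong) (auto simp: zero_weight_def B_def)
  also have "\<dots> = N0 t - N0 T"
  proof -
    have "zeros_upto t = zeros_upto T \<union> B" "zeros_upto T \<inter> B = {}"
      using assms by (auto simp: zeros_upto_def B_def)
    then show ?thesis using fin unfolding N0_eq_sum by (simp add: sum.union_disjoint finite_zeros_upto)
  qed
  finally show ?thesis using N_eq[OF assms(1)] by simp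
qed

text \<open>The condition \<open>g \<le> t\<close> takes the place of the lower limit of
  integration, so that the integrals for different ordinates share one interval and can be added
  under the integral sign.\<close>

lemma has_integral_tail:
  fixes \<phi>' :: "real \<Rightarrow> real"
  assumes d: "\<And>t. t \<in> {T..X} \<Longrightarrow> (\<phi> has_real_derivative \<phi>' t) (at t within {T..X})" and g: "T \<le> g" "g \<le> X"
  shows "((\<lambda>t. if g \<le> t then \<phi>' t else 0) has_integral (\<phi> X - \<phi> g)) {T..X}"
proof -
  have "(\<phi>' has_integral (\<phi> X - \<phi> g)) {g..X}"
    by (rule has_integral_FTC[OF g(2)], rule DERIV_subset[OF d]) (use g in auto)
  then have "((\<lambda>t. if t \<in> {g..X} then \<phi>' t else 0) has_integral (\<phi> X - \<phi> g)) {T..X}"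
    by (rule has_integral_on_superset[OF has_integral_eq[rotated]]) (use g in auto)
  then show ?thesis by (rule has_integral_eq[rotated]) auto
qed

text \<open>Each value of \<open>\<phi>\<close> at an ordinate is \<open>\<phi> X\<close> minus a
  tail integral of \<open>\<phi>'\<close>. The weighted number of tails active at t is
  \<open>N0 t - N T\<close>, so a finite sum of ordinary integrals does the work of a Stieltjes
  integral.\<close>

lemma zero_sum_by_parts:
  fixes \<phi> \<phi>' :: "real \<Rightarrow> real"
  assumes T: "T > 0" "T \<le> X"
    and d: "\<And>t. t \<in> {T..X} \<Longrightarrow> (\<phi> has_real_derivative \<phi>' t) (at t within {T..X})"
  shows "((\<lambda>t. \<phi>' t * N0 t) has_integral (\<phi> X * N0 X - \<phi> T * N T
     - (\<Sum>\<rho>\<in>{\<rho>\<in>nontrivial_zeros. T \<le> Im \<rho> \<and> Im \<rho> \<le> X}. zero_sum_weight T \<phi> \<rho>))) {T..X}"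
proof -
  define A where "A = {\<rho>\<in>nontrivial_zeros. T \<le> Im \<rho> \<and> Im \<rho> \<le> X}"
  have fA: "finite A" unfolding A_def by (rule finite_zeros_between[OF T(1)])
  define w where "w = zero_weight T"
  have "((\<lambda>t. \<Sum>\<rho>\<in>A. w \<rho> * (if Im \<rho> \<le> t then \<phi>' t else 0)) has_integral (\<Sum>\<rho>\<in>A. w \<rho> * (\<phi> X - \<phi> (Im \<rho>)))) {T..X}"
    by (intro has_integral_sum fA has_integral_mult_right has_integral_tail[OF d]) (auto simp: A_def)
  then have "((\<lambda>t. \<phi>' t * (N0 t - N T)) has_integral (\<Sum>\<rho>\<in>A. w \<rho> * (\<phi> X - \<phi> (Im \<rho>)))) {T..X}"
  proof (rule has_integral_eq[rotated])
    fix t assume t: "t \<in> {T..X}"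
    have "(\<Sum>\<rho>\<in>A. w \<rho> * (if Im \<rho> \<le> t then \<phi>' t else 0)) = (\<Sum>\<rho>\<in>{\<rho>\<in>A. Im \<rho> \<le> t}. w \<rho> * \<phi>' t)"
      using fA by (simp add: sum.inter_filter if_distrib cong: if_cong)
    also have "{\<rho>\<in>A. Im \<rho> \<le> t} = {\<rho>\<in>nontrivial_zeros. T \<le> Im \<rho> \<and> Im \<rho> \<le> t}" using t by (auto simp: A_def)
    also have "(\<Sum>\<rho>\<in>\<dots>. w \<rho> * \<phi>' t) = (N0 t - N T) * \<phi>' t"
      using sum_zero_weight[OF T(1), of t] t unfolding w_def by (simp flip: sum_distrib_right)
    finally show "(\<Sum>\<rho>\<in>A. w \<rho> * (if Im \<rho> \<le> t then \<phi>' t else 0)) = \<phi>' t * (N0 t - N T)" by (simp add: mult.commute)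
  qed
  moreover have "((\<lambda>t. \<phi>' t * N T) has_integral (\<phi> X - \<phi> T) * N T) {T..X}"
  proof -
    have "(\<phi>' has_integral (\<phi> X - \<phi> T)) {T..X}"
      by (rule has_integral_eq[OF _ has_integral_tail[OF d, where g = T]]) (use T in auto)
    then show ?thesis by (rule has_integral_mult_left)
  qed
  ultimately have "((\<lambda>t. \<phi>' t * (N0 t - N T) + \<phi>' t * N T) has_integral (\<Sum>\<rho>\<in>A. w \<rho> * (\<phi> X - \<phi> (Im \<rho>))) + (\<phi> X - \<phi> T) * N T) {T..X}"
    by (rule has_integral_add)
  moreover have "(\<Sum>\<rho>\<in>A. w \<rho> * (\<phi> X - \<phi> (Im \<rho>))) = (N0 X - N T) * \<phi> X - (\<Sum>\<rho>\<in>A. zero_sum_weight T \<phi> \<rho>)"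
  proof -
    have "(\<Sum>\<rho>\<in>A. w \<rho> * (\<phi> X - \<phi> (Im \<rho>))) = (\<Sum>\<rho>\<in>A. w \<rho>) * \<phi> X - (\<Sum>\<rho>\<in>A. w \<rho> * \<phi> (Im \<rho>))"
      by (simp add: right_diff_distrib sum_subtractf sum_distrib_right)
    also have "(\<Sum>\<rho>\<in>A. w \<rho>) = N0 X - N T" unfolding A_def w_def by (rule sum_zero_weight[OF T])
    also have "(\<Sum>\<rho>\<in>A. w \<rho> * \<phi> (Im \<rho>)) = (\<Sum>\<rho>\<in>A. zero_sum_weight T \<phi> \<rho>)"
      by (simp add: w_def zero_weight_def zero_sum_weight_def)
    finally show ?thesis .
  qed
  moreover have "(\<lambda>t. \<phi>' t * (N0 t - N T) + \<phi>' t * N T) = (\<lambda>t. \<phi>' t * N0 t)"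
    by (simp add: algebra_simps)
  moreover have "(N0 X - N T) * \<phi> X - z + (\<phi> X - \<phi> T) * N T = \<phi> X * N0 X - \<phi> T * N T - z" for z
    by (simp add: algebra_simps)
  ultimately show ?thesis unfolding A_def by (simp only:)
qed

lemma negligible_ordinates:
  assumes "T > 0"
  shows "negligible {t. T \<le> t \<and> is_ordinate t}"
proof -
  have "{t. T \<le> t \<and> is_ordinate t} \<subseteq> (\<Union>n::nat. {t. 0 < t \<and> t \<le> real n \<and> is_ordinate t})"
  proof safe
    fix t assume t: "T \<le> t" "is_ordinate t"
    obtain n :: nat where "t \<le> real n" using real_arch_simple by blast
    then show "t \<in> (\<Union>n. {t. 0 < t \<and> t \<le> real n \<and> is_ordinate t})" using t assms by auto
  qed
  moreover have "negligible (\<Union>n::nat. {t. 0 < t \<and> t \<le> real n \<and> is_ordinate t})"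
    by (intro negligible_Union_nat negligible_finite finite_ordinates)
  ultimately show ?thesis by (rule negligible_subset[rotated])
qed

text \<open>Summability and integrability are asserted along with the identity, because
  \<open>infsum\<close> and \<open>integral\<close> take a default value where they do not
  converge.\<close>

theorem theorem1:
  fixes \<phi> \<phi>' \<phi>'' :: "real \<Rightarrow> real" and T0 T A0 A1 :: real
  assumes T0: "2 * pi \<le> T0"
    and d1: "\<And>t. t \<ge> T0 \<Longrightarrow> (\<phi> has_real_derivative \<phi>' t) (at t within {T0..})"
    and d2: "\<And>t. t \<ge> T0 \<Longrightarrow> (\<phi>' has_real_derivative \<phi>'' t) (at t within {T0..})"
    and cont2: "continuous_on {T0..} \<phi>''"
    and nonneg: "\<And>t. t \<ge> T0 \<Longrightarrow> 0 \<le> \<phi> t"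
    and dec: "\<And>t. t \<ge> T0 \<Longrightarrow> \<phi>' t \<le> 0"
    and convex: "\<And>t. t \<ge> T0 \<Longrightarrow> \<phi>'' t \<ge> 0"
    and S1bound: "\<And>t. t \<ge> T0 \<Longrightarrow> \<bar>S1 t - S1 (168 * pi)\<bar> \<le> A0 + A1 * ln t"
    and T: "T0 \<le> T"
    and fin: "(\<lambda>t. \<phi> t * ln (t / (2 * pi))) integrable_on {T..}"
  shows "zero_sum_weight T \<phi> summable_on {\<rho>\<in>nontrivial_zeros. T \<le> Im \<rho>}
    \<and> (\<lambda>t. \<phi>' t * Q t) integrable_on {T..}
    \<and> infsum (zero_sum_weight T \<phi>) {\<rho>\<in>nontrivial_zeros. T \<le> Im \<rho>}
        - 1 / (2 * pi) * integral {T..} (\<lambda>t. \<phi> t * ln (t / (2 * pi)))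
      = - \<phi> T * Q T + (- integral {T..} (\<lambda>t. \<phi>' t * Q t))
    \<and> \<bar>- integral {T..} (\<lambda>t. \<phi>' t * Q t)\<bar>
      \<le> 2 * (A0 + A1 * ln T) * \<bar>\<phi>' T\<bar> + (A1 + 1 / 150) * \<phi> T / T"
proof -
  have T2: "T \<ge> 2 * pi" using T0 T by simp
  then have Tpos: "T > 0" using two_pi_gt by linarith
  have A1: "A1 \<ge> 0" by (rule A1_nonneg[OF T0 S1bound])
  obtain K where K: "K \<ge> 0" "\<And>t. t \<ge> T0 \<Longrightarrow> \<bar>Q0 t\<bar> \<le> K * ln t"
    using Q0_bound[OF T0 S1bound] by blast
  have lnpos: "ln t \<ge> 1" if "t \<ge> T" for t using ln_ge_1[of t] T2 that by simp
  have dphi: "(\<phi> has_real_derivative \<phi>' t) (at t within {T..X})" if "t \<in> {T..X}" for t X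
    by (rule DERIV_subset[OF d1]) (use that T in auto)
  have dphi': "(\<phi>' has_real_derivative \<phi>'' t) (at t within {T..X})" if "t \<in> {T..X}" for t X
    by (rule DERIV_subset[OF d2]) (use that T in auto)
  have c\<phi>: "continuous_on {T..X} \<phi>" and c\<phi>': "continuous_on {T..X} \<phi>'" for X
    using DERIV_continuous_on[OF dphi] DERIV_continuous_on[OF dphi'] by blast+
  have c\<phi>'': "continuous_on {T..X} \<phi>''" for X
    by (rule continuous_on_subset[OF cont2]) (use T in auto)
  have int_\<phi>': "(\<phi>' has_integral (\<phi> X - \<phi> T)) {T..X}" if "T \<le> X" for X
    by (rule has_integral_eq[OF _ has_integral_tail[OF dphi, where g = T and X = X]]) (use that in auto)
  have antimono: "\<phi> b \<le> \<phi> a" if "T \<le> a" "a \<le> b" for a b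
  proof -
    have "((\<lambda>t. if a \<le> t then \<phi>' t else 0) has_integral (\<phi> b - \<phi> a)) {T..b}"
      by (rule has_integral_tail[OF dphi]) (use that in auto)
    then have "((\<lambda>t. - (if a \<le> t then \<phi>' t else 0)) has_integral - (\<phi> b - \<phi> a)) {T..b}"
      by (rule has_integral_neg)
    then have "- (\<phi> b - \<phi> a) \<ge> 0"
      by (rule has_integral_nonneg) (use dec T in auto)
    then show ?thesis by simp
  qed

  define f where "f = (\<lambda>t. \<phi> t * ln (t / (2 * pi)))"
  define I where "I = integral {T..} f"
  have f_int: "f integrable_on {T..}" using fin unfolding f_def .
  have f0: "f t \<ge> 0" if "t \<ge> T" for t
    unfolding f_def using nonneg[of t] ln_2pi_nonneg[of t] T T2 that by (intro mult_nonneg_nonneg) auto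
  have f_c: "continuous_on {T..X} f" for X
    unfolding f_def using Tpos by (intro continuous_intros c\<phi>) auto
  have f_int': "f integrable_on {a..b}" if "T \<le> a" for a b
    by (rule integrable_continuous_real, rule continuous_on_subset[OF f_c[of b]]) (use that in auto)
  have f_le: "integral {a..b} f \<le> I" if "T \<le> a" for a b
    unfolding I_def by (intro integral_subset_le f_int' f_int) (use that f0 in auto)

  \<comment> \<open>Since \<open>\<phi>\<close> is decreasing and eventually \<open>\<phi> \<le> \<phi> ln(t/2\<pi>)\<close>, it decays like \<open>1/t\<close>.\<close>
  define a where "a = max T 20"
  have aT: "a \<ge> T" "a \<ge> 20" by (auto simp: a_def)
  \<comment> \<open>The number 20 in the choice of \<open>a\<close> exceeds 2 pi e, which is about
    17.1.\<close>
  have ln1: "ln (t / (2 * pi)) \<ge> 1" if "t \<ge> a" for t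
  proof -
    have "pi < 3.15" "exp 1 < (3::real)" using pi_approx e_less_272 by auto
    then have "exp 1 * (2 * pi) \<le> 3 * 6.3" by (intro mult_mono) auto
    then have "exp 1 * (2 * pi) \<le> t" using that aT by simp
    then have "exp 1 \<le> t / (2 * pi)" by (simp add: field_simps)
    then show ?thesis by (subst ln_ge_iff) (use exp_gt_zero[of "1::real"] in linarith)+
  qed
  have decay: "\<phi> X * (X - a) \<le> I" if "X \<ge> a" for X
  proof -
    have "\<phi> X * (X - a) = integral {a..X} (\<lambda>t. \<phi> X)" using that by simp
    also have "\<dots> \<le> integral {a..X} f"
    proof (rule integral_le)
      fix t assume t: "t \<in> {a..X}"
      have "\<phi> X * 1 \<le> \<phi> t * ln (t / (2 * pi))"
        using t aT T ln1[of t] nonneg[of t] antimono[of t X] by (intro mult_mono) auto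
      then show "\<phi> X \<le> f t" by (simp add: f_def)
    qed (use f_int' aT in auto)
    also have "\<dots> \<le> I" by (rule f_le[OF aT(1)])
    finally show ?thesis .
  qed
  have I0: "I \<ge> 0" unfolding I_def by (intro integral_nonneg f_int) (use f0 in auto)
  \<comment> \<open>The boundary term at infinity is O(log t / t), by the decay of
    \<open>\<phi>\<close> and the logarithmic bound for \<open>Q0\<close>.\<close>
  have \<phi>Q_lim: "(\<lambda>k. \<phi> (T + real k) * Q0 (T + real k)) \<longlonglongrightarrow> 0"
  proof (rule Lim_null_comparison)
    show "\<forall>\<^sub>F k in sequentially. norm (\<phi> (T + real k) * Q0 (T + real k)) \<le> I / (T + real k - a) * (K * ln (T + real k))"
    proof (rule eventually_sequentiallyI[of "nat \<lceil>a\<rceil> + 1"])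
      fix k assume "nat \<lceil>a\<rceil> + 1 \<le> k"
      then have "real k \<ge> a + 1" by linarith
      then have k: "T + real k > a" using Tpos by linarith
      then have "\<phi> (T + real k) \<le> I / (T + real k - a)"
        using decay[of "T + real k"] by (simp add: field_simps)
      moreover have "\<bar>Q0 (T + real k)\<bar> \<le> K * ln (T + real k)" using K(2)[of "T + real k"] T by simp
      moreover have "\<phi> (T + real k) \<ge> 0" using nonneg[of "T + real k"] T by simp
      ultimately show "norm (\<phi> (T + real k) * Q0 (T + real k)) \<le> I / (T + real k - a) * (K * ln (T + real k))"
        using I0 k unfolding real_norm_def abs_mult by (intro mult_mono) auto
    qed
    have "(\<lambda>k. ln (T + real k) / (T + real k - a)) \<longlonglongrightarrow> 0" by real_asymp
    from tendsto_mult_left[OF this, of "I * K"]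
    show "(\<lambda>k. I / (T + real k - a) * (K * ln (T + real k))) \<longlonglongrightarrow> 0" by (simp add: mult_ac)
  qed

  \<comment> \<open>Up to the factor \<open>K\<close>, this integrand dominates the absolute value
    of \<open>\<phi>' t * Q0 t\<close>. Integration by parts reduces its integrability on the
    half-line to a bound for the integral of \<open>\<phi> t / t\<close>.\<close>
  have neg_int: "((\<lambda>t. - \<phi>' t * ln t) has_integral
      (\<phi> T * ln T - \<phi> X * ln X + integral {T..X} (\<lambda>t. \<phi> t / t))) {T..X}" if X: "T \<le> X" for X
  proof -
    have "((\<lambda>t. \<phi>' t * ln t + \<phi> t * (1 / t)) has_integral (\<phi> X * ln X - \<phi> T * ln T)) {T..X}"
    proof (rule has_integral_FTC[OF X])
      fix x assume x: "x \<in> {T..X}"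
      have "((\<lambda>t. \<phi> t * ln t) has_real_derivative \<phi>' x * ln x + (1 / x) * \<phi> x) (at x within {T..X})"
        by (rule DERIV_mult[OF dphi[OF x]]) (use x Tpos in \<open>auto intro!: derivative_eq_intros\<close>)
      then show "((\<lambda>t. \<phi> t * ln t) has_real_derivative \<phi>' x * ln x + \<phi> x * (1 / x)) (at x within {T..X})" by simp
    qed
    moreover have "((\<lambda>t. \<phi> t / t) has_integral integral {T..X} (\<lambda>t. \<phi> t / t)) {T..X}"
      using Tpos by (intro integrable_integral integrable_continuous_real continuous_intros c\<phi>) auto
    ultimately have "((\<lambda>t. \<phi> t / t - (\<phi>' t * ln t + \<phi> t * (1 / t))) has_integral
       (integral {T..X} (\<lambda>t. \<phi> t / t) - (\<phi> X * ln X - \<phi> T * ln T))) {T..X}"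
      by (intro has_integral_diff)
    then show ?thesis by (simp add: algebra_simps)
  qed
  \<comment> \<open>Near 2 pi the factor ln(t/2pi) in \<open>f\<close> may vanish, so
    \<open>f\<close> dominates \<open>\<phi> t / t\<close> only beyond \<open>a\<close>; on
    \<open>{T..a}\<close> the constant \<open>\<phi> T\<close> is added instead.\<close>
  have \<phi>t_le: "integral {T..X} (\<lambda>t. \<phi> t / t) \<le> I + \<phi> T * (a - T)" if X: "T \<le> X" for X
  proof -
    have "integral {T..X} (\<lambda>t. \<phi> t / t) \<le> integral {T..X} (\<lambda>t. f t + (if t \<in> {T..a} then \<phi> T else 0))"
    proof (rule integral_le)
      show "(\<lambda>t. \<phi> t / t) integrable_on {T..X}"
        using Tpos by (intro integrable_continuous_real continuous_intros c\<phi>) auto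
      have "(\<lambda>t. if t \<in> {T..a} then \<phi> T else 0) integrable_on {T..X}"
        using integrable_restrict_Int[of "{T..a}" "\<lambda>_. \<phi> T" "{T..X}"] by (simp add: Int_atLeastAtMost integrable_const_ivl)
      then show "(\<lambda>t. f t + (if t \<in> {T..a} then \<phi> T else 0)) integrable_on {T..X}"
        by (intro integrable_add f_int') auto
      fix t assume t: "t \<in> {T..X}"
      have p: "\<phi> t \<ge> 0" using nonneg[of t] t T by simp
      have t1: "\<phi> t / t \<le> \<phi> t * 1"
        using p t T2 two_pi_gt by (simp add: divide_le_eq mult_le_cancel_left1)
      show "\<phi> t / t \<le> f t + (if t \<in> {T..a} then \<phi> T else 0)"
      proof (cases "t \<le> a")
        case True
        then show ?thesis using t t1 antimono[of T t] f0[of t] by simp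
      next
        case False
        then have "\<phi> t * 1 \<le> f t" unfolding f_def using p ln1[of t] by (intro mult_left_mono) auto
        then show ?thesis using t1 False by simp
      qed
    qed
    also have "\<dots> = integral {T..X} f + integral {T..X} (\<lambda>t. if t \<in> {T..a} then \<phi> T else 0)"
      using integrable_restrict_Int[of "{T..a}" "\<lambda>_. \<phi> T" "{T..X}"]
      by (intro integral_add f_int') (auto simp: Int_atLeastAtMost integrable_const_ivl)
    also have "integral {T..X} (\<lambda>t. if t \<in> {T..a} then \<phi> T else 0) = integral {T..min a X} (\<lambda>t. \<phi> T)"
      using integral_restrict_Int[of "{T..X}" "{T..a}" "\<lambda>_. \<phi> T"] by (simp add: Int_atLeastAtMost min.commute)
    also have "\<dots> = \<phi> T * (min a X - T)" using X aT by simp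
    also have "\<dots> \<le> \<phi> T * (a - T)" using nonneg[OF T] by (intro mult_left_mono) auto
    finally show ?thesis using f_le[of T X] by simp
  qed
  have h_int: "(\<lambda>t. - \<phi>' t * ln t) integrable_on {T..}"
  proof (rule integrable_on_atLeast_nonneg)
    fix k :: nat
    show "(\<lambda>t. - \<phi>' t * ln t) integrable_on {T..T + real k}" using neg_int[of "T + real k"] by (auto simp: integrable_on_def)
    have "\<phi> (T + real k) * ln (T + real k) \<ge> 0"
      using nonneg[of "T + real k"] lnpos[of "T + real k"] T by (intro mult_nonneg_nonneg) auto
    then show "integral {T..T + real k} (\<lambda>t. - \<phi>' t * ln t) \<le> \<phi> T * ln T + (I + \<phi> T * (a - T))"
      using integral_unique[OF neg_int[of "T + real k"]] \<phi>t_le[of "T + real k"] by simp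
  next
    fix x assume "x \<ge> T"
    then show "0 \<le> - \<phi>' x * ln x" using dec[of x] lnpos[of x] T by (intro mult_nonneg_nonneg) auto
  qed

  define Z where "Z = (\<lambda>X. \<Sum>\<rho>\<in>{\<rho>\<in>nontrivial_zeros. T \<le> Im \<rho> \<and> Im \<rho> \<le> X}. zero_sum_weight T \<phi> \<rho>)"
  \<comment> \<open>At the lower end the half weights produce the averaged \<open>Q T\<close>; at
    the upper end zeros at height \<open>X\<close> count fully, hence \<open>Q0 X\<close>. The
    integral of \<open>f\<close> comes from the derivative of \<open>L\<close>.\<close>
  have parts: "((\<lambda>t. \<phi>' t * Q0 t) has_integral (\<phi> X * Q0 X - \<phi> T * Q T - Z X + 1 / (2 * pi) * integral {T..X} f)) {T..X}" if X: "T \<le> X" for X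
  proof -
    have "((\<lambda>t. \<phi>' t * L t + \<phi> t * (ln (t / (2 * pi)) / (2 * pi))) has_integral (\<phi> X * L X - \<phi> T * L T)) {T..X}"
    proof (rule has_integral_FTC[OF X])
      fix x assume x: "x \<in> {T..X}"
      have "((\<lambda>t. \<phi> t * L t) has_real_derivative \<phi>' x * L x + (ln (x / (2 * pi)) / (2 * pi)) * \<phi> x) (at x within {T..X})"
        by (rule DERIV_mult[OF dphi[OF x] L_has_derivative]) (use x Tpos in auto)
      then show "((\<lambda>t. \<phi> t * L t) has_real_derivative \<phi>' x * L x + \<phi> x * (ln (x / (2 * pi)) / (2 * pi))) (at x within {T..X})"
        by (simp add: mult.commute)
    qed
    moreover have "((\<lambda>t. 1 / (2 * pi) * f t) has_integral 1 / (2 * pi) * integral {T..X} f) {T..X}"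
      by (intro has_integral_mult_right integrable_integral f_int') auto
    moreover have "((\<lambda>t. \<phi>' t * N0 t) has_integral (\<phi> X * N0 X - \<phi> T * N T - Z X)) {T..X}"
      unfolding Z_def by (rule zero_sum_by_parts[OF Tpos X dphi])
    ultimately have "((\<lambda>t. \<phi>' t * N0 t - ((\<phi>' t * L t + \<phi> t * (ln (t / (2 * pi)) / (2 * pi))) - 1 / (2 * pi) * f t)) has_integral
        ((\<phi> X * N0 X - \<phi> T * N T - Z X) - ((\<phi> X * L X - \<phi> T * L T) - 1 / (2 * pi) * integral {T..X} f))) {T..X}"
      by (intro has_integral_diff)
    moreover have "(\<phi> X * N0 X - \<phi> T * N T - Z X) - ((\<phi> X * L X - \<phi> T * L T) - 1 / (2 * pi) * integral {T..X} f)
       = \<phi> X * Q0 X - \<phi> T * Q T - Z X + 1 / (2 * pi) * integral {T..X} f"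
      by (simp add: Q0_def Q_def algebra_simps)
    moreover have "\<phi>' t * N0 t - ((\<phi>' t * L t + \<phi> t * (ln (t / (2 * pi)) / (2 * pi))) - 1 / (2 * pi) * f t) = \<phi>' t * Q0 t" for t
      by (simp add: Q0_def f_def algebra_simps)
    ultimately show ?thesis by (simp only:)
  qed
  have Q0_int: "(\<lambda>t. \<phi>' t * Q0 t) integrable_on {T..}"
    and Q0_lim: "(\<lambda>k. integral {T..T + real k} (\<lambda>t. \<phi>' t * Q0 t)) \<longlonglongrightarrow> integral {T..} (\<lambda>t. \<phi>' t * Q0 t)"
  proof -
    have i: "(\<lambda>t. \<phi>' t * Q0 t) integrable_on {T..T + real k}" for k :: nat
      using parts[of "T + real k"] by (auto simp: integrable_on_def)
    have h: "(\<lambda>t. K * (- \<phi>' t * ln t)) integrable_on {T..}" using h_int by (intro integrable_on_mult_right)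
    have b: "\<bar>\<phi>' t * Q0 t\<bar> \<le> K * (- \<phi>' t * ln t)" if "t \<ge> T" for t
    proof -
      have "\<bar>\<phi>' t * Q0 t\<bar> = (- \<phi>' t) * \<bar>Q0 t\<bar>" using dec[of t] T that by (simp add: abs_mult)
      also have "\<dots> \<le> (- \<phi>' t) * (K * ln t)" using dec[of t] K(2)[of t] T that by (intro mult_left_mono) auto
      finally show ?thesis by (simp add: mult_ac)
    qed
    show "(\<lambda>t. \<phi>' t * Q0 t) integrable_on {T..}"
      "(\<lambda>k. integral {T..T + real k} (\<lambda>t. \<phi>' t * Q0 t)) \<longlonglongrightarrow> integral {T..} (\<lambda>t. \<phi>' t * Q0 t)"
      using integral_atLeast_limit[OF i h b] by blast+
  qed
  define E where "E = integral {T..} (\<lambda>t. \<phi>' t * Q0 t)"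
  have f_lim: "(\<lambda>k. integral {T..T + real k} f) \<longlonglongrightarrow> I"
    unfolding I_def by (rule integral_atLeast_limit(2)[OF f_int' f_int]) (use f0 in auto)
  have spike: "(\<lambda>t. \<phi>' t * Q t) integrable_on {T..}" "integral {T..} (\<lambda>t. \<phi>' t * Q t) = E"
  proof -
    have eq: "\<phi>' t * Q t = \<phi>' t * Q0 t" if "t \<in> {T..} - {t. T \<le> t \<and> is_ordinate t}" for t
      using that Q_eq_Q0[of t] by auto
    show "(\<lambda>t. \<phi>' t * Q t) integrable_on {T..}"
      by (rule integrable_spike[OF Q0_int negligible_ordinates[OF Tpos] eq])
    show "integral {T..} (\<lambda>t. \<phi>' t * Q t) = E"
      unfolding E_def by (rule integral_spike[OF negligible_ordinates[OF Tpos] eq [symmetric]])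
  qed

  have Z_lim: "(\<lambda>k. Z (T + real k)) \<longlonglongrightarrow> - \<phi> T * Q T + 1 / (2 * pi) * I - E"
  proof -
    have "Z (T + real k) = \<phi> (T + real k) * Q0 (T + real k) - \<phi> T * Q T + 1 / (2 * pi) * integral {T..T + real k} f
        - integral {T..T + real k} (\<lambda>t. \<phi>' t * Q0 t)" for k
      using integral_unique[OF parts[of "T + real k"]] by simp
    moreover have "(\<lambda>k. \<phi> (T + real k) * Q0 (T + real k) - \<phi> T * Q T + 1 / (2 * pi) * integral {T..T + real k} f
        - integral {T..T + real k} (\<lambda>t. \<phi>' t * Q0 t)) \<longlonglongrightarrow> 0 - \<phi> T * Q T + 1 / (2 * pi) * I - E"
      unfolding E_def by (intro tendsto_intros \<phi>Q_lim f_lim Q0_lim)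
    ultimately show ?thesis by simp
  qed
  define A where "A = {\<rho>\<in>nontrivial_zeros. T \<le> Im \<rho>}"
  define Ak where "Ak = (\<lambda>X. {\<rho>\<in>nontrivial_zeros. T \<le> Im \<rho> \<and> Im \<rho> \<le> X})"
  have w0: "zero_sum_weight T \<phi> \<rho> \<ge> 0" if "\<rho> \<in> A" for \<rho>
    using that mult_zero_nonneg[of \<rho>] nonneg[of "Im \<rho>"] T by (auto simp: A_def zero_sum_weight_def)
  have Ak: "finite (Ak X)" "Ak X \<subseteq> A" for X
    using finite_zeros_between[OF Tpos] by (auto simp: Ak_def A_def)
  have Z_Ak: "Z X = sum (zero_sum_weight T \<phi>) (Ak X)" for X by (simp add: Z_def Ak_def)
  have incZ: "incseq (\<lambda>k. Z (T + real k))"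
    unfolding Z_Ak by (intro incseq_SucI sum_mono2 Ak w0) (use Ak in \<open>auto simp: Ak_def A_def\<close>)
  define l where "l = - \<phi> T * Q T + 1 / (2 * pi) * I - E"
  have Zl: "Z (T + real k) \<le> l" for k
    using incseq_le[OF incZ Z_lim] by (simp add: l_def)
  \<comment> \<open>Every finite set of zeros lies below some height \<open>T + real k\<close>, so
    its nonnegative sum is bounded by the limit \<open>l\<close> of the increasing partial
    sums.\<close>
  have fin_le: "sum (zero_sum_weight T \<phi>) F \<le> l" if F: "finite F" "F \<subseteq> A" for F
  proof -
    obtain k :: nat where k: "Max (insert 0 (Im ` F)) \<le> real k" using real_arch_simple by blast
    have "F \<subseteq> Ak (T + real k)"
    proof
      fix \<rho> assume \<rho>: "\<rho> \<in> F"
      then have "Im \<rho> \<le> Max (insert 0 (Im ` F))" using F by (intro Max_ge) auto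
      then show "\<rho> \<in> Ak (T + real k)" using \<rho> F k Tpos by (auto simp: Ak_def A_def)
    qed
    then have "sum (zero_sum_weight T \<phi>) F \<le> sum (zero_sum_weight T \<phi>) (Ak (T + real k))"
      using Ak(2) by (intro sum_mono2 Ak(1) w0) auto
    also have "\<dots> \<le> l" using Zl[of k] by (simp add: Z_Ak)
    finally show ?thesis .
  qed
  have summable: "zero_sum_weight T \<phi> summable_on A"
    by (rule nonneg_bdd_above_summable_on) (use w0 fin_le in \<open>auto intro!: bdd_aboveI[of _ l]\<close>)
  have infsum: "infsum (zero_sum_weight T \<phi>) A = l"
  proof (rule antisym)
    show "infsum (zero_sum_weight T \<phi>) A \<le> l" by (rule infsum_le_finite_sums[OF summable]) (rule fin_le)
    have "Z (T + real k) \<le> infsum (zero_sum_weight T \<phi>) A" for k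
      unfolding Z_Ak by (rule finite_sum_le_infsum[OF summable]) (use Ak w0 in auto)
    then show "l \<le> infsum (zero_sum_weight T \<phi>) A"
      using Z_lim unfolding l_def by (intro LIMSEQ_le_const2) auto
  qed

  \<comment> \<open>By \<open>Q = S + rem\<close>, only the \<open>S\<close>-part needs cancellation; it is integrated by parts against \<open>S1 - S1(168\<pi>)\<close>,
     where the boundary terms at \<open>X\<close> cancel against those of the majorant \<open>A0 + A1 ln t\<close>.\<close>
  define B where "B = (\<lambda>t. A0 + A1 * ln t)"
  define g where "g = (\<lambda>t. S1 t - S1 (168 * pi))"
  have gB: "\<bar>g t\<bar> \<le> B t" if "t \<ge> T" for t using S1bound[of t] that T by (simp add: g_def B_def)
  \<comment> \<open>The source of the error term in \<open>\<phi> T / T\<close>: 1/t is at most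
    1/\<open>T\<close>, and the integral of \<open>- \<phi>'\<close> is at most
    \<open>\<phi> T\<close>. It is used once with the factor \<open>A1\<close> and once with
    1/150.\<close>
  have neg_t: "0 \<le> integral {T..X} (\<lambda>t. - \<phi>' t / t) \<and> integral {T..X} (\<lambda>t. - \<phi>' t / t) \<le> \<phi> T / T"
    and int_neg_t: "(\<lambda>t. - \<phi>' t / t) integrable_on {T..X}" if X: "T \<le> X" for X
  proof -
    show i: "(\<lambda>t. - \<phi>' t / t) integrable_on {T..X}"
      using Tpos by (intro integrable_continuous_real continuous_intros c\<phi>') auto
    have "integral {T..X} (\<lambda>t. - \<phi>' t / t) \<le> integral {T..X} (\<lambda>t. - \<phi>' t / T)"
    proof (rule integral_le[OF i])
      show "(\<lambda>t. - \<phi>' t / T) integrable_on {T..X}"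
        using Tpos by (intro integrable_continuous_real continuous_intros c\<phi>') auto
      show "- \<phi>' t / t \<le> - \<phi>' t / T" if "t \<in> {T..X}" for t
        using that dec[of t] T Tpos by (intro divide_left_mono) auto
    qed
    also have "\<dots> = (\<phi> T - \<phi> X) / T"
      unfolding integral_unique[OF has_integral_divide[OF has_integral_neg[OF int_\<phi>'[OF X]]]] by simp
    also have "\<dots> \<le> \<phi> T / T" using nonneg[of X] X T Tpos by (intro divide_right_mono) auto
    finally have "integral {T..X} (\<lambda>t. - \<phi>' t / t) \<le> \<phi> T / T" .
    moreover have "0 \<le> integral {T..X} (\<lambda>t. - \<phi>' t / t)"
      by (rule integral_nonneg[OF i]) (use dec T Tpos in \<open>auto simp: divide_nonpos_pos\<close>)
    ultimately show "0 \<le> integral {T..X} (\<lambda>t. - \<phi>' t / t) \<and> integral {T..X} (\<lambda>t. - \<phi>' t / t) \<le> \<phi> T / T" by blast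
  qed
  have bound: "\<bar>integral {T..X} (\<lambda>t. \<phi>' t * Q0 t)\<bar> \<le> 2 * B T * \<bar>\<phi>' T\<bar> + (A1 + 1 / 150) * \<phi> T / T" if X: "T \<le> X" for X
  proof -
    have cg: "continuous_on {T..X} g"
      unfolding g_def by (intro continuous_intros continuous_on_subset[OF continuous_on_S1[of X]]) (use Tpos in auto)
    have cB: "continuous_on {T..X} B"
      unfolding B_def using Tpos by (intro continuous_intros) auto
    have ig: "(\<lambda>t. \<phi>'' t * g t) integrable_on {T..X}"
      by (intro integrable_continuous_real continuous_intros c\<phi>'' cg)
    have iB: "(\<lambda>t. \<phi>'' t * B t) integrable_on {T..X}"
      by (intro integrable_continuous_real continuous_intros c\<phi>'' cB)
    \<comment> \<open>At ordinates \<open>S\<close> jumps and \<open>S1\<close> may have corners, so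
      the fundamental theorem is used in the form that admits finitely many exceptional
      points.\<close>
    have "((\<lambda>t. \<phi>'' t * g t + S t * \<phi>' t) has_integral (\<phi>' X * g X - \<phi>' T * g T)) {T..X}"
    proof (rule fundamental_theorem_of_calculus_interior_strong[OF finite_exceptional[of X] X])
      show "continuous_on {T..X} (\<lambda>t. \<phi>' t * g t)" by (intro continuous_intros c\<phi>' cg)
      fix x assume x: "x \<in> {T<..<X} - insert 0 {t. 0 < t \<and> t \<le> X \<and> is_ordinate t}"
      have "(\<phi>' has_real_derivative \<phi>'' x) (at x within {T..X})" using dphi'[of x X] x by auto
      then have "(\<phi>' has_real_derivative \<phi>'' x) (at x)"
        using x at_within_Icc_at[of T x X] by auto
      moreover have "(S1 has_real_derivative S x) (at x)" using x Tpos by (intro S1_has_derivative) auto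
      then have "(g has_real_derivative S x) (at x)" unfolding g_def by (auto intro!: derivative_eq_intros)
      ultimately have "((\<lambda>t. \<phi>' t * g t) has_real_derivative \<phi>'' x * g x + S x * \<phi>' x) (at x)" by (rule DERIV_mult)
      then show "((\<lambda>t. \<phi>' t * g t) has_vector_derivative \<phi>'' x * g x + S x * \<phi>' x) (at x)"
        by (simp add: has_real_derivative_iff_has_vector_derivative)
    qed
    from has_integral_diff[OF this integrable_integral[OF ig]]
    have S_int: "((\<lambda>t. S t * \<phi>' t) has_integral (\<phi>' X * g X - \<phi>' T * g T - integral {T..X} (\<lambda>t. \<phi>'' t * g t))) {T..X}"
      by simp
    have ir: "(\<lambda>t. rem t * \<phi>' t) integrable_on {T..X}"
      using Tpos by (intro integrable_continuous_real continuous_intros c\<phi>' continuous_on_rem) auto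
    have "integral {T..X} (\<lambda>t. \<phi>' t * Q0 t) = integral {T..X} (\<lambda>t. S t * \<phi>' t + rem t * \<phi>' t)"
      by (rule integral_spike[OF negligible_finite[OF finite_exceptional[of X]]])
         (use Q0_eq_S Tpos in \<open>auto simp: algebra_simps\<close>)
    also have "\<dots> = (\<phi>' X * g X - \<phi>' T * g T - integral {T..X} (\<lambda>t. \<phi>'' t * g t)) + integral {T..X} (\<lambda>t. rem t * \<phi>' t)"
      by (rule integral_unique[OF has_integral_add[OF S_int integrable_integral[OF ir]]])
    finally have eq: "integral {T..X} (\<lambda>t. \<phi>' t * Q0 t) = \<dots>" .
    have r1: "\<bar>integral {T..X} (\<lambda>t. rem t * \<phi>' t)\<bar> \<le> 1 / 150 * (\<phi> T / T)"
    proof -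
      have "norm (integral {T..X} (\<lambda>t. rem t * \<phi>' t)) \<le> integral {T..X} (\<lambda>t. 1 / 150 * (- \<phi>' t / t))"
      proof (rule integral_norm_bound_integral[OF ir])
        show "(\<lambda>t. 1 / 150 * (- \<phi>' t / t)) integrable_on {T..X}" by (intro integrable_on_mult_right int_neg_t X)
        fix t assume t: "t \<in> {T..X}"
        have "\<bar>rem t\<bar> * \<bar>\<phi>' t\<bar> \<le> 1 / (150 * t) * (- \<phi>' t)"
          using rem_bounds[of t] dec[of t] t T T2 Tpos by (intro mult_mono) auto
        then show "norm (rem t * \<phi>' t) \<le> 1 / 150 * (- \<phi>' t / t)" by (simp add: abs_mult)
      qed
      also have "\<dots> = 1 / 150 * integral {T..X} (\<lambda>t. - \<phi>' t / t)" by (rule integral_mult_right)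
      also have "\<dots> \<le> 1 / 150 * (\<phi> T / T)" using neg_t[OF X] by (intro mult_left_mono) auto
      finally show ?thesis by simp
    qed
    \<comment> \<open>Because \<open>\<phi>''\<close> is nonnegative, the integral of
      \<open>\<phi>'' t * g t\<close> is dominated by that of \<open>\<phi>'' t * B t\<close>.
      Undoing the integration by parts there costs only the derivative \<open>A1 / t\<close> of
      \<open>B\<close>.\<close>
    have "((\<lambda>t. \<phi>'' t * B t + A1 * (1 / t) * \<phi>' t) has_integral (\<phi>' X * B X - \<phi>' T * B T)) {T..X}"
    proof (rule has_integral_FTC[OF X])
      fix x assume x: "x \<in> {T..X}"
      have "(B has_real_derivative A1 * (1 / x)) (at x within {T..X})"
        unfolding B_def using x Tpos by (auto intro!: derivative_eq_intros)
      from DERIV_mult[OF dphi'[OF x] this]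
      show "((\<lambda>t. \<phi>' t * B t) has_real_derivative \<phi>'' x * B x + A1 * (1 / x) * \<phi>' x) (at x within {T..X})" .
    qed
    moreover have "((\<lambda>t. A1 * (- \<phi>' t / t)) has_integral A1 * integral {T..X} (\<lambda>t. - \<phi>' t / t)) {T..X}"
      by (intro has_integral_mult_right integrable_integral int_neg_t X)
    ultimately have "((\<lambda>t. (\<phi>'' t * B t + A1 * (1 / t) * \<phi>' t) + A1 * (- \<phi>' t / t)) has_integral
       (\<phi>' X * B X - \<phi>' T * B T) + A1 * integral {T..X} (\<lambda>t. - \<phi>' t / t)) {T..X}"
      by (rule has_integral_add)
    then have B_eq: "integral {T..X} (\<lambda>t. \<phi>'' t * B t) = \<phi>' X * B X - \<phi>' T * B T + A1 * integral {T..X} (\<lambda>t. - \<phi>' t / t)"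
      by (simp add: integral_unique)
    have g1: "\<bar>integral {T..X} (\<lambda>t. \<phi>'' t * g t)\<bar> \<le> integral {T..X} (\<lambda>t. \<phi>'' t * B t)"
    proof -
      have "norm (integral {T..X} (\<lambda>t. \<phi>'' t * g t)) \<le> integral {T..X} (\<lambda>t. \<phi>'' t * B t)"
      proof (rule integral_norm_bound_integral[OF ig iB])
        fix t assume t: "t \<in> {T..X}"
        show "norm (\<phi>'' t * g t) \<le> \<phi>'' t * B t"
          using convex[of t] gB[of t] t T by (simp add: abs_mult mult_left_mono)
      qed
      then show ?thesis by simp
    qed
    have A1I: "A1 * integral {T..X} (\<lambda>t. - \<phi>' t / t) \<le> A1 * (\<phi> T / T)"
      using neg_t[OF X] A1 by (intro mult_left_mono) auto
    have bX: "\<bar>\<phi>' X * g X\<bar> \<le> - \<phi>' X * B X"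
      using gB[OF X] dec[of X] T X by (simp add: abs_mult mult_left_mono_neg)
    have bT: "\<bar>\<phi>' T * g T\<bar> \<le> \<bar>\<phi>' T\<bar> * B T"
      using gB[of T] by (simp add: abs_mult mult_left_mono)
    \<comment> \<open>The factor 2 in the result: this quantity arises once from the boundary term
      with \<open>g T\<close> and once from the majorant.\<close>
    have "\<phi>' T * B T = - (\<bar>\<phi>' T\<bar> * B T)" using dec[OF T] by simp
    then have "\<bar>integral {T..X} (\<lambda>t. \<phi>' t * Q0 t)\<bar> \<le> 2 * (\<bar>\<phi>' T\<bar> * B T) + A1 * (\<phi> T / T) + 1 / 150 * (\<phi> T / T)"
      unfolding eq using r1 g1 A1I bX bT B_eq by linarith
    then show ?thesis by (simp add: algebra_simps add_divide_distrib)
  qed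
  \<comment> \<open>The bound does not depend on \<open>X\<close>, so it passes to the
    limit.\<close>
  have "\<bar>E\<bar> \<le> 2 * B T * \<bar>\<phi>' T\<bar> + (A1 + 1 / 150) * \<phi> T / T"
    unfolding E_def by (rule LIMSEQ_le_const2[OF tendsto_rabs[OF Q0_lim]]) (use bound in auto)
  then show ?thesis
    using summable infsum spike unfolding A_def B_def l_def I_def f_def by auto
qed

end
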